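(* Let $k\to\infty$ and let $p=p(k)$ satisfy $k^{-3/2}\ll p\ll k^{-1}$; set $\varepsilon=pk/2$. Let $L=L(k)$ satisfy $(kp)^{-2}\ll L\ll k^{-1/2}p^{-1}$ and let $\omega=\omega(k)\to\infty$ satisfy $\omega\sqrt L\ll\sqrt k$ and $\omega\ll\sqrt L$. Let $m_L,m_R$ be the numbers of balls in bins $1,\dots,L$ and in bins $k-L+1,\dots,k$ respectively, and $\mu_L=E[m_L]$, $\mu_R=E[m_R]$. Call the placement normal if $|m_L-\mu_L|<\omega\sqrt L$ and $|m_R-\mu_R|<\omega\sqrt L$. Then the probability that $\mathrm{TREE}$ occurs and the placement is normal is $\sim 2\varepsilon^2$; consequently $\Pr[\mathrm{TREE}]\sim 2\varepsilon^2$.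
   Context: Tilted balls-into-bins model with tilt $p$ (integer $k\ge2$): $k-1$ balls are placed independently, each into bin $T\in\{1,\dots,k\}$ with $\Pr[T=i]=\frac{p(1-p)^{i-1}}{1-(1-p)^k}$. Let $Z_i$ be the number of balls in bin $i$, $Y_0=1$, $Y_i=Y_{i-1}+Z_i-1$; $\mathrm{TREE}$ is the event $Y_t>0$ for all $1\le t\le k-1$. *)

theory Defs
  imports "HOL-Probability.Probability" "HOL-Library.Landau_Symbols"
begin

unbundle asymp_equiv_syntax

text \<open>The formula below defines a probability mass function only for \<open>0 < p \<le> 1\<close> and \<open>k \<ge> 1\<close>
  (see \<open>pmf_tilted_bin\<close>); otherwise \<open>embed_pmf\<close> makes the value unspecified.\<close>

definition tilted_bin :: "nat \<Rightarrow> real \<Rightarrow> nat pmf" where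
  "tilted_bin k p =
     embed_pmf (\<lambda>i. if i \<in> {1..k} then p * (1 - p) ^ (i - 1) / (1 - (1 - p) ^ k) else 0)"

lemma pmf_tilted_bin:
  fixes p :: real
  assumes "0 < p" "p \<le> 1" "1 \<le> k"
  shows "pmf (tilted_bin k p) i =
           (if i \<in> {1..k} then p * (1 - p) ^ (i - 1) / (1 - (1 - p) ^ k) else 0)"
proof -
  let ?f = "\<lambda>i. if i \<in> {1..k} then p * (1 - p) ^ (i - 1) / (1 - (1 - p) ^ k) else 0"
  have lt: "(1 - p) ^ k < 1"
    using assms power_Suc_less_one[of "1 - p" "k - 1"] by (cases "p = 1") (auto simp: power_0_left)
  have nn: "?f i \<ge> 0" for i
    using assms lt by auto
  have "(\<Sum>i=1..k. p * (1 - p) ^ (i - 1)) = (\<Sum>i<k. p * (1 - p) ^ i)"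
    by (rule sum.reindex_bij_witness[of _ Suc "\<lambda>i. i - 1"]) auto
  also have "\<dots> = 1 - (1 - p) ^ k"
    using one_diff_power_eq[of "1 - p" k] by (simp add: sum_distrib_left)
  finally have s: "(\<Sum>i=1..k. p * (1 - p) ^ (i - 1) / (1 - (1 - p) ^ k)) = 1"
    using lt by (simp flip: sum_divide_distrib)
  have "(\<integral>\<^sup>+ i. ennreal (?f i) \<partial>count_space UNIV)
      = (\<integral>\<^sup>+ i. ennreal (?f i) * indicator {1..k} i \<partial>count_space UNIV)"
    by (intro nn_integral_cong) (auto simp: indicator_def)
  also have "\<dots> = (\<integral>\<^sup>+ i. ennreal (?f i) \<partial>count_space {1..k})"
    by (simp add: nn_integral_count_space_indicator)
  also have "\<dots> = (\<Sum>i=1..k. ennreal (?f i))"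
    by (rule nn_integral_count_space_finite) simp
  also have "\<dots> = ennreal (\<Sum>i=1..k. ?f i)"
    by (intro sum_ennreal nn)
  also have "(\<Sum>i=1..k. ?f i) = (\<Sum>i=1..k. p * (1 - p) ^ (i - 1) / (1 - (1 - p) ^ k))"
    by (intro sum.cong) auto
  finally have "(\<integral>\<^sup>+ i. ennreal (?f i) \<partial>count_space UNIV) = 1"
    using s by simp
  then show ?thesis
    unfolding tilted_bin_def by (subst pmf_embed_pmf) (use nn in auto)
qed

text \<open>A placement maps each of the balls \<open>0, \<dots>, k - 2\<close> to its bin; \<open>Pi_pmf\<close> makes the coordinates
  independent. The default value \<open>0\<close> is taken only outside the set of balls.\<close>

definition placement :: "nat \<Rightarrow> real \<Rightarrow> (nat \<Rightarrow> nat) pmf" where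
  "placement k p = Pi_pmf {..<k - 1} 0 (\<lambda>_. tilted_bin k p)"

definition balls_in :: "nat \<Rightarrow> nat set \<Rightarrow> (nat \<Rightarrow> nat) \<Rightarrow> nat" where
  "balls_in k B T = card {j \<in> {..<k - 1}. T j \<in> B}"

primrec Y :: "nat \<Rightarrow> (nat \<Rightarrow> nat) \<Rightarrow> nat \<Rightarrow> int" where
  "Y k T 0 = 1"
| "Y k T (Suc i) = Y k T i + int (balls_in k {Suc i} T) - 1"

definition TREE :: "nat \<Rightarrow> (nat \<Rightarrow> nat) set" where
  "TREE k = {T. \<forall>t \<in> {1..k - 1}. Y k T t > 0}"

definition m_L :: "nat \<Rightarrow> nat \<Rightarrow> (nat \<Rightarrow> nat) \<Rightarrow> nat" where
  "m_L k L T = balls_in k {1..L} T"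

definition m_R :: "nat \<Rightarrow> nat \<Rightarrow> (nat \<Rightarrow> nat) \<Rightarrow> nat" where
  "m_R k L T = balls_in k {k - L + 1..k} T"

definition mu_L :: "nat \<Rightarrow> real \<Rightarrow> nat \<Rightarrow> real" where
  "mu_L k p L = measure_pmf.expectation (placement k p) (\<lambda>T. real (m_L k L T))"

definition mu_R :: "nat \<Rightarrow> real \<Rightarrow> nat \<Rightarrow> real" where
  "mu_R k p L = measure_pmf.expectation (placement k p) (\<lambda>T. real (m_R k L T))"

definition normal_placements :: "nat \<Rightarrow> real \<Rightarrow> nat \<Rightarrow> real \<Rightarrow> (nat \<Rightarrow> nat) set" where
  "normal_placements k p L w =
     {T. \<bar>real (m_L k L T) - mu_L k p L\<bar> < w * sqrt (real L) \<and>
         \<bar>real (m_R k L T) - mu_R k p L\<bar> < w * sqrt (real L)}"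

end

theory Submission
  imports Defs
begin

text \<open>
  Write \<open>\<lambda>\<^sub>i\<close> for the mean number of balls in bin \<open>i\<close>; then \<open>\<lambda>\<^sub>i - 1\<close> decreases almost linearly
  from \<open>\<epsilon>\<close> to \<open>-\<epsilon>\<close>. Since \<open>Y\<^sub>k = 0\<close>, the event TREE asks the walk read from the left (started at
  1, drift \<open>\<epsilon>\<close>) and the walk read from the right (started at 0, steps \<open>1 - Z\<^sub>i\<close>, drift again
  \<open>\<epsilon>\<close>) to stay positive. On the first and last \<open>L\<close> bins, \<open>L = o(k)\<close>, the counts are compared
  with independent Poisson variables: the likelihood ratio is at most \<open>1 + o(1)\<close>, and at least
  \<open>1 - o(1)\<close> for normal placements.

  For Poisson steps the left walk survives with probability \<open>\<sim> 2\<epsilon>\<close> by the exponential martingale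
  at the Cramer root \<open>\<theta> \<sim> 2\<epsilon>\<close>; the surviving part of the martingale is a survival probability of
  the tilted walk of drift \<open>-\<epsilon>\<close>, hence \<open>O(1/(\<epsilon>L)) = o(\<epsilon>)\<close>. The right walk survives with
  probability \<open>\<sim> \<epsilon>\<close> by the ballot theorem. Monotone coupling of Poisson variables transfers both
  to varying means. The second moment of the stopped walk is \<open>O(\<epsilon>L)\<close>, so survival and
  abnormality together have probability \<open>O(\<epsilon>/\<omega>\<^sup>2)\<close>. Finally, a normal surviving walk is at
  height of order \<open>\<epsilon>L\<close> after \<open>L\<close> steps, and an exponential supermartingale shows that it dies
  before the middle with probability at most \<open>exp (- \<epsilon>\<^sup>2L/32)\<close>; here the likelihood ratio need
  only be bounded.
\<close>

section \<open>Poisson distribution\<close>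

text \<open>Two scales leave room for \<open>L\<close>. A walk of drift \<epsilon> decides its fate
  within about 1/\<epsilon>^2 steps, so \<epsilon>^2 L must be large; and L/k must vanish, both to
  keep the drift near \<epsilon> and to expose only a vanishing share of the balls. The lower bound
  on \<open>p\<close> says \<epsilon>^2 k is large, so such \<open>L\<close> exist. The likelihood
  ratio is bounded above for every total, so the upper bound needs no normality; from below it
  degenerates at extreme totals. A plain Chebyshev bound O(1/\<omega>^2) for abnormality would be
  useless against survival events of probability of order \<epsilon>, hence the deviation is
  estimated on survival, for each walk separately, and multiplied by the survival bound of the other
  walk. The continuation to the middle starts from a height of order \<epsilon>L only if the
  permitted deviation is at most \<epsilon>L/4, which \<omega> sqrt L need not be. Since the normal
  event grows with \<omega> and stays inside the sure event, \<omega> is first replaced by a smaller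
  function that still tends to infinity.\<close>

lemma prob_bind_pmf:
  "measure_pmf.prob (bind_pmf M f) A = measure_pmf.expectation M (\<lambda>x. measure_pmf.prob (f x) A)"
proof -
  have "ennreal (measure_pmf.prob (bind_pmf M f) A) = emeasure (bind_pmf M f) A"
    by (simp add: measure_pmf.emeasure_eq_measure)
  also have "\<dots> = (\<integral>\<^sup>+x. ennreal (measure_pmf.prob (f x) A) \<partial>M)"
    by (subst emeasure_bind_pmf) (simp only: measure_pmf.emeasure_eq_measure)
  also have "\<dots> = ennreal (measure_pmf.expectation M (\<lambda>x. measure_pmf.prob (f x) A))"
    by (intro nn_integral_eq_integral measure_pmf.integrable_const_bound[where B=1]) auto
  finally show ?thesis
    by (simp add: integral_nonneg)
qed

lemma integrable_pmf_bounded: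
  fixes f :: "'a \<Rightarrow> real"
  assumes "\<And>x. \<bar>f x\<bar> \<le> B"
  shows "integrable (measure_pmf M) f"
  by (rule measure_pmf.integrable_const_bound[where B=B]) (use assms in auto)

text \<open>Passes from likelihood ratios to events; the multinomial and the Poisson law each take
  both roles, which gives the upper and the lower comparison.\<close>

lemma prob_le_of_pmf_le:
  assumes "\<And>x. x \<in> E \<Longrightarrow> pmf M x \<le> C * pmf Q x" "C \<ge> 0"
  shows "measure_pmf.prob M E \<le> C * measure_pmf.prob Q E"
proof -
  have "ennreal (measure_pmf.prob M E) = (\<integral>\<^sup>+x. indicator E x \<partial>M)"
    by (simp add: measure_pmf.emeasure_eq_measure)
  also have "\<dots> = (\<integral>\<^sup>+x. ennreal (pmf M x) * indicator E x \<partial>count_space UNIV)"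
    by (rule nn_integral_measure_pmf)
  also have "\<dots> \<le> (\<integral>\<^sup>+x. ennreal C * (ennreal (pmf Q x) * indicator E x) \<partial>count_space UNIV)"
  proof (rule nn_integral_mono)
    fix x
    show "ennreal (pmf M x) * indicator E x \<le> ennreal C * (ennreal (pmf Q x) * indicator E x)"
      using assms(1)[of x] assms(2)
      by (cases "x \<in> E") (auto simp flip: ennreal_mult intro!: ennreal_leI)
  qed
  also have "\<dots> = ennreal C * (\<integral>\<^sup>+x. indicator E x \<partial>Q)"
    by (subst nn_integral_cmult) (auto simp: nn_integral_measure_pmf[of Q])
  also have "\<dots> = ennreal (C * measure_pmf.prob Q E)"
    using assms(2) by (simp add: measure_pmf.emeasure_eq_measure ennreal_mult)
  finally show ?thesis
    using assms(2) by (subst (asm) ennreal_le_iff) auto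
qed

lemma integrable_pmf_nat_iff:
  fixes f :: "nat \<Rightarrow> real"
  shows "integrable (measure_pmf M) f \<longleftrightarrow> summable (\<lambda>n. \<bar>pmf M n * f n\<bar>)"
  by (simp add: measure_pmf_eq_density integrable_density integrable_count_space_nat_iff)

lemma expectation_pmf_nat:
  fixes f :: "nat \<Rightarrow> real"
  assumes "integrable (measure_pmf M) f"
  shows "(\<lambda>n. pmf M n * f n) sums measure_pmf.expectation M f"
proof -
  have i: "integrable (count_space UNIV) (\<lambda>n. pmf M n * f n)"
    using assms by (simp add: measure_pmf_eq_density integrable_density)
  have "measure_pmf.expectation M f = (\<integral>n. pmf M n * f n \<partial>count_space UNIV)"
    by (simp add: measure_pmf_eq_density integral_density)
  with sums_integral_count_space_nat[OF i] show ?thesis by simp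
qed

lemma poisson_power:
  fixes l s :: real
  assumes "l > 0" "s \<ge> 0"
  shows "integrable (poisson_pmf l) (\<lambda>x. s ^ x)"
    and "measure_pmf.expectation (poisson_pmf l) (\<lambda>x. s ^ x) = exp (l * (s - 1))"
proof -
  have eq: "pmf (poisson_pmf l) n * s ^ n = exp (-l) * ((l * s) ^ n / fact n)" for n
    using assms by (simp add: power_mult_distrib)
  have sm: "(\<lambda>n. exp (-l) * ((l * s) ^ n / fact n)) sums (exp (-l) * exp (l * s))"
    using exp_converges[of "l * s"] by (intro sums_mult) (simp add: field_simps)
  have nn: "\<bar>pmf (poisson_pmf l) n * s ^ n\<bar> = pmf (poisson_pmf l) n * s ^ n" for n
    using assms by (simp del: pmf_poisson)
  show i: "integrable (poisson_pmf l) (\<lambda>x. s ^ x)"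
    unfolding integrable_pmf_nat_iff nn by (simp only: eq sums_summable[OF sm])
  have "measure_pmf.expectation (poisson_pmf l) (\<lambda>x. s ^ x) = exp (-l) * exp (l * s)"
    using expectation_pmf_nat[OF i] sm unfolding eq by (rule sums_unique2)
  thus "measure_pmf.expectation (poisson_pmf l) (\<lambda>x. s ^ x) = exp (l * (s - 1))"
    by (simp add: mult_exp_exp algebra_simps)
qed

text \<open>The size-bias (Stein-Chen) identity, from n P[X = n] = l P[X = n - 1]. It yields the
  moments below and, applied to an exponential, the mean of the tilted step in
  \<open>sum_exp_surv\<close>.\<close>

lemma poisson_times:
  fixes f :: "nat \<Rightarrow> real"
  assumes l: "l > 0" and i: "integrable (poisson_pmf l) (\<lambda>x. f (Suc x))"
  shows "integrable (poisson_pmf l) (\<lambda>x. real x * f x)"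
    and "measure_pmf.expectation (poisson_pmf l) (\<lambda>x. real x * f x) =
           l * measure_pmf.expectation (poisson_pmf l) (\<lambda>x. f (Suc x))"
proof -
  have eq: "pmf (poisson_pmf l) (Suc n) * (real (Suc n) * f (Suc n)) =
      l * (pmf (poisson_pmf l) n * f (Suc n))" for n
  proof -
    have "pmf (poisson_pmf l) (Suc n) * real (Suc n) = l * pmf (poisson_pmf l) n"
      using l by (simp add: field_simps del: of_nat_Suc)
    thus ?thesis by (simp only: mult.assoc [symmetric])
  qed
  have "summable (\<lambda>n. \<bar>l * (pmf (poisson_pmf l) n * f (Suc n))\<bar>)"
    using summable_mult[OF i[unfolded integrable_pmf_nat_iff], of l] l by (simp add: abs_mult)
  hence "summable (\<lambda>n. \<bar>pmf (poisson_pmf l) (Suc n) * (real (Suc n) * f (Suc n))\<bar>)"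
    unfolding eq .
  thus j: "integrable (poisson_pmf l) (\<lambda>x. real x * f x)"
    unfolding integrable_pmf_nat_iff by (subst (asm) summable_Suc_iff)
  have "(\<lambda>n. l * (pmf (poisson_pmf l) n * f (Suc n))) sums
      (l * measure_pmf.expectation (poisson_pmf l) (\<lambda>x. f (Suc x)))"
    by (intro sums_mult expectation_pmf_nat i)
  hence "(\<lambda>n. pmf (poisson_pmf l) (Suc n) * (real (Suc n) * f (Suc n))) sums
      (l * measure_pmf.expectation (poisson_pmf l) (\<lambda>x. f (Suc x)))"
    unfolding eq .
  hence "(\<lambda>n. pmf (poisson_pmf l) n * (real n * f n)) sums
      (l * measure_pmf.expectation (poisson_pmf l) (\<lambda>x. f (Suc x)))"
    by (subst (asm) sums_Suc_iff) simp
  with expectation_pmf_nat[OF j]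
  show "measure_pmf.expectation (poisson_pmf l) (\<lambda>x. real x * f x) =
           l * measure_pmf.expectation (poisson_pmf l) (\<lambda>x. f (Suc x))"
    by (rule sums_unique2)
qed

lemma poisson_mean:
  assumes "l > 0"
  shows "integrable (poisson_pmf l) real" "measure_pmf.expectation (poisson_pmf l) real = l"
  using poisson_times[OF assms, of "\<lambda>_. 1"] by auto

text \<open>The shift \<open>a\<close> stands for the centred sum of the earlier steps; the absence
  of a cross term is what makes second moments add up in \<open>second_moment_stays\<close>.\<close>

lemma poisson_variance:
  assumes l: "l > 0"
  shows "integrable (poisson_pmf l) (\<lambda>x. (a + (real x - l))\<^sup>2)"
    and "measure_pmf.expectation (poisson_pmf l) (\<lambda>x. (a + (real x - l))\<^sup>2) = a\<^sup>2 + l"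
proof -
  note m = poisson_mean[OF l]
  have i2: "integrable (poisson_pmf l) (\<lambda>x. real x * real x)"
    and e2: "measure_pmf.expectation (poisson_pmf l) (\<lambda>x. real x * real x) = l * (l + 1)"
    using poisson_times[OF l, of real] m by (auto simp: add.commute)
  have eq: "(a + (real x - l))\<^sup>2 = (a - l)\<^sup>2 + 2 * (a - l) * real x + real x * real x" for x
    by (simp add: power2_eq_square algebra_simps)
  show "integrable (poisson_pmf l) (\<lambda>x. (a + (real x - l))\<^sup>2)"
    unfolding eq using m(1) i2 by auto
  show "measure_pmf.expectation (poisson_pmf l) (\<lambda>x. (a + (real x - l))\<^sup>2) = a\<^sup>2 + l"
    unfolding eq using m i2 e2 by (simp add: power2_eq_square algebra_simps)
qed

lemma poisson_add:
  assumes "a > 0" "b > 0"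
  shows "bind_pmf (poisson_pmf a) (\<lambda>x. map_pmf (\<lambda>y. x + y) (poisson_pmf b)) = poisson_pmf (a + b)"
proof (rule pmf_eqI)
  fix m :: nat
  have p: "pmf (map_pmf (\<lambda>y. x + y) (poisson_pmf b)) m =
      (if x \<le> m then b ^ (m - x) / fact (m - x) * exp (- b) else 0)" for x
  proof (cases "x \<le> m")
    case True
    have "pmf (map_pmf (\<lambda>y. x + y) (poisson_pmf b)) (x + (m - x)) = pmf (poisson_pmf b) (m - x)"
      by (rule pmf_map_inj') (auto simp: inj_def)
    with True assms show ?thesis by simp
  next
    case False
    hence "m \<notin> (\<lambda>y. x + y) ` set_pmf (poisson_pmf b)" by auto
    with False show ?thesis by (simp add: pmf_map_outside)
  qed
  let ?g = "\<lambda>x. if x \<le> m then b ^ (m - x) / fact (m - x) * exp (- b) else 0"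
  have "integrable (poisson_pmf a) ?g"
    unfolding p[symmetric]
    by (rule integrable_pmf_bounded[where B=1]) (auto simp: pmf_le_1)
  from expectation_pmf_nat[OF this]
  have "(\<lambda>x. pmf (poisson_pmf a) x * ?g x) sums
      pmf (bind_pmf (poisson_pmf a) (\<lambda>x. map_pmf (\<lambda>y. x + y) (poisson_pmf b))) m"
    by (simp add: pmf_bind p)
  moreover have "(\<lambda>x. pmf (poisson_pmf a) x * ?g x) sums (\<Sum>x\<le>m. pmf (poisson_pmf a) x * ?g x)"
    by (rule sums_finite) auto
  ultimately have "pmf (bind_pmf (poisson_pmf a) (\<lambda>x. map_pmf (\<lambda>y. x + y) (poisson_pmf b))) m =
      (\<Sum>x\<le>m. pmf (poisson_pmf a) x * ?g x)"
    by (rule sums_unique2)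
  also have "\<dots> = (\<Sum>x\<le>m. exp (-(a+b)) / fact m * (real (m choose x) * a ^ x * b ^ (m - x)))"
    using assms by (intro sum.cong) (auto simp: binomial_fact field_simps mult_exp_exp)
  also have "\<dots> = pmf (poisson_pmf (a + b)) m"
    using assms by (simp only: sum_distrib_left[symmetric] flip: binomial_ring) simp
  finally show "pmf (bind_pmf (poisson_pmf a) (\<lambda>x. map_pmf (\<lambda>y. x + y) (poisson_pmf b))) m =
    pmf (poisson_pmf (a + b)) m" .
qed

text \<open>Coupling: a variable of mean \<open>b\<close> is one of mean \<open>a\<close> plus an
  independent one of mean \<open>b - a\<close>. Two functions are needed because the remaining lists
  of means differ as well when this is iterated along a walk.\<close>

lemma poisson_expectation_mono:
  fixes f g :: "nat \<Rightarrow> real"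
  assumes "0 < a" "a \<le> b" and f: "\<And>x. \<bar>f x\<bar> \<le> B" and g: "\<And>x. \<bar>g x\<bar> \<le> B"
    and fg: "\<And>x y. x \<le> y \<Longrightarrow> f x \<le> g y"
  shows "measure_pmf.expectation (poisson_pmf a) f \<le> measure_pmf.expectation (poisson_pmf b) g"
proof (cases "a = b")
  case True
  thus ?thesis using fg
    by (auto intro!: integral_mono integrable_pmf_bounded f g)
next
  case False
  define q where "q = bind_pmf (poisson_pmf a) (\<lambda>x. map_pmf (\<lambda>y. (x, x + y)) (poisson_pmf (b - a)))"
  have "map_pmf snd q = poisson_pmf b"
    unfolding q_def using poisson_add[of a "b - a"] False assms
    by (simp add: map_bind_pmf pmf.map_comp o_def)
  moreover have "map_pmf fst q = poisson_pmf a"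
    unfolding q_def by (simp add: map_bind_pmf pmf.map_comp o_def map_pmf_const bind_return_pmf')
  moreover have "measure_pmf.expectation q (\<lambda>z. f (fst z)) \<le> measure_pmf.expectation q (\<lambda>z. g (snd
      z))"
  proof (rule integral_mono_AE)
    show "AE z in q. f (fst z) \<le> g (snd z)"
      unfolding AE_measure_pmf_iff q_def using fg by auto
  qed (auto intro!: integrable_pmf_bounded f g)
  ultimately show ?thesis
    by (metis (no_types, lifting) Bochner_Integration.integral_cong integral_map_pmf)
qed

section \<open>Walks with Poisson steps\<close>

text \<open>Independent variables as a random list, so that walks unfold by induction on the list of
  means and split at any position.\<close>

primrec poisson_vec :: "real list \<Rightarrow> nat list pmf" where
  "poisson_vec [] = return_pmf []"
| "poisson_vec (l # ls) = bind_pmf (poisson_pmf l) (\<lambda>x. map_pmf ((#) x) (poisson_vec ls))"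

lemma prob_poisson_vec_Cons:
  "measure_pmf.prob (poisson_vec (l # ls)) A =
     measure_pmf.expectation (poisson_pmf l) (\<lambda>x. measure_pmf.prob (poisson_vec ls) {xs. x # xs \<in>
         A})"
  by (simp add: prob_bind_pmf vimage_def)

lemma poisson_vec_append:
  "poisson_vec (ls @ ls') = bind_pmf (poisson_vec ls) (\<lambda>xs. map_pmf ((@) xs) (poisson_vec ls'))"
proof (induction ls)
  case Nil
  have "(@) [] = (\<lambda>x :: nat list. x)" by auto
  thus ?case by (simp add: bind_return_pmf)
next
  case (Cons l ls)
  have "(@) (x # xs) = (\<lambda>ys. x # (xs @ ys))" for x :: nat and xs by auto
  with Cons show ?case
    by (simp add: bind_assoc_pmf map_bind_pmf bind_map_pmf pmf.map_comp o_def)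
qed

lemma prob_poisson_vec_append:
  "measure_pmf.prob (poisson_vec (ls @ ls')) A =
     measure_pmf.expectation (poisson_vec ls) (\<lambda>xs. measure_pmf.prob (poisson_vec ls') {ys. xs @ ys
         \<in> A})"
  by (simp add: poisson_vec_append prob_bind_pmf vimage_def)

lemma length_poisson_vec: "xs \<in> set_pmf (poisson_vec ls) \<Longrightarrow> length xs = length ls"
  by (induction ls arbitrary: xs) auto

text \<open>The starting point \<open>y\<close> itself is not required to be positive.\<close>

primrec stays_pos :: "int \<Rightarrow> int \<Rightarrow> nat list \<Rightarrow> bool" where
  "stays_pos s y [] = True"
| "stays_pos s y (x # xs) = (0 < y + s * (int x - 1) \<and> stays_pos s (y + s * (int x - 1)) xs)"

lemma stays_pos_append:
  "stays_pos s y (xs @ ys) \<longleftrightarrow>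
     stays_pos s y xs \<and> stays_pos s (y + s * (int (sum_list xs) - int (length xs))) ys"
  by (induction xs arbitrary: y) (auto simp: algebra_simps)

lemma stays_pos_iff:
  "stays_pos s y xs \<longleftrightarrow>
     (\<forall>t\<in>{1..length xs}. 0 < y + s * (int (sum_list (take t xs)) - int t))"
proof (induction xs rule: rev_induct)
  case (snoc x xs)
  have "{1..length (xs @ [x])} = insert (Suc (length xs)) {1..length xs}" by auto
  with snoc show ?case
    by (auto simp: stays_pos_append algebra_simps)
qed auto

lemma stays_pos_mono: "stays_pos s y xs \<Longrightarrow> y \<le> y' \<Longrightarrow> stays_pos s y' xs"
  unfolding stays_pos_iff by fastforce

text \<open>The sign \<open>s\<close> is 1 for the walk from the left and -1 for the walk from the
  right, whose steps are 1 minus the count; it lets both share the recursion and the exponential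
  bound.\<close>

definition surv :: "int \<Rightarrow> real list \<Rightarrow> int \<Rightarrow> real" where
  "surv s ls y = measure_pmf.prob (poisson_vec ls) {xs. stays_pos s y xs}"

lemma surv_bounds [simp]: "0 \<le> surv s ls y" "surv s ls y \<le> 1"
  by (auto simp: surv_def)

lemma surv_Nil [simp]: "surv s [] y = 1"
  by (simp add: surv_def)

lemma surv_Cons:
  "surv s (l # ls) y = measure_pmf.expectation (poisson_pmf l)
     (\<lambda>x. if 0 < y + s * (int x - 1) then surv s ls (y + s * (int x - 1)) else 0)"
  unfolding surv_def prob_poisson_vec_Cons
  by (intro Bochner_Integration.integral_cong) auto

lemma surv_mono_start: "y \<le> y' \<Longrightarrow> surv s ls y \<le> surv s ls y'"
  unfolding surv_def
  by (intro measure_pmf.finite_measure_mono) (auto intro: stays_pos_mono)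

text \<open>A larger count lifts the left walk. One step is coupled at a time:
  \<open>surv_mono_start\<close> absorbs the higher position, the induction hypothesis the larger
  remaining means.\<close>

lemma surv_up_mono:
  assumes "list_all2 (\<lambda>a b. 0 < a \<and> a \<le> b) ls ls'"
  shows "surv 1 ls y \<le> surv 1 ls' y"
  using assms
proof (induction arbitrary: y rule: list_all2_induct)
  case (Cons l ls l' ls')
  have "surv 1 ls (y + (int x - 1)) \<le> surv 1 ls' (y + (int x' - 1))" if "x \<le> x'" for x x'
    by (rule order_trans[OF surv_mono_start Cons.IH]) (use that in auto)
  thus ?case unfolding surv_Cons
    by (intro poisson_expectation_mono[where B=1]) (use Cons.hyps in auto)
qed simp

lemma surv_down_antimono:
  assumes "list_all2 (\<lambda>a b. 0 < a \<and> a \<le> b) ls ls'"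
  shows "surv (-1) ls' y \<le> surv (-1) ls y"
  using assms
proof (induction arbitrary: y rule: list_all2_induct)
  case (Cons l ls l' ls')
  let ?f = "\<lambda>ls x. - (if 0 < y + (-1) * (int x - 1) then surv (-1) ls (y + (-1) * (int x - 1)) else
      0)"
  have *: "surv (-1) ls' (y + (-1) * (int x' - 1)) \<le> surv (-1) ls (y + (-1) * (int x - 1))"
    if "x \<le> x'" for x x'
    by (rule order_trans[OF surv_mono_start Cons.IH]) (use that in auto)
  have "measure_pmf.expectation (poisson_pmf l) (?f ls) \<le> measure_pmf.expectation (poisson_pmf l')
      (?f ls')"
    by (intro poisson_expectation_mono[where B=1]) (use Cons.hyps * in auto)
  thus ?case unfolding surv_Cons by simp
qed simp

lemma integrable_surv_step:
  "integrable (measure_pmf M) (\<lambda>x. if P x then surv s ls (f x) else 0)"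
  by (rule integrable_pmf_bounded[where B=1]) auto

text \<open>Under \<open>poisson_pmf l\<close>, a walk step multiplies \<open>exp (- \<theta> * y)\<close> by \<open>exp (psi s \<theta> l)\<close> in the mean.\<close>

definition psi :: "int \<Rightarrow> real \<Rightarrow> real \<Rightarrow> real" where
  "psi s \<theta> l = l * (exp (- (s * \<theta>)) - 1) + s * \<theta>"

lemma poisson_exp_step:
  assumes "l > 0"
  shows "integrable (poisson_pmf l) (\<lambda>x. exp (- \<theta> * real_of_int (y + s * (int x - 1)) + c))"
    and "measure_pmf.expectation (poisson_pmf l) (\<lambda>x. exp (- \<theta> * real_of_int (y + s * (int x - 1)) +
        c)) =
           exp (- \<theta> * y + psi s \<theta> l + c)"
proof -
  have eq: "exp (- \<theta> * real_of_int (y + s * (int x - 1)) + c) =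
      exp (- \<theta> * y + s * \<theta> + c) * exp (- (s * \<theta>)) ^ x" for x
    by (simp add: exp_of_nat_mult [symmetric] mult_exp_exp algebra_simps)
  note pw = poisson_power[OF assms, of "exp (- (s * \<theta>))"]
  show "integrable (poisson_pmf l) (\<lambda>x. exp (- \<theta> * real_of_int (y + s * (int x - 1)) + c))"
    unfolding eq using pw by auto
  show "measure_pmf.expectation (poisson_pmf l) (\<lambda>x. exp (- \<theta> * real_of_int (y + s * (int x - 1)) +
      c)) =
           exp (- \<theta> * y + psi s \<theta> l + c)"
    unfolding eq using pw by (simp add: mult_exp_exp psi_def algebra_simps)
qed

text \<open>Supermartingale argument: at death the height is at most 0, so exp (- \<theta> y) is at
  least 1 there. Only partial sums of \<open>psi\<close> are bounded, because near the middle the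
  drift vanishes and single increments of \<open>psi\<close> become positive.\<close>

lemma surv_exp_bound:
  assumes "\<And>l. l \<in> set ls \<Longrightarrow> l > 0" "0 \<le> B" "\<theta> \<ge> 0"
    and "\<And>j. j \<le> length ls \<Longrightarrow> (\<Sum>l\<leftarrow>take j ls. psi s \<theta> l) \<le> B"
  shows "1 - surv s ls y \<le> exp (- \<theta> * y + B)"
  using assms(1,2,4)
proof (induction ls arbitrary: y B)
  case (Cons l ls)
  define B' where "B' = B - psi s \<theta> l"
  have l: "l > 0" using Cons.prems by simp
  have B': "0 \<le> B'"
    using Cons.prems(3)[of 1] by (simp add: B'_def)
  have IH: "1 - surv s ls y \<le> exp (- \<theta> * y + B')" for y
  proof (rule Cons.IH)
    fix j assume "j \<le> length ls"
    thus "(\<Sum>l\<leftarrow>take j ls. psi s \<theta> l) \<le> B'"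
      using Cons.prems(3)[of "Suc j"] by (simp add: B'_def)
  qed (use B' Cons.prems in auto)
  let ?y = "\<lambda>x. y + s * (int x - 1)"
  have "1 - surv s (l # ls) y =
      measure_pmf.expectation (poisson_pmf l) (\<lambda>x. 1 - (if 0 < ?y x then surv s ls (?y x) else 0))"
    by (simp add: surv_Cons integrable_surv_step)
  also have "\<dots> \<le> measure_pmf.expectation (poisson_pmf l) (\<lambda>x. exp (- \<theta> * real_of_int (?y x) + B'))"
  proof (rule integral_mono)
    fix x
    show "1 - (if 0 < ?y x then surv s ls (?y x) else 0) \<le> exp (- \<theta> * real_of_int (?y x) + B')"
    proof (cases "0 < ?y x")
      case False
      hence "0 \<le> - \<theta> * real_of_int (?y x)"
        using \<open>\<theta> \<ge> 0\<close> by (simp add: mult_nonneg_nonpos del: of_int_add of_int_diff of_int_mult)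
      with False B' show ?thesis by simp
    qed (use IH[of "?y x"] in simp)
  qed (use poisson_exp_step[OF l] in \<open>auto intro: integrable_surv_step\<close>)
  also have "\<dots> = exp (- \<theta> * y + B)"
    by (subst poisson_exp_step[OF l]) (simp add: B'_def)
  finally show ?case .
qed simp

text \<open>The mean of \<open>exp (- \<theta> * y)\<close> over the paths that survive \<open>n\<close> steps. If \<open>psi 1 \<theta> l = 0\<close>,
  optional stopping expresses the survival probability through it.\<close>

primrec exp_surv :: "real \<Rightarrow> real \<Rightarrow> nat \<Rightarrow> int \<Rightarrow> real" where
  "exp_surv \<theta> l 0 y = exp (- \<theta> * y)"
| "exp_surv \<theta> l (Suc n) y = measure_pmf.expectation (poisson_pmf l)
     (\<lambda>x. if 0 < y + (int x - 1) then exp_surv \<theta> l n (y + (int x - 1)) else 0)"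

text \<open>Weighting a step by exp (- \<theta> x) turns its law into Poisson of mean l exp (-
  \<theta>); \<open>c\<close> is the downward drift of this tilted walk.\<close>

context
  fixes l \<theta> c :: real
  assumes l: "l > 0" and \<theta>: "\<theta> > 0" and root: "l * (1 - exp (- \<theta>)) = \<theta>"
    and c_def: "c = 1 - l * exp (- \<theta>)" and c: "c > 0"
begin

lemma psi_root: "psi 1 \<theta> l = 0"
  using root by (simp add: psi_def algebra_simps)

lemma exp_surv_bounds: "y \<ge> 0 \<Longrightarrow> 0 \<le> exp_surv \<theta> l n y \<and> exp_surv \<theta> l n y \<le> 1"
proof (induction n arbitrary: y)
  case (Suc n)
  have "exp_surv \<theta> l (Suc n) y \<le> measure_pmf.expectation (poisson_pmf l) (\<lambda>x. 1)"
    unfolding exp_surv.simps using Suc.IH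
    by (intro integral_mono integrable_pmf_bounded[where B=1]) (auto simp: abs_le_iff intro:
        order_trans[of _ 0])
  moreover have "0 \<le> exp_surv \<theta> l (Suc n) y"
    unfolding exp_surv.simps using Suc.IH by (intro Bochner_Integration.integral_nonneg) auto
  ultimately show ?case by simp
qed (use \<theta> in auto)

lemma integrable_exp_surv_step:
  "integrable (poisson_pmf l) (\<lambda>x. if 0 < y + (int x - 1) then exp_surv \<theta> l n (y + (int x - 1)) else
      0)"
  by (rule integrable_pmf_bounded[where B=1]) (use exp_surv_bounds in \<open>auto simp: abs_le_iff intro:
      order_trans[of _ 0]\<close>)

lemma exp_surv_decreasing: "exp_surv \<theta> l (Suc n) y \<le> exp_surv \<theta> l n y"
proof (induction n arbitrary: y)
  case 0
  have "exp_surv \<theta> l (Suc 0) y \<le>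
      measure_pmf.expectation (poisson_pmf l) (\<lambda>x. exp (- \<theta> * real_of_int (y + 1 * (int x - 1)) +
          0))"
    unfolding exp_surv.simps(2)
    by (intro integral_mono integrable_exp_surv_step poisson_exp_step(1)[OF l]) auto
  also have "\<dots> = exp_surv \<theta> l 0 y"
    by (subst poisson_exp_step[OF l]) (simp add: psi_root)
  finally show ?case .
next
  case (Suc n)
  note a = exp_surv.simps(2)[of \<theta> l "Suc n" y] and b = exp_surv.simps(2)[of \<theta> l n y]
  show ?case
    unfolding a b
    by (intro integral_mono integrable_exp_surv_step) (use Suc.IH in \<open>auto simp del:
        exp_surv.simps\<close>)
qed

lemma exp_surv_antimono: "m \<le> n \<Longrightarrow> exp_surv \<theta> l n y \<le> exp_surv \<theta> l m y"
  by (rule lift_Suc_antimono_le) (rule exp_surv_decreasing)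

text \<open>\<open>exp_surv \<theta> l j y\<close> is exp (- \<theta> y) times the probability that
  the tilted walk survives \<open>j\<close> steps. Summed over \<open>j\<close> this is a truncated
  mean lifetime, at most y / c as in Wald's identity; the induction checks that y exp (- \<theta> y)
  / c dominates the recursion.\<close>

lemma sum_exp_surv: "y \<ge> 1 \<Longrightarrow> (\<Sum>j<n. exp_surv \<theta> l j y) \<le> y * exp (- \<theta> * y) / c"
proof (induction n arbitrary: y)
  case (Suc n)
  let ?y = "\<lambda>x. y + (int x - 1)"
  let ?e = "\<lambda>x. exp (- \<theta> * real_of_int (y + 1 * (int x - 1)) + 0)"
  note e = poisson_exp_step[OF l, of \<theta> y 1 0]
  have se: "?e (Suc x) = exp (- \<theta>) * ?e x" for x
    by (simp add: mult_exp_exp algebra_simps)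
  have xe: "integrable (poisson_pmf l) (\<lambda>x. real x * ?e x)"
    "measure_pmf.expectation (poisson_pmf l) (\<lambda>x. real x * ?e x) = l * (exp (- \<theta>) * exp (- \<theta> * y))"
    using poisson_times[OF l, of ?e] e unfolding se by (auto simp: psi_root)
  have ye: "real_of_int (?y x) * ?e x = (real_of_int y - 1) * ?e x + real x * ?e x" for x
    by (simp add: algebra_simps)
  have "(\<Sum>j<Suc n. exp_surv \<theta> l j y) = exp (- \<theta> * y) + (\<Sum>j<n. exp_surv \<theta> l (Suc j) y)"
    by (subst sum.lessThan_Suc_shift) simp
  also have "(\<Sum>j<n. exp_surv \<theta> l (Suc j) y) = measure_pmf.expectation (poisson_pmf l)
      (\<lambda>x. \<Sum>j<n. if 0 < ?y x then exp_surv \<theta> l j (?y x) else 0)"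
    unfolding exp_surv.simps by (subst Bochner_Integration.integral_sum) (auto intro:
        integrable_exp_surv_step)
  also have "\<dots> \<le> measure_pmf.expectation (poisson_pmf l) (\<lambda>x. real_of_int (?y x) * ?e x / c)"
  proof (intro integral_mono Bochner_Integration.integrable_sum integrable_exp_surv_step)
    show "integrable (poisson_pmf l) (\<lambda>x. real_of_int (?y x) * ?e x / c)"
      unfolding ye using e(1) xe(1) by auto
    fix x
    show "(\<Sum>j<n. if 0 < ?y x then exp_surv \<theta> l j (?y x) else 0) \<le> real_of_int (?y x) * ?e x / c"
    proof (cases "0 < ?y x")
      case True
      thus ?thesis using Suc.IH[of "?y x"] by simp
    next
      case False
      \<comment> \<open>Steps are at least -1 and the start is at least 1, so death happens exactly
        at 0, where both sides vanish.\<close>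
      hence "?y x = 0" using Suc.prems by linarith
      thus ?thesis by simp
    qed
  qed
  also have "\<dots> = ((real_of_int y - 1) * exp (- \<theta> * y) + l * (exp (- \<theta>) * exp (- \<theta> * y))) / c"
    unfolding ye using e xe by (simp add: psi_root)
  also have "exp (- \<theta> * y) + \<dots> = y * exp (- \<theta> * y) / c"
    using c by (simp add: field_simps c_def)
  finally show ?case by simp
qed (use c in auto)

text \<open>Optional stopping for the martingale exp (- \<theta> y): the walk descends by unit steps
  and dies exactly at 0, where the martingale equals 1, so its initial value splits into the death
  probability and \<open>exp_surv\<close>.\<close>

lemma surv_le_exp_surv:
  "y \<ge> 1 \<Longrightarrow> surv 1 (replicate n l) y \<le> 1 - exp (- \<theta> * y) + exp_surv \<theta> l n y"
proof (induction n arbitrary: y)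
  case (Suc n)
  let ?y = "\<lambda>x. y + 1 * (int x - 1)"
  note e = poisson_exp_step[OF l, of \<theta> y 1 0]
  let ?v = "\<lambda>x. if 0 < y + (int x - 1) then exp_surv \<theta> l n (y + (int x - 1)) else 0"
  have "surv 1 (replicate (Suc n) l) y \<le> measure_pmf.expectation (poisson_pmf l)
      (\<lambda>x. (1 - exp (- \<theta> * real_of_int (?y x) + 0)) + ?v x)"
    unfolding replicate_Suc surv_Cons
  proof (intro integral_mono integrable_surv_step Bochner_Integration.integrable_add
      integrable_exp_surv_step
      Bochner_Integration.integrable_diff e)
    fix x
    show "(if 0 < ?y x then surv 1 (replicate n l) (?y x) else 0) \<le>
        (1 - exp (- \<theta> * real_of_int (?y x) + 0)) + ?v x"
    proof (cases "0 < ?y x")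
      case True
      thus ?thesis using Suc.IH[of "?y x"] by simp
    next
      case False
      hence "y + (int x - 1) = 0" using Suc.prems by simp
      thus ?thesis by simp
    qed
  qed auto
  also have "\<dots> = 1 - exp (- \<theta> * y) + exp_surv \<theta> l (Suc n) y"
    using e integrable_exp_surv_step by (simp add: psi_root)
  finally show ?case .
qed simp

text \<open>A decreasing sequence whose sums stay below 1 / c has n-th term at most 1 / (c
  n).\<close>

lemma surv_replicate_le:
  assumes "n > 0"
  shows "surv 1 (replicate n l) 1 \<le> 1 - exp (- \<theta>) + 1 / (c * n)"
proof -
  have "real n * exp_surv \<theta> l n 1 = (\<Sum>j<n. exp_surv \<theta> l n 1)" by simp
  also have "\<dots> \<le> (\<Sum>j<n. exp_surv \<theta> l j 1)"
    by (intro sum_mono exp_surv_antimono) auto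
  also have "\<dots> \<le> exp (- \<theta>) / c" using sum_exp_surv[of 1 n] by simp
  also have "\<dots> \<le> 1 / c" using c \<theta> by (intro divide_right_mono) auto
  finally have "exp_surv \<theta> l n 1 \<le> 1 / (c * n)"
    using assms c by (simp add: field_simps)
  with surv_le_exp_surv[of 1 n] show ?thesis by simp
qed

lemma sum_surv_replicate_le:
  "(\<Sum>j<n. surv 1 (replicate j l) 1) \<le> n * (1 - exp (- \<theta>)) + 1 / c"
proof -
  have "(\<Sum>j<n. surv 1 (replicate j l) 1) \<le> (\<Sum>j<n. 1 - exp (- \<theta>) + exp_surv \<theta> l j 1)"
    using surv_le_exp_surv[of 1] by (intro sum_mono) auto
  also have "\<dots> = n * (1 - exp (- \<theta>)) + (\<Sum>j<n. exp_surv \<theta> l j 1)"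
    by (simp add: sum.distrib)
  also have "(\<Sum>j<n. exp_surv \<theta> l j 1) \<le> exp (- \<theta>) / c" using sum_exp_surv[of 1 n] by simp
  also have "\<dots> \<le> 1 / c" using c \<theta> by (intro divide_right_mono) auto
  finally show ?thesis by simp
qed

end

section \<open>Ballot theorem and the right walk with constant means\<close>

lemma prob_poisson_vec_snoc:
  "measure_pmf.prob (poisson_vec (ls @ [l])) A =
     measure_pmf.expectation (poisson_vec ls) (\<lambda>xs. measure_pmf.prob (poisson_pmf l) {x. xs @ [x] \<in>
         A})"
proof -
  have "poisson_vec [l] = map_pmf (\<lambda>x. [x]) (poisson_pmf l)"
    by (simp add: map_pmf_def bind_return_pmf)
  thus ?thesis
    by (simp only: prob_poisson_vec_append measure_map_pmf) (simp add: vimage_def)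
qed

lemma sum_binomial_index:
  fixes n :: nat
  shows "(\<Sum>i\<le>m. real i * (real (m choose i) * real n ^ i)) = real m * real n * (real n + 1) ^ (m -
      1)"
proof (cases m)
  case (Suc m')
  have "(\<Sum>i\<le>Suc m'. real i * (real (Suc m' choose i) * real n ^ i)) =
      (\<Sum>i\<le>m'. real (Suc i) * (real (Suc m' choose Suc i) * real n ^ Suc i))"
    by (subst sum.atMost_Suc_shift) simp
  also have "\<dots> = (\<Sum>i\<le>m'. real (Suc m') * real n * (real (m' choose i) * real n ^ i * 1 ^ (m' - i)))"
  proof (rule sum.cong)
    fix i
    have "real (Suc i) * real (Suc m' choose Suc i) = real (Suc m') * real (m' choose i)"
      using Suc_times_binomial_eq[of m' i] by (metis of_nat_mult mult.commute)
    thus "real (Suc i) * (real (Suc m' choose Suc i) * real n ^ Suc i) =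
        real (Suc m') * real n * (real (m' choose i) * real n ^ i * 1 ^ (m' - i))"
      by (simp only: mult.assoc[symmetric]) (simp add: algebra_simps)
  qed simp
  also have "\<dots> = real (Suc m') * real n * (real n + 1) ^ m'"
    by (simp only: sum_distrib_left[symmetric] binomial_ring)
  finally show ?thesis by (simp add: Suc)
qed simp

text \<open>The ballot theorem: given the total \<open>m\<close>, staying positive has probability
  (n - m) / n. The induction peels off the last step and closes because the linear weight of the
  hypothesis turns the convolution into two binomial sums.\<close>

lemma ballot_poisson:
  assumes v: "v > 0" and n: "n \<ge> 1"
  shows "m \<le> n \<Longrightarrow> measure_pmf.prob (poisson_vec (replicate n v)) {xs. stays_pos (-1) 0 xs \<and> sum_list
      xs = m} =
           (real n - real m) / real n * pmf (poisson_pmf (v * n)) m"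
  using n
proof (induction n arbitrary: m rule: nat_induct_at_least)
  case base
  have "{xs. stays_pos (-1) 0 xs \<and> sum_list xs = m} \<inter> {xs. length xs = 1} = (if m = 0 then {[0]}
      else {})"
    by (auto simp: length_Suc_conv)
  moreover have "measure_pmf.prob (poisson_vec (replicate 1 v)) {xs. stays_pos (-1) 0 xs \<and> sum_list
      xs = m} =
     measure_pmf.prob (poisson_vec (replicate 1 v)) ({xs. stays_pos (-1) 0 xs \<and> sum_list xs = m} \<inter>
         {xs. length xs = 1})"
    by (intro measure_pmf.finite_measure_eq_AE)
       (auto simp: AE_measure_pmf_iff dest!: length_poisson_vec)
  moreover have "measure_pmf.prob (poisson_vec (replicate 1 v)) {[0]} = pmf (poisson_pmf v) 0"
  proof -
    have "measure_pmf.prob (poisson_vec (replicate 1 v)) {[0]} =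
        measure_pmf.prob (map_pmf (\<lambda>x. [x]) (poisson_pmf v)) {[0]}"
      by (simp add: map_pmf_def bind_return_pmf)
    also have "\<dots> = measure_pmf.prob (poisson_pmf v) {0}"
      unfolding measure_map_pmf by (rule arg_cong[where f="measure_pmf.prob _"]) auto
    finally show ?thesis by (simp only: measure_pmf_single)
  qed
  ultimately show ?case using base by (cases "m = 0") auto
next
  case (Suc n)
  show ?case
  proof (cases "m = Suc n")
    \<comment> \<open>The induction hypothesis covers totals up to \<open>n\<close> only; here the
      final height is 0, so both sides vanish.\<close>
    case True
    have "measure_pmf.prob (poisson_vec (replicate (Suc n) v)) {xs. stays_pos (-1) 0 xs \<and> sum_list
        xs = m} = 0"
    proof (subst measure_pmf_zero_iff, intro equals0I, clarify)
      fix xs assume "xs \<in> set_pmf (poisson_vec (replicate (Suc n) v))" and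
        s: "stays_pos (-1) 0 xs" "m = sum_list xs"
      hence "length xs = Suc n" using length_poisson_vec by fastforce
      thus False using s True unfolding stays_pos_iff by (auto dest!: bspec[where x="Suc n"])
    qed
    thus ?thesis using True by simp
  next
    case False
    hence m: "m \<le> n" using Suc.prems by simp
    let ?A = "\<lambda>i. {xs. stays_pos (-1) 0 xs \<and> sum_list xs = i}"
    let ?P = "poisson_vec (replicate n v)"
    have "measure_pmf.prob (poisson_vec (replicate (Suc n) v)) (?A m) =
        measure_pmf.expectation ?P (\<lambda>xs. measure_pmf.prob (poisson_pmf v) {x. xs @ [x] \<in> ?A m})"
      by (simp only: replicate_Suc replicate_app_Cons_same[symmetric]
          replicate_append_same[symmetric]
            prob_poisson_vec_snoc)
    also have "\<dots> = measure_pmf.expectation ?P (\<lambda>xs. \<Sum>i\<le>m. pmf (poisson_pmf v) (m - i) * indicator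
        (?A i) xs)"
    proof (intro Bochner_Integration.integral_cong_AE AE_pmfI)
      fix xs assume "xs \<in> set_pmf ?P"
      hence len: "length xs = n" using length_poisson_vec by fastforce
      show "measure_pmf.prob (poisson_pmf v) {x. xs @ [x] \<in> ?A m} =
          (\<Sum>i\<le>m. pmf (poisson_pmf v) (m - i) * indicator (?A i) xs)"
      proof (cases "stays_pos (-1) 0 xs \<and> sum_list xs \<le> m")
        case True
        have "{x. xs @ [x] \<in> ?A m} = {m - sum_list xs}"
          using True m len by (auto simp: stays_pos_append)
        moreover have "(\<Sum>i\<le>m. pmf (poisson_pmf v) (m - i) * indicator (?A i) xs) =
            (\<Sum>i\<le>m. if i = sum_list xs then pmf (poisson_pmf v) (m - sum_list xs) else 0)"
          using True by (intro sum.cong) (auto simp: indicator_def)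
        ultimately show ?thesis using True by (simp add: measure_pmf_single)
      next
        case F: False
        have "{x. xs @ [x] \<in> ?A m} = {}"
          using F by (auto simp: stays_pos_append)
        moreover have "(\<Sum>i\<le>m. pmf (poisson_pmf v) (m - i) * indicator (?A i) xs) = 0"
          using F by (intro sum.neutral) auto
        ultimately show ?thesis by (simp only: measure_empty)
      qed
    qed auto
    also have "\<dots> = (\<Sum>i\<le>m. pmf (poisson_pmf v) (m - i) * measure_pmf.prob ?P (?A i))"
      by (subst Bochner_Integration.integral_sum) (auto simp: measure_pmf.emeasure_eq_measure)
    also have "\<dots> = (\<Sum>i\<le>m. pmf (poisson_pmf v) (m - i) *
        ((real n - real i) / real n * pmf (poisson_pmf (v * n)) i))"
      using m by (intro sum.cong refl) (simp add: Suc.IH)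
    \<comment> \<open>Exponentials and powers of \<open>v\<close> combine to a factor free of
      \<open>i\<close>; splitting 1 - i/n leaves the binomial theorem and
      \<open>sum_binomial_index\<close>.\<close>
    also have "\<dots> = (\<Sum>i\<le>m. exp (- (v * (n + 1))) * v ^ m / fact m *
        ((real (m choose i) * real n ^ i * 1 ^ (m - i)) - real i * (real (m choose i) * real n ^ i)
            / real n))"
    proof (intro sum.cong refl)
      fix i assume "i \<in> {..m}"
      hence i: "i \<le> m" by simp
      have n0: "real n > 0" using Suc.hyps by simp
      have b: "real (m choose i) / fact m = 1 / (fact i * fact (m - i))"
        using i by (simp add: binomial_fact)
      have e: "exp (- (v * (n + 1))) = exp (- (v * n)) * exp (- v)"
        by (simp add: mult_exp_exp algebra_simps)
      have vm: "v ^ m = v ^ i * v ^ (m - i)" using i by (simp flip: power_add)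
      have "pmf (poisson_pmf v) (m - i) * ((real n - real i) / real n * pmf (poisson_pmf (v * n)) i)
          =
         exp (- (v * n)) * exp (- v) * (v ^ i * v ^ (m - i)) * (1 / (fact i * fact (m - i))) *
           (real n ^ i * (1 - real i / real n))"
        using v n0 by (simp add: power_mult_distrib diff_divide_distrib mult_ac)
      also have "\<dots> = exp (- (v * (n + 1))) * v ^ m * (real (m choose i) / fact m) *
           (real n ^ i * (1 - real i / real n))"
        by (simp only: b e vm)
      finally show "pmf (poisson_pmf v) (m - i) * ((real n - real i) / real n * pmf (poisson_pmf (v
          * n)) i) =
        exp (- (v * (n + 1))) * v ^ m / fact m *
        ((real (m choose i) * real n ^ i * 1 ^ (m - i)) - real i * (real (m choose i) * real n ^ i)
            / real n)"
        by (simp add: diff_divide_distrib right_diff_distrib mult_ac)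
    qed
    also have "\<dots> = exp (- (v * (n + 1))) * v ^ m / fact m *
        ((real n + 1) ^ m - real m * real n * (real n + 1) ^ (m - 1) / real n)"
      by (simp only: sum_distrib_left[symmetric] sum_subtractf sum_divide_distrib[symmetric]
          sum_binomial_index binomial_ring)
    also have "(real n + 1) ^ m - real m * real n * (real n + 1) ^ (m - 1) / real n =
        (real n + 1) ^ m * ((real (Suc n) - real m) / real (Suc n))"
      using Suc.hyps by (cases m) (auto simp: field_simps)
    also have "exp (- (v * (n + 1))) * v ^ m / fact m * \<dots> =
        (real (Suc n) - real m) / real (Suc n) * pmf (poisson_pmf (v * Suc n)) m"
    proof -
      have "pmf (poisson_pmf (v * Suc n)) m = v ^ m * (real n + 1) ^ m / fact m * exp (- (v * (n +
          1)))"
        using v by (simp add: power_mult_distrib add.commute)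
      thus ?thesis by (simp only:) (simp add: mult_ac)
    qed
    finally show ?thesis .
  qed
qed

text \<open>Survival forces a total below \<open>n\<close>; \<open>max\<close> extends the ballot
  weight by zero to the other totals, so the sum over totals becomes an expectation.\<close>

lemma surv_down_replicate:
  assumes v: "v > 0" and n: "n \<ge> 1"
  shows "surv (-1) (replicate n v) 0 =
    measure_pmf.expectation (poisson_pmf (v * n)) (\<lambda>x. max 0 (1 - real x / real n))"
proof -
  let ?P = "poisson_vec (replicate n v)"
  let ?A = "\<lambda>i. {xs. stays_pos (-1) 0 xs \<and> sum_list xs = i}"
  have "surv (-1) (replicate n v) 0 = measure_pmf.prob ?P (\<Union>i<n. ?A i)"
    unfolding surv_def
  proof (intro measure_pmf.finite_measure_eq_AE AE_pmfI)
    fix xs assume "xs \<in> set_pmf ?P"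
    hence len: "length xs = n" using length_poisson_vec by fastforce
    have "stays_pos (-1) 0 xs \<Longrightarrow> sum_list xs < n"
      using n len unfolding stays_pos_iff by (auto dest!: bspec[where x=n])
    thus "xs \<in> {xs. stays_pos (-1) 0 xs} \<longleftrightarrow> xs \<in> (\<Union>i<n. ?A i)" by auto
  qed auto
  also have "\<dots> = (\<Sum>i<n. measure_pmf.prob ?P (?A i))"
    by (rule measure_pmf.finite_measure_finite_Union) (auto simp: disjoint_family_on_def)
  also have "\<dots> = (\<Sum>i<n. pmf (poisson_pmf (v * n)) i * max 0 (1 - real i / real n))"
    using v n by (intro sum.cong) (auto simp: ballot_poisson field_simps simp del: pmf_poisson)
  finally have 1: "surv (-1) (replicate n v) 0 = \<dots>" .
  have "(\<lambda>i. pmf (poisson_pmf (v * n)) i * max 0 (1 - real i / real n)) sums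
     (\<Sum>i<n. pmf (poisson_pmf (v * n)) i * max 0 (1 - real i / real n))"
    using n by (intro sums_finite) (auto simp: field_simps)
  moreover have "(\<lambda>i. pmf (poisson_pmf (v * n)) i * max 0 (1 - real i / real n)) sums
     measure_pmf.expectation (poisson_pmf (v * n)) (\<lambda>x. max 0 (1 - real x / real n))"
    by (intro expectation_pmf_nat integrable_pmf_bounded[where B=1]) auto
  ultimately show ?thesis unfolding 1 by (rule sums_unique2)
qed

lemma surv_down_replicate_ge:
  assumes v: "v > 0" and n: "n \<ge> 1"
  shows "1 - v \<le> surv (-1) (replicate n v) 0"
proof -
  have vn: "v * n > 0" using assms by simp
  note m = poisson_mean[OF vn]
  have "1 - v = measure_pmf.expectation (poisson_pmf (v * n)) (\<lambda>x. 1 - real x / real n)"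
    using m n by simp
  also have "\<dots> \<le> measure_pmf.expectation (poisson_pmf (v * n)) (\<lambda>x. max 0 (1 - real x / real n))"
    using m by (intro integral_mono integrable_pmf_bounded[where B=1 and f="\<lambda>x. max 0 (1 - real x /
        real n)"]) auto
  finally show ?thesis by (simp add: surv_down_replicate[OF v n])
qed

lemma surv_down_replicate_le:
  assumes v: "0 < v" "v \<le> 1" and n: "n \<ge> 1"
  shows "surv (-1) (replicate n v) 0 \<le> 1 - v + 1 / sqrt n"
proof -
  have vn: "v * n > 0" using assms by simp
  note m = poisson_variance[OF vn, of 0]
  let ?s = "sqrt n"
  have s: "?s > 0" "?s * ?s = n" using n by auto
  have "max 0 (1 - real x / real n) \<le> 1 - v + ((0 + (real x - v * n))\<^sup>2 / ?s + ?s) / 2 / n" for x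
  proof -
    let ?d = "real x - v * n"
    \<comment> \<open>Arithmetic-geometric mean with the scale sqrt n of the standard deviation: the
      mean absolute deviation is reduced to the variance.\<close>
    have "\<bar>?d\<bar> \<le> (?d\<^sup>2 / ?s + ?s) / 2"
    proof -
      have "0 \<le> (\<bar>?d\<bar> - ?s)\<^sup>2 / ?s" using s by simp
      also have "\<dots> = ?d\<^sup>2 / ?s + ?s - 2 * \<bar>?d\<bar>"
        using s by (simp add: power2_diff field_simps)
      finally show ?thesis by simp
    qed
    hence "\<bar>?d\<bar> / n \<le> (?d\<^sup>2 / ?s + ?s) / 2 / n" using n by (intro divide_right_mono) auto
    moreover have "1 - real x / real n \<le> 1 - v + \<bar>?d\<bar> / n"
      using n by (simp add: field_simps abs_if)
    moreover have "0 \<le> 1 - v + \<bar>?d\<bar> / n" using v by simp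
    ultimately show ?thesis by simp
  qed
  hence "surv (-1) (replicate n v) 0 \<le> measure_pmf.expectation (poisson_pmf (v * n))
      (\<lambda>x. 1 - v + ((0 + (real x - v * n))\<^sup>2 / ?s + ?s) / 2 / n)"
    unfolding surv_down_replicate[OF v(1) n] using m
    by (intro integral_mono integrable_pmf_bounded[where B=1 and f="\<lambda>x. max 0 (1 - real x / real
        n)"]) auto
  also have "\<dots> = 1 - v + (v * n / ?s + ?s) / 2 / n"
    using m by simp
  also have "v * n / ?s \<le> 1 * n / ?s" using v s by (intro divide_right_mono mult_right_mono) auto
  also have "1 * n / ?s = ?s" using s by (simp add: field_simps)
  also have "1 - v + (?s + ?s) / 2 / n = 1 - v + 1 / ?s" using s by (simp add: field_simps)
  finally show ?thesis using n by (simp add: divide_right_mono)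
qed

text \<open>Survivors of one more step are among the earlier survivors, and the new step is centred
  and independent of them, so it adds at most \<open>b\<close> times their probability. The sum is a
  truncated mean lifetime, far smaller than the length; this is the source of the gain over plain
  Chebyshev.\<close>

lemma second_moment_stays:
  assumes "\<And>l. l \<in> set ls \<Longrightarrow> 0 < l \<and> l \<le> b"
  shows "(\<integral>\<^sup>+xs. ennreal ((real (sum_list xs) - sum_list ls)\<^sup>2) * indicator {xs. stays_pos s y xs}
      xs \<partial>poisson_vec ls)
     \<le> ennreal (b * (\<Sum>j<length ls. surv s (take j ls) y))"
  using assms
proof (induction ls rule: rev_induct)
  case (snoc l ls)
  let ?S = "{xs. stays_pos s y xs}"
  have l: "0 < l" "l \<le> b" using snoc.prems by auto
  have "(\<integral>\<^sup>+xs. ennreal ((real (sum_list xs) - sum_list (ls @ [l]))\<^sup>2) * indicator ?S xs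
      \<partial>poisson_vec (ls @ [l]))
      = (\<integral>\<^sup>+xs. (\<integral>\<^sup>+x. ennreal (((real (sum_list xs) - sum_list ls) + (real x - l))\<^sup>2) * indicator
          ?S (xs @ [x]) \<partial>poisson_pmf l) \<partial>poisson_vec ls)"
    by (simp add: poisson_vec_append bind_return_pmf algebra_simps)
  also have "\<dots> \<le> (\<integral>\<^sup>+xs. (\<integral>\<^sup>+x. ennreal (((real (sum_list xs) - sum_list ls) + (real x - l))\<^sup>2)
      \<partial>poisson_pmf l) * indicator ?S xs \<partial>poisson_vec ls)"
  proof (rule nn_integral_mono)
    fix xs
    show "(\<integral>\<^sup>+x. ennreal (((real (sum_list xs) - sum_list ls) + (real x - l))\<^sup>2) * indicator ?S (xs
        @ [x]) \<partial>poisson_pmf l) \<le>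
      (\<integral>\<^sup>+x. ennreal (((real (sum_list xs) - sum_list ls) + (real x - l))\<^sup>2) \<partial>poisson_pmf l) *
          indicator ?S xs"
      by (cases "stays_pos s y xs")
         (auto simp: stays_pos_append indicator_def intro!: nn_integral_mono)
  qed
  also have "\<dots> = (\<integral>\<^sup>+xs. ennreal ((real (sum_list xs) - sum_list ls)\<^sup>2) * indicator ?S xs + ennreal
      l * indicator ?S xs \<partial>poisson_vec ls)"
  proof (rule nn_integral_cong)
    fix xs
    have "(\<integral>\<^sup>+x. ennreal (((real (sum_list xs) - sum_list ls) + (real x - l))\<^sup>2) \<partial>poisson_pmf l) =
        ennreal ((real (sum_list xs) - sum_list ls)\<^sup>2 + l)"
      using poisson_variance[OF l(1)] by (subst nn_integral_eq_integral) auto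
    also have "\<dots> = ennreal ((real (sum_list xs) - sum_list ls)\<^sup>2) + ennreal l"
      using l by (intro ennreal_plus) auto
    finally show "(\<integral>\<^sup>+x. ennreal (((real (sum_list xs) - sum_list ls) + (real x - l))\<^sup>2)
        \<partial>poisson_pmf l) * indicator ?S xs =
      ennreal ((real (sum_list xs) - sum_list ls)\<^sup>2) * indicator ?S xs + ennreal l * indicator ?S
          xs"
      by (simp add: distrib_right)
  qed
  also have "\<dots> = (\<integral>\<^sup>+xs. ennreal ((real (sum_list xs) - sum_list ls)\<^sup>2) * indicator ?S xs
      \<partial>poisson_vec ls)
     + ennreal (l * surv s ls y)"
    using l by (subst nn_integral_add)
      (auto simp: nn_integral_cmult measure_pmf.emeasure_eq_measure surv_def ennreal_mult)
  also have "\<dots> \<le> ennreal (b * (\<Sum>j<length ls. surv s (take j ls) y)) + ennreal (b * surv s ls y)"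
    using l by (intro add_mono snoc.IH ennreal_leI mult_right_mono) (use snoc.prems in auto)
  also have "\<dots> = ennreal (b * (\<Sum>j<length (ls @ [l]). surv s (take j (ls @ [l])) y))"
    using l by (subst ennreal_plus[symmetric]) (auto simp: sum_nonneg distrib_left)
  finally show ?case .
qed simp

lemma prob_stays_deviation:
  assumes "\<And>l. l \<in> set ls \<Longrightarrow> 0 < l \<and> l \<le> b" "D > 0" "b \<ge> 0"
  shows "measure_pmf.prob (poisson_vec ls) {xs. stays_pos s y xs \<and> \<bar>real (sum_list xs) - sum_list
      ls\<bar> \<ge> D}
    \<le> b * (\<Sum>j<length ls. surv s (take j ls) y) / D\<^sup>2"
proof -
  let ?E = "{xs. stays_pos s y xs \<and> \<bar>real (sum_list xs) - sum_list ls\<bar> \<ge> D}"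
  have "ennreal (D\<^sup>2 * measure_pmf.prob (poisson_vec ls) ?E) = (\<integral>\<^sup>+xs. ennreal (D\<^sup>2) * indicator ?E
      xs \<partial>poisson_vec ls)"
    by (subst nn_integral_cmult) (auto simp: measure_pmf.emeasure_eq_measure ennreal_mult)
  also have "\<dots> \<le> (\<integral>\<^sup>+xs. ennreal ((real (sum_list xs) - sum_list ls)\<^sup>2) * indicator {xs. stays_pos s
      y xs} xs \<partial>poisson_vec ls)"
  proof (intro nn_integral_mono)
    fix xs
    have "D\<^sup>2 \<le> (real (sum_list xs) - sum_list ls)\<^sup>2" if "\<bar>real (sum_list xs) - sum_list ls\<bar> \<ge> D"
      using that assms(2) by (metis abs_le_square_iff abs_of_pos)
    thus "ennreal (D\<^sup>2) * indicator ?E xs \<le>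
      ennreal ((real (sum_list xs) - sum_list ls)\<^sup>2) * indicator {xs. stays_pos s y xs} xs"
      by (auto simp: indicator_def intro: ennreal_leI)
  qed
  also have "\<dots> \<le> ennreal (b * (\<Sum>j<length ls. surv s (take j ls) y))"
    by (rule second_moment_stays) (use assms in auto)
  finally have "D\<^sup>2 * measure_pmf.prob (poisson_vec ls) ?E \<le> b * (\<Sum>j<length ls. surv s (take j ls)
      y)"
    using assms by (subst (asm) ennreal_le_iff) (auto intro!: mult_nonneg_nonneg sum_nonneg)
  thus ?thesis using assms(2) by (simp add: field_simps)
qed

section \<open>Exponential inequalities and the Cramer root\<close>

lemma exp_neg_le_quadratic:
  fixes x :: real
  assumes "x \<ge> 0"
  shows "exp (- x) \<le> 1 - x + x\<^sup>2 / 2"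
proof -
  let ?f = "\<lambda>x :: real. 1 - x + x\<^sup>2 / 2 - exp (- x)"
  have "?f 0 \<le> ?f x"
  proof (rule DERIV_nonneg_imp_nondecreasing[OF assms])
    fix t :: real
    have "(?f has_real_derivative (-1 + t + exp (- t))) (at t)"
      by (auto intro!: derivative_eq_intros)
    moreover have "-1 + t + exp (- t) \<ge> 0" using exp_ge_add_one_self[of "- t"] by simp
    ultimately show "\<exists>y. (?f has_real_derivative y) (at t) \<and> 0 \<le> y" by blast
  qed
  thus ?thesis by simp
qed

lemma exp_neg_ge_cubic:
  fixes x :: real
  assumes "x \<ge> 0"
  shows "1 - x + x\<^sup>2 / 2 - x ^ 3 / 6 \<le> exp (- x)"
proof -
  let ?f = "\<lambda>x :: real. exp (- x) - (1 - x + x\<^sup>2 / 2 - x ^ 3 / 6)"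
  have "?f 0 \<le> ?f x"
  proof (rule DERIV_nonneg_imp_nondecreasing[OF assms])
    fix t :: real assume "0 \<le> t"
    have "(?f has_real_derivative (- exp (- t) - (-1 + t - t\<^sup>2 / 2))) (at t)"
      by (auto intro!: derivative_eq_intros)
    moreover have "- exp (- t) - (-1 + t - t\<^sup>2 / 2) \<ge> 0"
      using exp_neg_le_quadratic[OF \<open>0 \<le> t\<close>] by simp
    ultimately show "\<exists>y. (?f has_real_derivative y) (at t) \<and> 0 \<le> y" by blast
  qed
  thus ?thesis by simp
qed

lemma psi_up_le:
  assumes "\<theta> \<ge> 0" "l \<ge> 0"
  shows "psi 1 \<theta> l \<le> - \<theta> * (l - 1) + l * \<theta>\<^sup>2 / 2"
  using mult_left_mono[OF exp_neg_le_quadratic[OF assms(1)] assms(2)]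
  by (simp add: psi_def algebra_simps)

lemma psi_down_le:
  assumes "0 \<le> \<theta>" "\<theta> \<le> 1" "l \<ge> 0"
  shows "psi (-1) \<theta> l \<le> - \<theta> * (1 - l) + l * \<theta>\<^sup>2"
  using mult_left_mono[OF exp_bound[OF assms(1,2)] assms(3)]
  by (simp add: psi_def algebra_simps)

lemma half_square_eq:
  fixes a b d :: real
  assumes "b * a = 2 * d"
  shows "b * a\<^sup>2 / 2 = a * d"
  using assms by (simp add: power2_eq_square flip: mult.assoc)

text \<open>The last conclusion bounds the negative drift of the exponentially tilted walk.\<close>

lemma cramer_root:
  fixes \<delta> :: real
  assumes "0 < \<delta>" "\<delta> \<le> 1/10"
  obtains \<theta> where "0 < \<theta>" "\<theta> \<le> 2 * \<delta> * (1 + 2 * \<delta>)" "(1 + \<delta>) * (1 - exp (- \<theta>)) = \<theta>"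
    "\<delta> / 2 \<le> 1 - (1 + \<delta>) * exp (- \<theta>)"
proof -
  let ?f = "\<lambda>\<theta>. psi 1 \<theta> (1 + \<delta>)"
  \<comment> \<open>\<open>?a\<close> is the zero of the quadratic upper bound
    \<open>psi_up_le\<close>; \<open>?b\<close> is slightly larger than 2 \<delta>, enough to make
    the cubic lower bound nonnegative. The root is caught between them.\<close>
  let ?a = "2 * \<delta> / (1 + \<delta>)" and ?b = "2 * \<delta> * (1 + 2 * \<delta>)"
  have a2: "(1 + \<delta>) * ?a\<^sup>2 / 2 = ?a * \<delta>"
    using assms by (intro half_square_eq) simp
  have "?f ?a \<le> - ?a * \<delta> + (1 + \<delta>) * ?a\<^sup>2 / 2"
    using psi_up_le[of ?a "1 + \<delta>"] assms by simp
  also have "\<dots> = 0" unfolding a2 by simp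
  finally have fa: "?f ?a \<le> 0" .
  have "0 \<le> ?b * (- \<delta> + (1 + \<delta>) * (?b / 2 - ?b\<^sup>2 / 6))"
  proof (intro mult_nonneg_nonneg)
    have "?b\<^sup>2 / 6 = (2/3) * \<delta>\<^sup>2 * (1 + 2 * \<delta>)\<^sup>2" by (simp add: power2_eq_square)
    also have "(1 + 2 * \<delta>)\<^sup>2 \<le> (12/10)\<^sup>2" using assms by (intro power_mono) auto
    finally have "?b\<^sup>2 / 6 \<le> \<delta>\<^sup>2" using assms by (simp add: power2_eq_square)
    hence "\<delta> + \<delta>\<^sup>2 \<le> ?b / 2 - ?b\<^sup>2 / 6" by (simp add: power2_eq_square algebra_simps)
    moreover have "(1 + \<delta>) * (\<delta> + \<delta>\<^sup>2) \<ge> \<delta>" using assms by (simp add: algebra_simps)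
    ultimately show "0 \<le> - \<delta> + (1 + \<delta>) * (?b / 2 - ?b\<^sup>2 / 6)"
      using mult_left_mono[of "\<delta> + \<delta>\<^sup>2" "?b / 2 - ?b\<^sup>2 / 6" "1 + \<delta>"] assms by linarith
  qed (use assms in auto)
  also have "\<dots> = (1 + \<delta>) * ((1 - ?b + ?b\<^sup>2 / 2 - ?b ^ 3 / 6) - 1) + ?b"
    by (simp add: power2_eq_square power3_eq_cube algebra_simps)
  also have "\<dots> \<le> ?f ?b"
    unfolding psi_def using exp_neg_ge_cubic[of ?b] assms by (auto intro!: mult_left_mono)
  finally have fb: "0 \<le> ?f ?b" .
  have ab: "?a \<le> ?b"
  proof -
    have "?a \<le> 2 * \<delta>" using assms by (simp add: field_simps)
    also have "\<dots> \<le> ?b" using assms by (simp add: algebra_simps)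
    finally show ?thesis .
  qed
  have "\<exists>\<theta>\<ge>?a. \<theta> \<le> ?b \<and> ?f \<theta> = 0"
    by (rule IVT'[OF fa fb ab]) (auto simp: psi_def intro!: continuous_intros)
  then obtain \<theta> where \<theta>: "?a \<le> \<theta>" "\<theta> \<le> ?b" "?f \<theta> = 0" by blast
  have b: "?b \<le> 1/2"
  proof -
    have "?b \<le> 2 * (1/10) * (1 + 2 * (1/10))" using assms by (intro mult_mono add_mono) auto
    thus ?thesis by simp
  qed
  have pos: "\<theta> > 0" using \<theta>(1) assms by (smt (verit) divide_pos_pos)
  \<comment> \<open>The tilted mean: the lower end \<open>?a\<close> gives (1 + \<delta>) \<theta>
    at least 2 \<delta>, and \<theta> at most 1/2 gives 1 - \<theta>/2 at least 3/4, so it falls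
    below 1 by \<delta>/2.\<close>
  have "(1 + \<delta>) * exp (- \<theta>) \<le> (1 + \<delta>) * (1 - \<theta> + \<theta>\<^sup>2 / 2)"
    using exp_neg_le_quadratic[of \<theta>] pos assms by (intro mult_left_mono) auto
  also have "\<dots> = 1 + \<delta> - ((1 + \<delta>) * \<theta>) * (1 - \<theta> / 2)"
    by (simp add: power2_eq_square algebra_simps)
  also have "\<dots> \<le> 1 + \<delta> - (2 * \<delta>) * (3 / 4)"
  proof -
    have "(2 * \<delta>) * (3 / 4) \<le> ((1 + \<delta>) * \<theta>) * (1 - \<theta> / 2)"
      by (rule mult_mono) (use \<theta> b assms pos in \<open>auto simp: field_simps\<close>)
    thus ?thesis by simp
  qed
  finally have "\<delta> / 2 \<le> 1 - (1 + \<delta>) * exp (- \<theta>)" by simp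
  moreover have "(1 + \<delta>) * (1 - exp (- \<theta>)) = \<theta>" using \<theta>(3) by (simp add: psi_def algebra_simps)
  ultimately show thesis using that pos \<theta> by blast
qed

section \<open>Survival bounds for varying means\<close>

lemma list_all2_replicate_right:
  assumes "\<And>l. l \<in> set ls \<Longrightarrow> P l b"
  shows "list_all2 P ls (replicate (length ls) b)"
  using assms by (auto simp: list_all2_conv_all_nth)

text \<open>By monotonicity the constant mean 1 + \<delta> is the worst case. The first bound is for
  survival over the whole block, the second is the lifetime sum that enters the second
  moment.\<close>

lemma surv_up_le:
  fixes \<delta> :: real
  assumes "0 < \<delta>" "\<delta> \<le> 1/10" and ls: "\<And>l. l \<in> set ls \<Longrightarrow> 0 < l \<and> l \<le> 1 + \<delta>"
  shows "ls \<noteq> [] \<Longrightarrow> surv 1 ls 1 \<le> 2 * \<delta> * (1 + 2 * \<delta>) + 2 / (\<delta> * length ls)"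
    and "(\<Sum>j<length ls. surv 1 (take j ls) 1) \<le> length ls * (2 * \<delta> * (1 + 2 * \<delta>)) + 2 / \<delta>"
proof -
  obtain \<theta> where \<theta>: "0 < \<theta>" "\<theta> \<le> 2 * \<delta> * (1 + 2 * \<delta>)" "(1 + \<delta>) * (1 - exp (- \<theta>)) = \<theta>"
    "\<delta> / 2 \<le> 1 - (1 + \<delta>) * exp (- \<theta>)"
    using cramer_root[OF assms(1,2)] by blast
  define c where "c = 1 - (1 + \<delta>) * exp (- \<theta>)"
  have c: "c > 0" "\<delta> / 2 \<le> c" using \<theta> assms by (auto simp: c_def)
  have l: "1 + \<delta> > 0" using assms by simp
  have ee: "1 - exp (- \<theta>) \<le> 2 * \<delta> * (1 + 2 * \<delta>)"
    using \<theta>(2) exp_ge_add_one_self[of "- \<theta>"] by simp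
  have le: "surv 1 (take j ls) 1 \<le> surv 1 (replicate j (1 + \<delta>)) 1" if "j \<le> length ls" for j
    using that ls by (intro surv_up_mono) (auto simp: list_all2_conv_all_nth)
  have cinv: "1 / c \<le> 2 / \<delta>" using c assms by (simp add: field_simps)
  {
    assume "ls \<noteq> []"
    hence n: "length ls > 0" by simp
    have "surv 1 ls 1 \<le> 1 - exp (- \<theta>) + 1 / (c * length ls)"
      using le[of "length ls"] surv_replicate_le[OF l \<theta>(1,3) c_def c(1) n] by simp
    also have "1 / (c * length ls) = 1 / c / length ls" by simp
    also have "\<dots> \<le> 2 / \<delta> / length ls" using cinv by (intro divide_right_mono) auto
    finally show "surv 1 ls 1 \<le> 2 * \<delta> * (1 + 2 * \<delta>) + 2 / (\<delta> * length ls)"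
      using ee by simp
  }
  have "(\<Sum>j<length ls. surv 1 (take j ls) 1) \<le> (\<Sum>j<length ls. surv 1 (replicate j (1 + \<delta>)) 1)"
    by (intro sum_mono le) auto
  also have "\<dots> \<le> length ls * (1 - exp (- \<theta>)) + 1 / c"
    by (rule sum_surv_replicate_le[OF l \<theta>(1,3) c_def c(1)])
  also have "\<dots> \<le> length ls * (2 * \<delta> * (1 + 2 * \<delta>)) + 2 / \<delta>"
    using ee cinv by (intro add_mono mult_left_mono) auto
  finally show "(\<Sum>j<length ls. surv 1 (take j ls) 1) \<le> length ls * (2 * \<delta> * (1 + 2 * \<delta>)) + 2 / \<delta>" .
qed

text \<open>For a lower bound an exact root is unnecessary: at this explicit exponent the quadratic
  bound makes every \<open>psi\<close> nonpositive.\<close>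

lemma surv_up_ge:
  fixes \<delta> :: real
  assumes "0 \<le> \<delta>" and ls: "\<And>l. l \<in> set ls \<Longrightarrow> 1 + \<delta> \<le> l"
  shows "1 - exp (- (2 * \<delta> / (1 + \<delta>))) \<le> surv 1 ls 1"
proof -
  let ?\<theta> = "2 * \<delta> / (1 + \<delta>)"
  have a2: "(1 + \<delta>) * ?\<theta>\<^sup>2 / 2 = ?\<theta> * \<delta>"
    using assms by (intro half_square_eq) simp
  have psi: "psi 1 ?\<theta> l \<le> 0" if "l \<in> set ls" for l
  proof -
    have l: "1 + \<delta> \<le> l" using ls that by simp
    have "psi 1 ?\<theta> l \<le> psi 1 ?\<theta> (1 + \<delta>)"
      unfolding psi_def using l assms by (auto intro!: mult_right_mono_neg)
    also have "\<dots> \<le> - ?\<theta> * (1 + \<delta> - 1) + (1 + \<delta>) * ?\<theta>\<^sup>2 / 2"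
      using assms by (intro psi_up_le) auto
    also have "\<dots> = 0" unfolding a2 by simp
    finally show ?thesis .
  qed
  have "1 - surv 1 ls 1 \<le> exp (- ?\<theta> * real_of_int 1 + 0)"
  proof (rule surv_exp_bound)
    show "0 < l" if "l \<in> set ls" for l using ls[OF that] assms by simp
    show "(\<Sum>l\<leftarrow>take j ls. psi (1) ?\<theta> l) \<le> 0" for j
      by (intro sum_list_nonpos) (use psi in \<open>auto dest: in_set_takeD\<close>)
  qed (use assms in auto)
  thus ?thesis by simp
qed

lemma surv_down_ge:
  assumes ls: "\<And>l. l \<in> set ls \<Longrightarrow> 0 < l \<and> l \<le> 1 - \<gamma>" and "ls \<noteq> []"
  shows "\<gamma> \<le> surv (-1) ls 0"
proof -
  have v: "1 - \<gamma> > 0" using assms by (meson hd_in_set less_le_trans)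
  have "\<gamma> \<le> surv (-1) (replicate (length ls) (1 - \<gamma>)) 0"
    using surv_down_replicate_ge[OF v, of "length ls"] assms(2) by (simp add: Suc_le_eq)
  also have "\<dots> \<le> surv (-1) ls 0"
    by (rule surv_down_antimono[OF list_all2_replicate_right]) (use ls in auto)
  finally show ?thesis .
qed

lemma sum_inverse_sqrt: "(\<Sum>j\<in>{1..n}. 1 / sqrt (real j)) \<le> 2 * sqrt (real n)"
proof (induction n)
  case (Suc n)
  let ?a = "sqrt (real n)" and ?b = "sqrt (real (Suc n))"
  have ab: "0 < ?b" "?a \<le> ?b" "?b * ?b = ?a * ?a + 1" by auto
  have "1 = (?b + ?a) * (?b - ?a)" using ab(3) by (simp add: algebra_simps)
  also have "\<dots> \<le> (2 * ?b) * (?b - ?a)" using ab by (intro mult_right_mono) auto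
  finally have "1 / ?b \<le> 2 * (?b - ?a)" using ab(1) by (simp add: field_simps)
  with Suc show ?case by simp
qed simp

lemma surv_down_le:
  fixes \<gamma> :: real
  assumes \<gamma>: "0 \<le> \<gamma>" "\<gamma> < 1" and ls: "\<And>l. l \<in> set ls \<Longrightarrow> 1 - \<gamma> \<le> l"
  shows "ls \<noteq> [] \<Longrightarrow> surv (-1) ls 0 \<le> \<gamma> + 1 / sqrt (length ls)"
    and "(\<Sum>j<length ls. surv (-1) (take j ls) 0) \<le> 1 + length ls * \<gamma> + 2 * sqrt (length ls)"
proof -
  have le: "surv (-1) (take j ls) 0 \<le> \<gamma> + 1 / sqrt j" if "1 \<le> j" "j \<le> length ls" for j
  proof -
    have "surv (-1) (take j ls) 0 \<le> surv (-1) (replicate j (1 - \<gamma>)) 0"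
      using that \<gamma> ls by (intro surv_down_antimono) (auto simp: list_all2_conv_all_nth)
    also have "\<dots> \<le> \<gamma> + 1 / sqrt j"
      using surv_down_replicate_le[of "1 - \<gamma>" j] that \<gamma> by simp
    finally show ?thesis .
  qed
  show "surv (-1) ls 0 \<le> \<gamma> + 1 / sqrt (length ls)" if "ls \<noteq> []"
    using le[of "length ls"] that by (simp add: Suc_le_eq)
  show "(\<Sum>j<length ls. surv (-1) (take j ls) 0) \<le> 1 + length ls * \<gamma> + 2 * sqrt (length ls)"
  proof (cases "ls = []")
    case False
    \<comment> \<open>The term j = 0 equals 1 and is split off: since 1 / sqrt 0 is 0, the bound
      used for the other terms would fail there.\<close>
    hence eq: "{..<length ls} = insert 0 {1..<length ls}" by auto
    have "(\<Sum>j<length ls. surv (-1) (take j ls) 0) = 1 + (\<Sum>j\<in>{1..<length ls}. surv (-1) (take j ls)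
        0)"
      unfolding eq by (subst sum.insert) auto
    also have "(\<Sum>j\<in>{1..<length ls}. surv (-1) (take j ls) 0) \<le> (\<Sum>j\<in>{1..<length ls}. \<gamma> + 1 / sqrt j)"
      by (intro sum_mono le) auto
    also have "\<dots> \<le> (\<Sum>j\<in>{1..length ls}. \<gamma> + 1 / sqrt j)"
      using \<gamma> by (intro sum_mono2) auto
    also have "\<dots> \<le> length ls * \<gamma> + 2 * sqrt (length ls)"
      using sum_inverse_sqrt[of "length ls"] by (simp add: sum.distrib)
    finally show ?thesis by simp
  qed simp
qed

section \<open>Comparison of multinomial and Poisson counts\<close>

text \<open>The rational function agrees with the logarithm to second order. At x = 1/n it gives (n
  + 1/2) ln (1 + 1/n) at least 1, hence the factor 1/2 in \<open>lfe_upper\<close>.\<close>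

lemma ln_one_plus_ge:
  fixes x :: real
  assumes "x \<ge> 0"
  shows "2 * x / (2 + x) \<le> ln (1 + x)"
proof -
  let ?f = "\<lambda>x :: real. ln (1 + x) - 2 * x / (2 + x)"
  have "?f 0 \<le> ?f x"
  proof (rule DERIV_nonneg_imp_nondecreasing[OF assms])
    fix t :: real assume t: "0 \<le> t"
    have "(?f has_real_derivative (1 / (1 + t) - (2 * (2 + t) - 2 * t) / ((2 + t) * (2 + t)))) (at
        t)"
      using t by (auto intro!: derivative_eq_intros)
    moreover have "(2 * (2 + t) - 2 * t) / ((2 + t) * (2 + t)) \<le> 1 / (1 + t)"
    proof (rule mult_imp_div_pos_le)
      have "4 * (1 + t) \<le> (2 + t) * (2 + t)" by (simp add: algebra_simps)
      thus "2 * (2 + t) - 2 * t \<le> 1 / (1 + t) * ((2 + t) * (2 + t))"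
        using t by (simp add: pos_le_divide_eq)
    qed (use t in auto)
    hence "0 \<le> 1 / (1 + t) - (2 * (2 + t) - 2 * t) / ((2 + t) * (2 + t))" by simp
    ultimately show "\<exists>y. (?f has_real_derivative y) (at t) \<and> 0 \<le> y" by blast
  qed
  thus ?thesis by simp
qed

text \<open>The logarithm of \<open>n! e^n / n^n\<close>, the reciprocal of the probability that a Poisson variable of
  mean \<open>n\<close> equals \<open>n\<close>; comparing values at two arguments replaces Stirling's formula.\<close>

definition lfe :: "nat \<Rightarrow> real" where
  "lfe n = ln (fact n) + real n - real n * ln (real n)"

lemma lfe_Suc: "n \<ge> 1 \<Longrightarrow> lfe (Suc n) = lfe n + 1 - real n * (ln (real (Suc n)) - ln (real n))"
proof -
  have "ln (fact (Suc n)) = ln (real (Suc n)) + ln (fact n)"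
    by (simp only: fact_Suc) (subst ln_mult, auto)
  thus ?thesis by (simp add: lfe_def algebra_simps)
qed

lemma ln_Suc_diff:
  assumes "n \<ge> 1"
  shows "ln (real (Suc n)) - ln (real n) = ln (1 + 1 / n)"
proof -
  have "1 + 1 / real n = real (Suc n) / real n" using assms by (simp add: field_simps)
  thus ?thesis using assms by (simp add: ln_div)
qed

text \<open>The increment is 1 - n ln (1 + 1/n), nonnegative since ln (1 + x) is at most x. Together
  with \<open>lfe_upper\<close> it says that \<open>lfe\<close> grows, but no faster than half the
  logarithm.\<close>

lemma lfe_mono:
  assumes "1 \<le> i" "i \<le> n"
  shows "lfe i \<le> lfe n"
  using assms(2)
proof (induction n rule: dec_induct)
  case (step n)
  hence n: "n \<ge> 1" using assms by simp
  have "ln (real (Suc n)) - ln (real n) = ln (1 + 1 / n)" by (rule ln_Suc_diff[OF n])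
  also have "\<dots> \<le> 1 / n" by (rule ln_add_one_self_le_self) auto
  finally have "real n * (ln (real (Suc n)) - ln (real n)) \<le> 1"
    using n by (simp add: field_simps)
  thus ?case using step lfe_Suc[OF n] by simp
qed simp

lemma lfe_upper:
  assumes "1 \<le> i" "i \<le> n"
  shows "lfe n \<le> lfe i + (ln (real n) - ln (real i)) / 2"
  using assms(2)
proof (induction n rule: dec_induct)
  case (step n)
  hence n: "n \<ge> 1" using assms by simp
  have "2 * (1 / n) / (2 + 1 / n) \<le> ln (1 + 1 / n)" using ln_one_plus_ge[of "1 / n"] by simp
  also have "2 * (1 / n) / (2 + 1 / n) = 2 / (2 * n + 1)" using n by (simp add: field_simps)
  also have "ln (1 + 1 / n) = ln (real (Suc n)) - ln (real n)" by (rule ln_Suc_diff[OF n,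
      symmetric])
  finally have "1 \<le> (real n + 1 / 2) * (ln (real (Suc n)) - ln (real n))"
    by (simp add: field_simps)
  hence "1 \<le> real n * (ln (real (Suc n)) - ln (real n)) + (ln (real (Suc n)) - ln (real n)) / 2"
    by (simp add: distrib_right)
  with step.IH lfe_Suc[OF n] show ?case by argo
qed simp

lemma power_over_fact_le_mode:
  fixes \<mu> :: real
  assumes "\<mu> > 0" and J: "real J \<le> \<mu>" "\<mu> \<le> real J + 1"
  shows "\<mu> ^ j / fact j \<le> \<mu> ^ J / fact J"
proof -
  show ?thesis
  proof (cases "j \<le> J")
    case True
    thus ?thesis
    proof (induction j rule: inc_induct)
      case (step i)
      have "\<mu> ^ i / fact i * 1 \<le> \<mu> ^ i / fact i * (\<mu> / real (Suc i))"
        using step.hyps J assms by (intro mult_left_mono) auto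
      thus ?case using step.IH by (simp add: mult_ac)
    qed simp
  next
    case False
    hence "J \<le> j" by simp
    thus ?thesis
    proof (induction j rule: dec_induct)
      case (step i)
      have "\<mu> ^ i / fact i * (\<mu> / real (Suc i)) \<le> \<mu> ^ i / fact i * 1"
        using step.hyps J assms by (intro mult_left_mono) auto
      thus ?case using step.IH by (simp add: mult_ac)
    qed simp
  qed
qed

text \<open>The likelihood ratio between multinomial and independent Poisson counts in a set of bins
  of total probability \<open>P\<close> that receives \<open>m\<close> of the \<open>n\<close> balls.\<close>

definition lratio :: "nat \<Rightarrow> real \<Rightarrow> nat \<Rightarrow> real" where
  "lratio n P m = (if m \<le> n then fact n / (fact (n - m) * real n ^ m) * (1 - P) ^ (n - m) * exp (n *
      P) else 0)"

text \<open>Multinomial counts are Poisson counts conditioned on the total. Hence the ratio is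
  P[Poisson(\<mu>) = n - m] / P[Poisson(n) = n], where \<mu> is the mean number of balls outside the
  bins considered.\<close>

lemma lratio_altdef:
  assumes "n \<ge> 1" "m \<le> n" "P < 1"
  defines "\<mu> \<equiv> real n * (1 - P)"
  shows "lratio n P m = exp (lfe n - \<mu>) * (\<mu> ^ (n - m) / fact (n - m))"
proof -
  have "exp (lfe n - \<mu>) = fact n * exp (n * P) / real n ^ n"
    using assms by (simp add: lfe_def exp_add exp_diff exp_of_nat_mult algebra_simps)
  moreover have "real n ^ n = real n ^ m * real n ^ (n - m)"
    using assms by (simp flip: power_add)
  ultimately show ?thesis
    using assms by (simp add: lratio_def power_mult_distrib mult_ac)
qed

text \<open>The numerator is largest at the mode J, the floor of \<mu>. At J the bound ln x at most
  x - 1 leaves the difference of \<open>lfe\<close> at \<open>n\<close> and at J, which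
  \<open>lfe_upper\<close> turns into a square root; J exceeds \<mu> - 1.\<close>

lemma lratio_le:
  assumes n: "n \<ge> 1" and P: "0 \<le> P" "P < 1" and n1: "real n * (1 - P) \<ge> 2"
  shows "lratio n P m \<le> sqrt (n / (n * (1 - P) - 1))"
proof (cases "m \<le> n")
  case True
  define \<mu> where "\<mu> = real n * (1 - P)"
  define J where "J = nat \<lfloor>\<mu>\<rfloor>"
  have mu: "\<mu> \<ge> 2" "\<mu> \<le> n" using assms by (auto simp: \<mu>_def mult_left_le)
  have J: "real J \<le> \<mu>" "\<mu> \<le> real J + 1" using mu by (auto simp: J_def)
  hence J1: "J \<ge> 1" "J \<le> n" using mu by auto
  have "lratio n P m \<le> exp (lfe n - \<mu>) * (\<mu> ^ J / fact J)"
    unfolding lratio_altdef[OF n True P(2)] \<mu>_def[symmetric]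
    using mu J by (intro mult_left_mono power_over_fact_le_mode) auto
  also have "\<dots> = exp (lfe n - \<mu> + real J * ln \<mu> - ln (fact J))"
    using mu by (simp add: exp_add exp_diff exp_of_nat_mult)
  also have "\<dots> \<le> exp (ln (n / (\<mu> - 1)) / 2)"
  proof -
    have "real J * (ln \<mu> - ln (real J)) \<le> real J * (\<mu> / J - 1)"
    proof (intro mult_left_mono)
      show "ln \<mu> - ln (real J) \<le> \<mu> / J - 1"
        using mu J1 ln_le_minus_one[of "\<mu> / J"] by (simp add: ln_div)
    qed auto
    also have "\<dots> = \<mu> - J" using J1 by (simp add: field_simps)
    finally have "real J * ln \<mu> \<le> \<mu> - J + real J * ln (real J)" by (simp add: algebra_simps)
    hence "lfe n - \<mu> + real J * ln \<mu> - ln (fact J) \<le> lfe n - lfe J"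
      by (simp add: lfe_def)
    also have "\<dots> \<le> (ln (real n) - ln (real J)) / 2" using lfe_upper[OF J1] by linarith
    also have "\<dots> \<le> (ln (real n) - ln (\<mu> - 1)) / 2" using mu J by simp
    also have "\<dots> = ln (n / (\<mu> - 1)) / 2" using mu n by (subst ln_div) auto
    finally show ?thesis by simp
  qed
  also have "\<dots> = sqrt (n / (\<mu> - 1))"
    using mu n by (simp add: ln_sqrt[symmetric])
  finally show ?thesis by (simp add: \<mu>_def)
next
  case False
  thus ?thesis using n1 by (simp add: lratio_def)
qed

text \<open>With j = n - m balls outside, \<open>lfe_mono\<close> discards the two factorial
  corrections, and ln x at most x - 1 leaves the Gaussian exponent, because the excess of
  \<open>m\<close> over its mean is the deficit of \<open>j\<close>. Strictness of m < n keeps ln j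
  meaningful.\<close>

lemma lratio_ge:
  assumes n: "n \<ge> 1" and P: "0 \<le> P" "P < 1" and m: "m < n"
  shows "lratio n P m \<ge> exp (- ((real m - n * P)\<^sup>2 / (n * (1 - P))))"
proof -
  define \<mu> where "\<mu> = real n * (1 - P)"
  define j where "j = n - m"
  have j: "j \<ge> 1" "j \<le> n" using m by (auto simp: j_def)
  have mu: "\<mu> > 0" using assms by (auto simp: \<mu>_def)
  have "ln (real j) - ln \<mu> \<le> j / \<mu> - 1"
    using mu j ln_le_minus_one[of "j / \<mu>"] by (simp add: ln_div)
  hence "real j * (ln (real j) - ln \<mu>) \<le> real j * (j / \<mu> - 1)"
    by (intro mult_left_mono) auto
  hence "real j - \<mu> - real j * (j / \<mu> - 1) \<le> real j - \<mu> + real j * ln \<mu> - real j * ln (real j)"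
    by (simp add: algebra_simps)
  also have "\<dots> = lfe j - \<mu> + real j * ln \<mu> - ln (fact j)" by (simp add: lfe_def)
  also have "\<dots> \<le> lfe n - \<mu> + real j * ln \<mu> - ln (fact j)" using lfe_mono[OF j] by simp
  finally have "exp (real j - \<mu> - real j * (j / \<mu> - 1)) \<le> exp (lfe n - \<mu> + real j * ln \<mu> - ln (fact
      j))"
    by simp
  also have "\<dots> = lratio n P m"
    unfolding lratio_altdef[OF n less_imp_le[OF m] P(2)] \<mu>_def[symmetric] j_def[symmetric]
    using mu by (simp add: exp_add exp_diff exp_of_nat_mult)
  also have "real j - \<mu> - real j * (j / \<mu> - 1) = - ((real m - n * P)\<^sup>2 / \<mu>)"
  proof -
    have "real m - n * P = \<mu> - j" using m by (simp add: \<mu>_def j_def of_nat_diff algebra_simps)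
    thus ?thesis using mu by (simp only:) (simp add: field_simps power2_eq_square)
  qed
  finally show ?thesis by (simp add: \<mu>_def)
qed

section \<open>Joint law of the counts in a set of bins\<close>

lemma expectation_finite_partition:
  fixes c :: "'a \<Rightarrow> real"
  assumes "finite A"
  shows "measure_pmf.expectation t (\<lambda>y. if y \<in> A then c y else d) =
    (\<Sum>i\<in>A. pmf t i * c i) + (1 - (\<Sum>i\<in>A. pmf t i)) * d"
proof -
  have "(\<lambda>y. if y \<in> A then c y else d) = (\<lambda>y. (\<Sum>i\<in>A. c i * indicator {i} y) + d * indicator (- A)
      y)"
  proof
    fix y
    have "(\<Sum>i\<in>A. c i * indicator {i} y) = (\<Sum>i\<in>A. if i = y then c y else 0)"
      by (intro sum.cong) (auto simp: indicator_def)
    thus "(if y \<in> A then c y else d) = (\<Sum>i\<in>A. c i * indicator {i} y) + d * indicator (- A) y"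
      using assms by auto
  qed
  hence "measure_pmf.expectation t (\<lambda>y. if y \<in> A then c y else d) =
      (\<Sum>i\<in>A. c i * measure_pmf.prob t {i}) + d * measure_pmf.prob t (- A)"
    by (simp only:) (subst Bochner_Integration.integral_add;
        auto simp: measure_pmf.emeasure_eq_measure Bochner_Integration.integral_sum intro!:
            Bochner_Integration.integrable_sum)
  also have "measure_pmf.prob t (- A) = 1 - measure_pmf.prob t A"
    using measure_pmf.prob_compl[of A t] by (simp add: Compl_eq_Diff_UNIV)
  also have "measure_pmf.prob t A = (\<Sum>i\<in>A. pmf t i)"
    using assms by (rule measure_measure_pmf_finite)
  finally show ?thesis by (simp add: measure_pmf_single mult_ac)
qed

text \<open>Induction on the number of balls, conditioning on the bin of the last one; all bins
  outside \<open>A\<close> act as a single class of probability 1 - P.\<close>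

lemma multinomial_prob:
  fixes t :: "'a pmf" and z :: "'a \<Rightarrow> nat"
  assumes A: "finite A"
  defines "P \<equiv> (\<Sum>i\<in>A. pmf t i)"
  shows "measure_pmf.prob (Pi_pmf {..<n} d (\<lambda>_. t)) {T. \<forall>i\<in>A. card {j. j < n \<and> T j = i} = z i} =
    (if sum z A \<le> n then fact n / fact (n - sum z A) * (\<Prod>i\<in>A. pmf t i ^ z i / fact (z i)) * (1 - P)
        ^ (n - sum z A) else 0)"
proof (induction n arbitrary: z)
  case 0
  have "(\<Prod>i\<in>A. pmf t i ^ z i / fact (z i)) = 1" if "sum z A = 0"
    using that A by (intro prod.neutral) auto
  thus ?case using A by (auto simp: indicator_def)
next
  case (Suc n)
  let ?W = "\<lambda>z. \<Prod>i\<in>A. pmf t i ^ z i / fact (z i)"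
  let ?Q = "\<lambda>n z. if sum z A \<le> n then fact n / fact (n - sum z A) * ?W z * (1 - P) ^ (n - sum z A)
      else 0"
  let ?E = "\<lambda>n z. {T. \<forall>i\<in>A. card {j. j < n \<and> T j = i} = z i}"
  let ?M = "Pi_pmf {..<n} d (\<lambda>_. t)"
  have card: "card {j. j < Suc n \<and> (f(n := y)) j = i} = card {j. j < n \<and> f j = i} + (if y = i then 1
      else 0)" for f y i
  proof -
    have "{j. j < Suc n \<and> (f(n := y)) j = i} = {j. j < n \<and> f j = i} \<union> (if y = i then {n} else {})"
      by auto
    thus ?thesis by (auto simp: card_insert_if)
  qed
  have inner: "measure_pmf.prob ?M {f. f(n := y) \<in> ?E (Suc n) z} =
      (if y \<in> A then (if z y = 0 then 0 else ?Q n (z(y := z y - 1))) else ?Q n z)" for y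
  proof (cases "y \<in> A \<and> z y = 0")
    case True
    hence "{f. f(n := y) \<in> ?E (Suc n) z} = {}"
      by (auto simp: card simp del: fun_upd_apply intro!: bexI[of _ y])
    thus ?thesis using True by (simp only: measure_empty) simp
  next
    case False
    define z' where "z' = (if y \<in> A then z(y := z y - 1) else z)"
    have "{f. f(n := y) \<in> ?E (Suc n) z} = ?E n z'"
    proof (rule set_eqI)
      fix f
      have "card {j. j < n \<and> f j = i} + (if y = i then 1 else 0) = z i \<longleftrightarrow> card {j. j < n \<and> f j = i} =
          z' i"
        if "i \<in> A" for i using that False by (auto simp: z'_def)
      thus "f \<in> {f. f(n := y) \<in> ?E (Suc n) z} \<longleftrightarrow> f \<in> ?E n z'"
        by (simp only: mem_Collect_eq card cong: ball_cong)
    qed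
    thus ?thesis using False Suc.IH[of z'] by (auto simp: z'_def)
  qed
  \<comment> \<open>Removing a ball from bin \<open>i\<close> changes the weight by z i / pmf t i,
    so the contribution of bin \<open>i\<close> is proportional to z i and the contributions add up
    to the total.\<close>
  have wi: "pmf t i * (if z i = 0 then 0 else ?Q n (z(i := z i - 1))) =
     (if sum z A \<le> Suc n then fact n / fact (Suc n - sum z A) * (1 - P) ^ (Suc n - sum z A) * ?W z
         else 0) * real (z i)"
    if i: "i \<in> A" for i
  proof (cases "z i")
    case (Suc k)
    let ?z = "z(i := k)"
    have sum: "sum z A = Suc (sum ?z A)"
    proof -
      have "sum ?z (A - {i}) = sum z (A - {i})" by (intro sum.cong) auto
      thus ?thesis using A i Suc by (simp add: sum.remove[of A i])
    qed
    have "?W ?z * pmf t i = ?W z * real (z i)"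
    proof -
      have "(\<Prod>j\<in>A - {i}. pmf t j ^ ?z j / fact (?z j)) = (\<Prod>j\<in>A - {i}. pmf t j ^ z j / fact (z j))"
        by (intro prod.cong) auto
      thus ?thesis using A i Suc by (simp add: prod.remove[of A i])
    qed
    thus ?thesis using Suc sum by (simp add: mult_ac)
  qed simp
  have "Pi_pmf {..<Suc n} d (\<lambda>_. t) = bind_pmf t (\<lambda>y. map_pmf (\<lambda>f. f(n := y)) ?M)"
    unfolding lessThan_Suc by (subst Pi_pmf_insert') (auto simp: map_pmf_def)
  hence "measure_pmf.prob (Pi_pmf {..<Suc n} d (\<lambda>_. t)) (?E (Suc n) z) =
      measure_pmf.expectation t (\<lambda>y. measure_pmf.prob ?M {f. f(n := y) \<in> ?E (Suc n) z})"
    by (simp only: prob_bind_pmf measure_map_pmf vimage_def)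
  also have "\<dots> = (\<Sum>i\<in>A. pmf t i * (if z i = 0 then 0 else ?Q n (z(i := z i - 1)))) + (1 - P) * ?Q n
      z"
    unfolding inner P_def by (rule expectation_finite_partition[OF A])
  also have "(\<Sum>i\<in>A. pmf t i * (if z i = 0 then 0 else ?Q n (z(i := z i - 1)))) =
     (if sum z A \<le> Suc n then fact n / fact (Suc n - sum z A) * (1 - P) ^ (Suc n - sum z A) * ?W z
         else 0) * real (sum z A)"
    by (simp only: wi sum_distrib_left[symmetric] of_nat_sum cong: sum.cong)
  also have "\<dots> + (1 - P) * ?Q n z = ?Q (Suc n) z"
  proof -
    \<comment> \<open>In the main case the recursion amounts to n + 1 = (n + 1 - S) + S for the
      total S; at S = n + 1 the last ball cannot fall outside \<open>A\<close>.\<close>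
    consider "sum z A \<le> n" | "sum z A = Suc n" | "sum z A > Suc n" by linarith
    thus ?thesis
    proof cases
      case 1
      define r where "r = n - sum z A"
      have n: "n = r + sum z A" using 1 by (simp add: r_def)
      have s: "Suc n - sum z A = Suc r" "n - sum z A = r" using 1 by (auto simp: r_def)
      have f: "fact (Suc n) = (real r + 1 + sum z A) * fact n" by (simp add: n)
      have g: "(fact (Suc r) :: real) = (real r + 1) * fact r" by simp
      have alg: "F / (R * h) * (Q * X) * W * S + Q * (F / h * W * X) = (R + S) * F / (R * h) * W *
          (Q * X)"
        if "R > 0" "h > 0" for F R h Q X W S :: real
        using that by (simp add: field_simps)
      have "sum z A \<le> Suc n" using 1 by simp
      thus ?thesis using 1 by (simp only: s f g if_True power_Suc) (rule alg, auto)
    qed auto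
  qed
  finally show ?case .
qed

lemma pmf_poisson_vec:
  "pmf (poisson_vec (map g is)) (map z is) = (\<Prod>i\<leftarrow>is. pmf (poisson_pmf (g i)) (z i))"
proof (induction "is")
  case (Cons i "is")
  have "poisson_vec (map g (i # is)) =
      map_pmf (\<lambda>(x, xs). x # xs) (pair_pmf (poisson_pmf (g i)) (poisson_vec (map g is)))"
    by (simp add: pair_pmf_def map_bind_pmf map_pmf_def bind_assoc_pmf bind_return_pmf)
  also have "pmf \<dots> (map z (i # is)) = pmf (pair_pmf (poisson_pmf (g i)) (poisson_vec (map g is))) (z
      i, map z is)"
    using pmf_map_inj'[of "\<lambda>(x, xs). x # xs" _ "(z i, map z is)"] by (auto simp: inj_def)
  finally show ?case by (simp add: pmf_pair Cons.IH)
qed simp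

lemma distinct_map_surj:
  "distinct is \<Longrightarrow> length xs = length is \<Longrightarrow> \<exists>z. xs = map z is"
proof (induction xs arbitrary: "is")
  case (Cons x xs)
  then obtain i is' where i: "is = i # is'" by (cases "is") auto
  with Cons obtain z where "xs = map z is'" by auto
  thus ?case using i Cons.prems by (intro exI[of _ "z(i := x)"]) auto
qed simp

definition counts :: "nat \<Rightarrow> nat list \<Rightarrow> (nat \<Rightarrow> nat) \<Rightarrow> nat list" where
  "counts k is T = map (\<lambda>i. balls_in k {i} T) is"

text \<open>Poisson weights differ from multinomial ones by powers of n = k - 1 and exponentials
  whose product depends on the counts only through their total; these collect in
  \<open>lratio\<close>.\<close>

lemma pmf_counts:
  fixes p :: real
  assumes "distinct is" "length xs = length is" "k \<ge> 2"
    and pos: "\<And>i. i \<in> set is \<Longrightarrow> pmf (tilted_bin k p) i > 0"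
  shows "pmf (map_pmf (counts k is) (placement k p)) xs =
    lratio (k - 1) (\<Sum>i\<leftarrow>is. pmf (tilted_bin k p) i) (sum_list xs) *
      pmf (poisson_vec (map (\<lambda>i. (real k - 1) * pmf (tilted_bin k p) i) is)) xs"
proof -
  obtain z where z: "xs = map z is" using distinct_map_surj assms by blast
  define n where "n = k - 1"
  have n: "real k - 1 = real n" "n \<ge> 1" using assms by (auto simp: n_def)
  let ?t = "tilted_bin k p"
  let ?A = "set is"
  let ?P = "\<Sum>i\<in>?A. pmf ?t i"
  let ?m = "sum z ?A"
  have "counts k is -` {xs} = {T. \<forall>i\<in>?A. card {j. j < n \<and> T j = i} = z i}"
    by (auto simp: z counts_def balls_in_def n_def)
  hence "pmf (map_pmf (counts k is) (placement k p)) xs =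
      measure_pmf.prob (Pi_pmf {..<n} 0 (\<lambda>_. ?t)) {T. \<forall>i\<in>?A. card {j. j < n \<and> T j = i} = z i}"
    by (simp add: pmf_map placement_def n_def)
  also have "\<dots> = (if ?m \<le> n then fact n / fact (n - ?m) * (\<Prod>i\<in>?A. pmf ?t i ^ z i / fact (z i)) * (1
      - ?P) ^ (n - ?m) else 0)"
    by (rule multinomial_prob) simp
  also have "\<dots> = lratio n ?P ?m * (\<Prod>i\<in>?A. pmf (poisson_pmf (n * pmf ?t i)) (z i))"
  proof -
    have "(\<Prod>i\<in>?A. pmf (poisson_pmf (n * pmf ?t i)) (z i)) =
        (\<Prod>i\<in>?A. real n ^ z i * (exp (- (real n * pmf ?t i)) * (pmf ?t i ^ z i / fact (z i))))"
      using pos n by (intro prod.cong) (auto simp: power_mult_distrib)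
    also have "\<dots> = real n ^ ?m * (exp (- (real n * ?P)) * (\<Prod>i\<in>?A. pmf ?t i ^ z i / fact (z i)))"
    proof -
      have "(\<Prod>i\<in>?A. exp (- (real n * pmf ?t i))) = exp (- (real n * ?P))"
        by (simp add: sum_distrib_left exp_sum flip: sum_negf)
      thus ?thesis by (simp only: prod.distrib power_sum)
    qed
    finally show ?thesis using n by (simp add: lratio_def exp_minus field_simps)
  qed
  also have "(\<Prod>i\<in>?A. pmf (poisson_pmf (n * pmf ?t i)) (z i)) = pmf (poisson_vec (map (\<lambda>i. n * pmf ?t
      i) is)) xs"
    using assms(1) by (simp add: z pmf_poisson_vec prod.distinct_set_conv_list)
  also have "?m = sum_list xs" using assms(1) by (simp add: z sum.distinct_set_conv_list)
  also have "?P = (\<Sum>i\<leftarrow>is. pmf ?t i)" using assms(1) by (simp add: sum.distinct_set_conv_list)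
  finally show ?thesis by (simp only: n n_def[symmetric])
qed

section \<open>The tree event in terms of bin counts\<close>

definition fwd :: "nat \<Rightarrow> nat list" where
  "fwd a = [1..<Suc a]"

definition bwd :: "nat \<Rightarrow> nat \<Rightarrow> nat list" where
  "bwd k b = map (\<lambda>i. k - i) [0..<b]"

lemma length_fwd [simp]: "length (fwd a) = a" and length_bwd [simp]: "length (bwd k b) = b"
  by (auto simp: fwd_def bwd_def)

lemma set_fwd: "set (fwd a) = {1..a}"
  by (auto simp: fwd_def)

lemma set_bwd:
  assumes "b \<le> k"
  shows "set (bwd k b) = {k - b + 1..k}"
proof (intro equalityI subsetI)
  fix x assume "x \<in> {k - b + 1..k}"
  hence "x = k - (k - x)" "k - x < b" using assms by auto
  thus "x \<in> set (bwd k b)" by (auto simp: bwd_def)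
qed (use assms in \<open>auto simp: bwd_def\<close>)

lemma distinct_fwd_bwd:
  assumes "a + b \<le> k"
  shows "distinct (fwd a @ bwd k b)"
  using assms set_bwd[of b k]
  by (auto simp: set_fwd distinct_map inj_on_def fwd_def bwd_def simp del: upt_Suc)

lemma take_fwd: "t \<le> a \<Longrightarrow> take t (fwd a) = fwd t"
  by (simp add: fwd_def take_upt del: upt_Suc)

lemma take_bwd: "t \<le> b \<Longrightarrow> take t (bwd k b) = bwd k t"
  by (simp add: bwd_def take_map take_upt)

lemma sum_list_counts:
  assumes "distinct is"
  shows "sum_list (counts k is T) = balls_in k (set is) T"
proof -
  have "{j \<in> {..<k - 1}. T j \<in> set is} = (\<Union>i\<in>set is. {j \<in> {..<k - 1}. T j = i})" by auto
  hence "balls_in k (set is) T = (\<Sum>i\<in>set is. card {j \<in> {..<k - 1}. T j = i})"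
    by (simp only: balls_in_def) (rule card_UN_disjoint, auto)
  thus ?thesis
    using assms by (simp add: counts_def balls_in_def sum.distinct_set_conv_list)
qed

lemma Y_eq: "Y k T t = 1 + int (balls_in k {1..t} T) - int t"
proof (induction t)
  case (Suc t)
  have "balls_in k {1..Suc t} T = balls_in k {1..t} T + balls_in k {Suc t} T"
    unfolding balls_in_def
    by (subst card_Un_disjoint[symmetric]) (auto intro!: arg_cong[where f=card])
  thus ?case using Suc by simp
qed (simp add: balls_in_def)

lemma stays_fwd:
  "stays_pos 1 1 (counts k (fwd a) T) \<longleftrightarrow> (\<forall>t\<in>{1..a}. Y k T t > 0)"
proof -
  have "sum_list (take t (counts k (fwd a) T)) = balls_in k {1..t} T" if "t \<le> a" for t
    using that sum_list_counts[of "fwd t" k T]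
    by (simp add: counts_def take_map take_fwd set_fwd) (simp add: fwd_def)
  thus ?thesis
    unfolding stays_pos_iff by (simp add: Y_eq counts_def) (smt (verit) atLeastAtMost_iff)
qed

lemma set_pmf_tilted_bin:
  assumes "0 < p" "p \<le> 1" "1 \<le> k"
  shows "set_pmf (tilted_bin k p) \<subseteq> {1..k}"
  using pmf_tilted_bin[OF assms] by (auto simp: set_pmf_eq split: if_splits)

lemma placement_range:
  assumes "0 < p" "p \<le> 1" "1 \<le> k" "T \<in> set_pmf (placement k p)" "j < k - 1"
  shows "T j \<in> {1..k}"
  using assms set_Pi_pmf[of "{..<k - 1}" 0 "\<lambda>_. tilted_bin k p"] set_pmf_tilted_bin[OF assms(1-3)]
  by (auto simp: placement_def PiE_dflt_def)

text \<open>All k - 1 balls lie in the bins 1 to k, so Y at k - s equals s minus the number of balls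
  in the last \<open>s\<close> bins: the height of the right walk after \<open>s\<close> steps.
  Membership in the support supplies the range of the balls.\<close>

lemma stays_bwd:
  assumes p: "0 < p" "p \<le> 1" and k: "1 \<le> k" and T: "T \<in> set_pmf (placement k p)" and b: "b \<le> k"
  shows "stays_pos (-1) 0 (counts k (bwd k b) T) \<longleftrightarrow> (\<forall>s\<in>{1..b}. Y k T (k - s) > 0)"
proof -
  have "0 < 0 + -1 * (int (sum_list (take s (counts k (bwd k b) T))) - int s) \<longleftrightarrow> Y k T (k - s) > 0"
    if s: "s \<le> b" for s
  proof -
    have "distinct (bwd k s)" using distinct_fwd_bwd[of 0 s k] s b by simp
    hence "sum_list (take s (counts k (bwd k b) T)) = balls_in k {k - s + 1..k} T"
      using s b sum_list_counts[of "bwd k s" k T]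
      by (simp add: counts_def take_map take_bwd set_bwd)
    moreover have "balls_in k {1..k - s} T + balls_in k {k - s + 1..k} T = k - 1"
    proof -
      have "balls_in k {1..k - s} T + balls_in k {k - s + 1..k} T = card {..<k - 1}"
        unfolding balls_in_def
      proof (subst card_Un_disjoint[symmetric])
        show "card ({j \<in> {..<k - 1}. T j \<in> {1..k - s}} \<union> {j \<in> {..<k - 1}. T j \<in> {k - s + 1..k}}) =
            card {..<k - 1}"
          using placement_range[OF p k T] by (intro arg_cong[where f=card]) fastforce
      qed auto
      thus ?thesis by simp
    qed
    ultimately show ?thesis using s b k by (simp add: Y_eq of_nat_diff) linarith
  qed
  thus ?thesis unfolding stays_pos_iff by (auto simp: counts_def)
qed

lemma TREE_imp_stays:
  assumes "0 < p" "p \<le> 1" "T \<in> set_pmf (placement k p)" "T \<in> TREE k" "L < k"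
  shows "stays_pos 1 1 (counts k (fwd L) T) \<and> stays_pos (-1) 0 (counts k (bwd k L) T)"
proof -
  have "Y k T (k - s) > 0" if "s \<in> {1..L}" for s
  proof -
    have "k - s \<in> {1..k - 1}" using that assms(5) by auto
    thus ?thesis using assms(4) unfolding TREE_def by blast
  qed
  thus ?thesis using assms stays_bwd[of p k T L] by (auto simp: TREE_def stays_fwd)
qed

lemma stays_imp_TREE:
  assumes "0 < p" "p \<le> 1" "T \<in> set_pmf (placement k p)" "k - 1 \<le> a + b" "b \<le> k" "1 \<le> k"
    and "stays_pos 1 1 (counts k (fwd a) T)" "stays_pos (-1) 0 (counts k (bwd k b) T)"
  shows "T \<in> TREE k"
proof -
  have "Y k T t > 0" if "t \<in> {1..k - 1}" for t
  proof (cases "t \<le> a")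
    case True
    thus ?thesis using assms(7) that by (auto simp: stays_fwd)
  next
    case False
    hence "k - t \<in> {1..b}" "t = k - (k - t)" using that assms by auto
    thus ?thesis using assms stays_bwd[of p k T b] by metis
  qed
  thus ?thesis by (auto simp: TREE_def)
qed

lemma expectation_balls_in:
  "measure_pmf.expectation (placement k p) (\<lambda>T. real (balls_in k B T)) =
     real (k - 1) * measure_pmf.prob (tilted_bin k p) B"
proof -
  have "real (balls_in k B T) = (\<Sum>j<k - 1. indicator B (T j))" for T
    by (simp add: balls_in_def indicator_def sum.If_cases Int_def)
  hence "measure_pmf.expectation (placement k p) (\<lambda>T. real (balls_in k B T)) =
      (\<Sum>j<k - 1. measure_pmf.expectation (placement k p) (\<lambda>T. indicator B (T j)))"
    by (simp only:) (rule Bochner_Integration.integral_sum, rule integrable_pmf_bounded[where B=1],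
        auto)
  also have "\<dots> = (\<Sum>j<k - 1. measure_pmf.prob (tilted_bin k p) B)"
  proof (intro sum.cong refl)
    fix j assume "j \<in> {..<k - 1}"
    hence "map_pmf (\<lambda>f. f j) (placement k p) = tilted_bin k p"
      unfolding placement_def by (subst Pi_pmf_component) auto
    hence "measure_pmf.prob (tilted_bin k p) B = measure_pmf.expectation (map_pmf (\<lambda>f. f j)
        (placement k p)) (indicator B)"
      by simp
    thus "measure_pmf.expectation (placement k p) (\<lambda>T. indicator B (T j)) = measure_pmf.prob
        (tilted_bin k p) B"
      by (simp only: integral_map_pmf)
  qed
  finally show ?thesis by simp
qed

definition lam :: "nat \<Rightarrow> real \<Rightarrow> nat \<Rightarrow> real" where
  "lam k p i = (real k - 1) * pmf (tilted_bin k p) i"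

lemma sum_list_lam: "sum_list (map (lam k p) is) = (real k - 1) * sum_list (map (pmf (tilted_bin k
    p)) is)"
  by (simp add: lam_def[abs_def] sum_list_const_mult)

lemma expectation_balls_in_set:
  assumes "distinct is" "1 \<le> k"
  shows "measure_pmf.expectation (placement k p) (\<lambda>T. real (balls_in k (set is) T)) = sum_list (map
      (lam k p) is)"
  using assms unfolding expectation_balls_in
  by (simp add: measure_measure_pmf_finite sum.distinct_set_conv_list sum_list_lam of_nat_diff)

lemma mu_L_eq: "1 \<le> k \<Longrightarrow> mu_L k p L = sum_list (map (lam k p) (fwd L))"
  using expectation_balls_in_set[of "fwd L" k p] by (simp add: mu_L_def m_L_def set_fwd) (simp add:
      fwd_def)

lemma mu_R_eq:
  assumes "1 \<le> k" "L \<le> k"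
  shows "mu_R k p L = sum_list (map (lam k p) (bwd k L))"
proof -
  have "distinct (bwd k L)" using distinct_fwd_bwd[of 0 L k] assms by simp
  thus ?thesis
    using assms expectation_balls_in_set[of "bwd k L" k p] by (simp add: mu_R_def m_R_def set_bwd)
qed

lemma m_L_eq: "m_L k L T = sum_list (counts k (fwd L) T)"
  using sum_list_counts[of "fwd L" k T] by (simp add: m_L_def set_fwd) (simp add: fwd_def)

lemma m_R_eq: "L \<le> k \<Longrightarrow> m_R k L T = sum_list (counts k (bwd k L) T)"
  using sum_list_counts[of "bwd k L" k T] distinct_fwd_bwd[of 0 L k] by (simp add: m_R_def set_bwd)

section \<open>Transfer between placements and two independent Poisson walks\<close>

lemma prob_poisson_vec_product:
  "measure_pmf.prob (poisson_vec (ls @ ls'))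
       {xs. A (take (length ls) xs) \<and> B (drop (length ls) xs)} =
     measure_pmf.prob (poisson_vec ls) {xs. A xs} * measure_pmf.prob (poisson_vec ls') {xs. B xs}"
proof -
  have "measure_pmf.prob (poisson_vec (ls @ ls')) {xs. A (take (length ls) xs) \<and> B (drop (length ls)
      xs)} =
     measure_pmf.expectation (poisson_vec ls)
       (\<lambda>xs. measure_pmf.prob (poisson_vec ls') {xs. B xs} * indicator {xs. A xs} xs)"
    unfolding prob_poisson_vec_append
    by (intro Bochner_Integration.integral_cong_AE AE_pmfI) (auto dest!: length_poisson_vec simp:
        indicator_def)
  also have "\<dots> = measure_pmf.prob (poisson_vec ls') {xs. B xs} * measure_pmf.prob (poisson_vec ls)
      {xs. A xs}"
    by simp
  finally show ?thesis by simp
qed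

context
  fixes k :: nat and p :: real and a b :: nat and P :: real
  assumes k: "k \<ge> 2" and p: "0 < p" "p < 1" and ab: "a + b \<le> k"
  defines "P \<equiv> (\<Sum>i\<leftarrow>fwd a @ bwd k b. pmf (tilted_bin k p) i)"
begin

lemma pmf_tilted_bin_pos: "i \<in> {1..k} \<Longrightarrow> pmf (tilted_bin k p) i > 0"
  using p k power_Suc_less_one[of "1 - p" "k - 1"] by (subst pmf_tilted_bin) auto

lemma pmf_counts_fwd_bwd:
  "length xs = a + b \<Longrightarrow> pmf (map_pmf (counts k (fwd a @ bwd k b)) (placement k p)) xs =
    lratio (k - 1) P (sum_list xs) *
      pmf (poisson_vec (map (lam k p) (fwd a) @ map (lam k p) (bwd k b))) xs"
  unfolding P_def lam_def map_append[symmetric]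
  by (rule pmf_counts) (use k ab distinct_fwd_bwd[OF ab] set_bwd[of b k] in \<open>auto simp: set_fwd
      intro!: pmf_tilted_bin_pos\<close>)

text \<open>The length condition always holds for \<open>counts\<close>; it confines the event to
  the lists on which \<open>pmf_counts_fwd_bwd\<close> gives the ratio.\<close>

lemma prob_counts_eq:
  "measure_pmf.prob (placement k p) {T. A (counts k (fwd a) T) \<and> B (counts k (bwd k b) T)} =
    measure_pmf.prob (map_pmf (counts k (fwd a @ bwd k b)) (placement k p)) {xs. length xs = a + b \<and>
        A (take a xs) \<and> B (drop a xs)}"
  by (simp add: vimage_def counts_def)

lemma prob_poisson_fwd_bwd:
  "measure_pmf.prob (poisson_vec (map (lam k p) (fwd a) @ map (lam k p) (bwd k b))) {xs. length xs =
      a + b \<and> A (take a xs) \<and> B (drop a xs)}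
   = measure_pmf.prob (poisson_vec (map (lam k p) (fwd a))) {xs. A xs} * measure_pmf.prob
       (poisson_vec (map (lam k p) (bwd k b))) {xs. B xs}"
proof -
  have "measure_pmf.prob (poisson_vec (map (lam k p) (fwd a) @ map (lam k p) (bwd k b))) {xs. length
      xs = a + b \<and> A (take a xs) \<and> B (drop a xs)} =
    measure_pmf.prob (poisson_vec (map (lam k p) (fwd a) @ map (lam k p) (bwd k b)))
      {xs. A (take (length (map (lam k p) (fwd a))) xs) \<and> B (drop (length (map (lam k p) (fwd a)))
          xs)}"
    by (intro measure_pmf.finite_measure_eq_AE AE_pmfI) (auto dest!: length_poisson_vec)
  thus ?thesis by (simp only: prob_poisson_vec_product)
qed

lemma P_nonneg: "P \<ge> 0"
  unfolding P_def by (intro sum_list_nonneg) auto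

lemma prob_counts_le:
  assumes P: "(real k - 1) * (1 - P) \<ge> 2"
  shows "measure_pmf.prob (placement k p) {T. A (counts k (fwd a) T) \<and> B (counts k (bwd k b) T)} \<le>
    sqrt ((real k - 1) / ((real k - 1) * (1 - P) - 1)) *
    (measure_pmf.prob (poisson_vec (map (lam k p) (fwd a))) {xs. A xs} *
     measure_pmf.prob (poisson_vec (map (lam k p) (bwd k b))) {xs. B xs})"
  unfolding prob_counts_eq prob_poisson_fwd_bwd[symmetric]
proof (rule prob_le_of_pmf_le)
  have P1: "P < 1"
  proof (rule ccontr)
    assume "\<not> P < 1"
    hence "(real k - 1) * (1 - P) \<le> 0" using k by (intro mult_nonneg_nonpos) auto
    thus False using P by simp
  qed
  fix xs assume "xs \<in> {xs. length xs = a + b \<and> A (take a xs) \<and> B (drop a xs)}"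
  hence len: "length xs = a + b" by simp
  have "lratio (k - 1) P (sum_list xs) \<le> sqrt (real (k - 1) / (real (k - 1) * (1 - P) - 1))"
    using P P1 P_nonneg k by (intro lratio_le) (auto simp: of_nat_diff)
  thus "pmf (map_pmf (counts k (fwd a @ bwd k b)) (placement k p)) xs \<le>
    sqrt ((real k - 1) / ((real k - 1) * (1 - P) - 1)) *
      pmf (poisson_vec (map (lam k p) (fwd a) @ map (lam k p) (bwd k b))) xs"
    unfolding pmf_counts_fwd_bwd[OF len] using k by (intro mult_right_mono) (auto simp: of_nat_diff)
qed (use P k in auto)

lemma sum_lam_eq: "sum_list (map (lam k p) (fwd a)) + sum_list (map (lam k p) (bwd k b)) = (real k -
    1) * P"
  by (simp add: P_def sum_list_lam distrib_left)

text \<open>Both blocks deviate by less than \<open>D\<close>, so the total deviates by at most 2 D.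
  The first assumption keeps at least one ball outside the two blocks, as \<open>lratio_ge\<close>
  requires.\<close>

lemma prob_counts_ge:
  assumes P: "(real k - 1) * P + 2 * D < real k - 1" "P < 1"
    and A: "\<And>xs. A xs \<Longrightarrow> \<bar>real (sum_list xs) - sum_list (map (lam k p) (fwd a))\<bar> < D"
    and B: "\<And>xs. B xs \<Longrightarrow> \<bar>real (sum_list xs) - sum_list (map (lam k p) (bwd k b))\<bar> < D"
  shows "exp (- ((2 * D)\<^sup>2 / ((real k - 1) * (1 - P)))) *
    (measure_pmf.prob (poisson_vec (map (lam k p) (fwd a))) {xs. A xs} *
     measure_pmf.prob (poisson_vec (map (lam k p) (bwd k b))) {xs. B xs}) \<le>
    measure_pmf.prob (placement k p) {T. A (counts k (fwd a) T) \<and> B (counts k (bwd k b) T)}"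
proof -
  let ?c = "(2 * D)\<^sup>2 / ((real k - 1) * (1 - P))"
  let ?Q = "poisson_vec (map (lam k p) (fwd a) @ map (lam k p) (bwd k b))"
  let ?E = "{xs. length xs = a + b \<and> A (take a xs) \<and> B (drop a xs)}"
  have n: "real (k - 1) = real k - 1" using k by (simp add: of_nat_diff)
  have "measure_pmf.prob ?Q ?E \<le> exp ?c * measure_pmf.prob (map_pmf (counts k (fwd a @ bwd k b))
      (placement k p)) ?E"
  proof (rule prob_le_of_pmf_le)
    fix xs assume "xs \<in> ?E"
    hence len: "length xs = a + b" and xs: "A (take a xs)" "B (drop a xs)" by auto
    have "real (sum_list xs) = real (sum_list (take a xs)) + real (sum_list (drop a xs))"
      by (metis append_take_drop_id sum_list_append of_nat_add)
    hence dev: "\<bar>real (sum_list xs) - (real k - 1) * P\<bar> \<le> 2 * D"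
      using A[OF xs(1)] B[OF xs(2)] sum_lam_eq by linarith
    hence lt: "sum_list xs < k - 1" using P n by linarith
    have "(real (sum_list xs) - (real k - 1) * P)\<^sup>2 \<le> (2 * D)\<^sup>2"
      using dev by (intro iffD1[OF abs_le_square_iff]) linarith
    hence "?c \<ge> (real (sum_list xs) - real (k - 1) * P)\<^sup>2 / (real (k - 1) * (1 - P))"
      unfolding n using k P by (intro divide_right_mono) auto
    hence "exp (- ?c) \<le> exp (- ((real (sum_list xs) - real (k - 1) * P)\<^sup>2 / (real (k - 1) * (1 -
        P))))"
      by simp
    also have "\<dots> \<le> lratio (k - 1) P (sum_list xs)"
      using k P P_nonneg lt by (intro lratio_ge) auto
    finally have "1 \<le> exp ?c * lratio (k - 1) P (sum_list xs)"
      by (simp add: exp_minus field_simps)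
    hence "1 * pmf ?Q xs \<le> exp ?c * lratio (k - 1) P (sum_list xs) * pmf ?Q xs"
      by (intro mult_right_mono) auto
    thus "pmf ?Q xs \<le> exp ?c * pmf (map_pmf (counts k (fwd a @ bwd k b)) (placement k p)) xs"
      unfolding pmf_counts_fwd_bwd[OF len] by (simp add: mult.assoc)
  qed auto
  thus ?thesis
    unfolding prob_counts_eq prob_poisson_fwd_bwd by (simp add: exp_minus field_simps)
qed

end

section \<open>Bounds for a fixed number of bins\<close>

lemma one_minus_power_le:
  fixes p :: real
  assumes "0 \<le> p" "p \<le> 1"
  shows "(1 - p) ^ k \<le> 1 - real k * p + real k * (real k - 1) / 2 * p\<^sup>2"
proof (induction k)
  case (Suc k)
  have "(1 - p) ^ Suc k \<le> (1 - p) * (1 - real k * p + real k * (real k - 1) / 2 * p\<^sup>2)"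
    using Suc assms by (auto intro!: mult_left_mono)
  also have "\<dots> = 1 - real (Suc k) * p + real (Suc k) * (real (Suc k) - 1) / 2 * p\<^sup>2
      - real k * (real k - 1) / 2 * p ^ 3"
    by (simp add: field_simps power2_eq_square power3_eq_cube)
  also have "\<dots> \<le> 1 - real (Suc k) * p + real (Suc k) * (real (Suc k) - 1) / 2 * p\<^sup>2"
    using assms by (cases k) auto
  finally show ?case .
qed simp

lemma one_minus_power_ge:
  fixes p :: real
  assumes "0 \<le> p" "p \<le> 1"
  shows "1 - real k * p + real k * (real k - 1) / 2 * p\<^sup>2 - real k * (real k - 1) * (real k - 2) / 6
      * p ^ 3 \<le> (1 - p) ^ k"
proof (induction k)
  case (Suc k)
  have nn: "0 \<le> real k * (real k - 1) * (real k - 2) / 6 * p ^ 4"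
  proof -
    consider "k = 0" | "k = 1" | "k \<ge> 2" by linarith
    thus ?thesis using assms by cases auto
  qed
  have "1 - real (Suc k) * p + real (Suc k) * (real (Suc k) - 1) / 2 * p\<^sup>2
      - real (Suc k) * (real (Suc k) - 1) * (real (Suc k) - 2) / 6 * p ^ 3
    \<le> 1 - real (Suc k) * p + real (Suc k) * (real (Suc k) - 1) / 2 * p\<^sup>2
      - real (Suc k) * (real (Suc k) - 1) * (real (Suc k) - 2) / 6 * p ^ 3
      + real k * (real k - 1) * (real k - 2) / 6 * p ^ 4"
    using nn by linarith
  also have "\<dots> = (1 - p) * (1 - real k * p + real k * (real k - 1) / 2 * p\<^sup>2 - real k * (real k - 1)
      * (real k - 2) / 6 * p ^ 3)"
    by (simp add: field_simps power2_eq_square power3_eq_cube power4_eq_xxxx)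
  also have "\<dots> \<le> (1 - p) ^ Suc k"
    using Suc assms by (auto intro!: mult_left_mono)
  finally show ?case .
qed simp

text \<open>The mean is (1 - 1/k) Q / G, with Q close to 1 - p (i - 1) and G, the normalising
  constant over k p, close to 1 - \<epsilon>. The second-order parts of Q and G and the factors with
  1/k make up the error.\<close>

lemma lam_approx:
  fixes p \<epsilon> :: real
  assumes k: "k \<ge> 2" and p: "p > 0" and \<epsilon>: "\<epsilon> = p * real k / 2" "\<epsilon> \<le> 1/10" and i: "i \<in> {1..k}"
  shows "\<bar>lam k p i - (1 + \<epsilon> - p * real i)\<bar> \<le> 5 * (\<epsilon>\<^sup>2 + 1 / real k)"
proof -
  define \<kappa> where "\<kappa> = 1 / real k"
  define s where "s = real (i - 1) * p"
  define Q where "Q = (1 - p) ^ (i - 1)"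
  define G where "G = (1 - (1 - p) ^ k) / (real k * p)"
  have kk: "0 < \<kappa>" "\<kappa> \<le> 1/2" using k by (auto simp: \<kappa>_def)
  have pe: "p = 2 * \<epsilon> * \<kappa>" using k unfolding \<kappa>_def \<epsilon>(1) by simp
  have e0: "\<epsilon> > 0" using p k unfolding \<epsilon>(1) by simp
  have p1: "p \<le> 1/10"
  proof -
    have "p = (2 * \<epsilon>) * \<kappa>" using pe by simp
    also have "\<dots> \<le> (2/10) * (1/2)" using kk \<epsilon> e0 by (intro mult_mono) auto
    finally show ?thesis by simp
  qed
  have s0: "0 \<le> s" using p by (simp add: s_def)
  have s2: "s \<le> 2 * \<epsilon>"
  proof -
    have "s \<le> real k * p" unfolding s_def using i p by (intro mult_right_mono) auto
    thus ?thesis using \<epsilon> by (simp add: mult.commute)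
  qed
  have si: "p * real i = s + p" using i by (simp add: s_def of_nat_diff algebra_simps)
  have Ql: "1 - s \<le> Q"
    unfolding Q_def s_def using Bernoulli_inequality[of "- p" "i - 1"] p1 by simp
  have Qu: "Q \<le> 1 - s + 2 * \<epsilon>\<^sup>2"
  proof -
    let ?j = "real (i - 1)"
    have "Q \<le> 1 - s + ?j * (?j - 1) / 2 * p\<^sup>2"
      unfolding Q_def s_def using one_minus_power_le[of p "i - 1"] p p1 by simp
    also have "?j * (?j - 1) / 2 * p\<^sup>2 \<le> ?j * ?j / 2 * p\<^sup>2"
      by (intro mult_right_mono divide_right_mono mult_left_mono) auto
    also have "\<dots> = s\<^sup>2 / 2" by (simp add: s_def power2_eq_square)
    also have "\<dots> \<le> (2 * \<epsilon>)\<^sup>2 / 2" using s0 s2 by (intro divide_right_mono power_mono) auto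
    finally show ?thesis by (simp add: power2_eq_square)
  qed
  have kp: "real k * p > 0" using k p by simp
  have Gl: "1 - \<epsilon> \<le> G"
  proof -
    have "real k * p * (1 - \<epsilon>) \<le> real k * p - real k * (real k - 1) / 2 * p\<^sup>2"
      using kp p by (simp add: \<epsilon> power2_eq_square algebra_simps)
    also have "\<dots> \<le> 1 - (1 - p) ^ k" using one_minus_power_le[of p k] p p1 by simp
    finally show ?thesis unfolding G_def using kp by (simp add: pos_le_divide_eq mult.commute)
  qed
  have Gu: "G \<le> 1 - \<epsilon> + \<epsilon> * \<kappa> + \<epsilon>\<^sup>2"
  proof -
    have "1 - (1 - p) ^ k \<le> real k * p - real k * (real k - 1) / 2 * p\<^sup>2 + real k * (real k - 1) *
        (real k - 2) / 6 * p ^ 3"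
      using one_minus_power_ge[of p k] p p1 by simp
    also have "real k * (real k - 1) * (real k - 2) / 6 * p ^ 3 \<le> real k * real k * real k / 6 * p ^
        3"
      using k p by (intro mult_right_mono divide_right_mono mult_mono) auto
    also have "real k * p - real k * (real k - 1) / 2 * p\<^sup>2 + real k * real k * real k / 6 * p ^ 3 =
        real k * p * (1 - \<epsilon> + \<epsilon> * \<kappa> + (2/3) * \<epsilon>\<^sup>2)"
      using k by (simp add: \<epsilon> \<kappa>_def power2_eq_square power3_eq_cube field_simps)
    finally have "G \<le> 1 - \<epsilon> + \<epsilon> * \<kappa> + (2/3) * \<epsilon>\<^sup>2"
      unfolding G_def using kp by (simp add: pos_divide_le_eq mult.commute)
    also have "(2/3) * \<epsilon>\<^sup>2 \<le> \<epsilon>\<^sup>2" by simp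
    finally show ?thesis by simp
  qed
  have G0: "G > 0" using Gl \<epsilon> by simp
  have lam: "lam k p i = (1 - \<kappa>) * Q / G"
  proof -
    have D: "1 - (1 - p) ^ k = G * (real k * p)" using kp unfolding G_def by simp
    have "lam k p i = (real k - 1) * (p * Q / (G * (real k * p)))"
      unfolding D[symmetric] using i k p p1 by (simp add: lam_def pmf_tilted_bin Q_def)
    thus ?thesis using G0 k p by (simp add: \<kappa>_def field_simps)
  qed
  have "lam k p i \<le> 1 + \<epsilon> - s + 5 * \<epsilon>\<^sup>2"
  proof -
    have "(1 - \<kappa>) * Q \<le> 1 * Q" using kk Ql s2 \<epsilon> by (intro mult_right_mono) auto
    also have "\<dots> \<le> 1 - s + 2 * \<epsilon>\<^sup>2" using Qu by simp
    also have "\<dots> \<le> (1 + \<epsilon> - s + 5 * \<epsilon>\<^sup>2) * (1 - \<epsilon>)"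
    proof -
      have "\<epsilon>\<^sup>2 * (5 * \<epsilon>) \<le> \<epsilon>\<^sup>2 * 2" using \<epsilon> by (intro mult_left_mono) auto
      moreover have "0 \<le> s * \<epsilon>" using s0 e0 by simp
      moreover have "(1 + \<epsilon> - s + 5 * \<epsilon>\<^sup>2) * (1 - \<epsilon>) = 1 - s + 4 * \<epsilon>\<^sup>2 + s * \<epsilon> - \<epsilon>\<^sup>2 * (5 * \<epsilon>)"
        by (simp add: power2_eq_square algebra_simps)
      ultimately show ?thesis by linarith
    qed
    also have "\<dots> \<le> (1 + \<epsilon> - s + 5 * \<epsilon>\<^sup>2) * G"
      using Gl s2 \<epsilon> by (intro mult_left_mono) (auto intro!: add_nonneg_nonneg)
    finally show ?thesis unfolding lam using G0 by (simp add: pos_divide_le_eq)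
  qed
  moreover have "1 + \<epsilon> - s - 3 * \<epsilon>\<^sup>2 - 3 * \<kappa> \<le> lam k p i"
  proof -
    \<comment> \<open>Chosen so that \<open>Gu\<close> reads G at most 1 - u; then (1 + u) (1 - u)
      at most 1 replaces division by G.\<close>
    define u where "u = \<epsilon> - \<epsilon> * \<kappa> - \<epsilon>\<^sup>2"
    have u: "u = \<epsilon> * (1 - \<kappa> - \<epsilon>)" by (simp add: u_def power2_eq_square algebra_simps)
    have u0: "0 \<le> u" unfolding u using e0 kk \<epsilon> by (intro mult_nonneg_nonneg) auto
    have u1: "u \<le> \<epsilon>" unfolding u using e0 kk \<epsilon> by (simp add: mult_le_cancel_left1)
    define X where "X = (1 - s) * (1 + u)"
    have X0: "0 \<le> X" unfolding X_def using s2 \<epsilon> u0 by (intro mult_nonneg_nonneg) auto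
    have X2: "X \<le> 1 * 2" unfolding X_def using s0 s2 \<epsilon> u0 u1 by (intro mult_mono) auto
    have "s * u \<le> (2 * \<epsilon>) * \<epsilon>" using s0 s2 u0 u1 e0 by (intro mult_mono) auto
    hence X1: "1 + u - s - 2 * \<epsilon>\<^sup>2 \<le> X" by (simp add: X_def power2_eq_square algebra_simps)
    have "X * G \<le> Q"
    proof -
      have "(1 + u) * G \<le> (1 + u) * (1 - u)"
        using Gu u0 by (intro mult_left_mono) (auto simp: u_def)
      also have "\<dots> \<le> 1" by (simp add: algebra_simps)
      finally have "(1 - s) * ((1 + u) * G) \<le> (1 - s) * 1" using s2 \<epsilon> by (intro mult_left_mono) auto
      thus ?thesis using Ql by (simp add: X_def mult.assoc)
    qed
    hence "(1 - \<kappa>) * (X * G) \<le> (1 - \<kappa>) * Q" using kk by (intro mult_left_mono) auto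
    hence "(1 - \<kappa>) * X \<le> lam k p i" unfolding lam using G0 by (simp add: pos_le_divide_eq
        mult.assoc)
    moreover have "\<kappa> * X \<le> \<kappa> * (1 * 2)" using X2 kk by (intro mult_left_mono) auto
    moreover have "\<epsilon> * \<kappa> \<le> 1 * \<kappa>" using \<epsilon> kk by (intro mult_right_mono) auto
    ultimately show ?thesis using X1 by (simp add: u_def algebra_simps)
  qed
  moreover have "p \<le> \<kappa>"
    unfolding pe using \<epsilon> kk by simp
  ultimately show ?thesis unfolding si \<kappa>_def[symmetric] using p kk zero_le_power2[of \<epsilon>]
    by (simp only: abs_le_iff) argo
qed

lemma sum_real_shift: "(\<Sum>t<j. real (L + t + 1)) = real j * real L + real j * (real j + 1) / 2"
  by (induction j) (auto simp: field_simps)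

text \<open>The drift shrinks linearly to about 0 at the middle, but its average over any initial
  stretch that stops before the middle is at least \<epsilon>/4; hence the control by partial
  sums.\<close>

lemma surv_drift_bound:
  fixes ls :: "real list" and s :: int
  assumes s: "s = 1 \<or> s = -1" and \<epsilon>: "\<epsilon> = p * real k / 2" "0 < \<epsilon>" "\<epsilon> \<le> 1"
    and k: "k > 0"
    and ls: "\<And>t. t < length ls \<Longrightarrow> \<epsilon> - p * real (L + t + 1) - \<epsilon> * \<eta> \<le> s * (ls ! t - 1)"
      "\<And>t. t < length ls \<Longrightarrow> 0 < ls ! t \<and> ls ! t \<le> 2"
    and len: "2 * (L + length ls) \<le> k" and \<eta>: "\<eta> + (real L + 1) / k \<le> 1/4"
  shows "1 - surv s ls y \<le> exp (- (\<epsilon> / 8) * y)"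
proof -
  \<comment> \<open>Per step the mean exponent is at most - \<theta> \<epsilon>/4 + 2 \<theta>^2,
    which is zero at \<theta> = \<epsilon>/8.\<close>
  let ?\<theta> = "\<epsilon> / 8"
  have "1 - surv s ls y \<le> exp (- ?\<theta> * y + 0)"
  proof (rule surv_exp_bound)
    fix j assume j: "j \<le> length ls"
    have psi: "psi s ?\<theta> (ls ! t) \<le> - ?\<theta> * (\<epsilon> - p * real (L + t + 1) - \<epsilon> * \<eta>) + 2 * ?\<theta>\<^sup>2" if t: "t <
        j" for t
    proof -
      have l: "0 < ls ! t" "ls ! t \<le> 2" using ls(2) t j by auto
      have "psi s ?\<theta> (ls ! t) \<le> - ?\<theta> * (s * (ls ! t - 1)) + ls ! t * ?\<theta>\<^sup>2"
        using s
      proof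
        assume "s = 1"
        have "psi 1 ?\<theta> (ls ! t) \<le> - ?\<theta> * (ls ! t - 1) + ls ! t * ?\<theta>\<^sup>2 / 2"
          using l \<epsilon>(2) by (intro psi_up_le) auto
        moreover have "0 \<le> ls ! t * ?\<theta>\<^sup>2" using l by simp
        ultimately show ?thesis unfolding \<open>s = 1\<close> of_int_1 mult_1_left by linarith
      next
        assume "s = -1"
        with psi_down_le[of ?\<theta> "ls ! t"] l \<epsilon>(2,3) show ?thesis by (simp add: algebra_simps)
      qed
      also have "ls ! t * ?\<theta>\<^sup>2 \<le> 2 * ?\<theta>\<^sup>2" using l by (intro mult_right_mono) auto
      also have "- ?\<theta> * (s * (ls ! t - 1)) \<le> - ?\<theta> * (\<epsilon> - p * real (L + t + 1) - \<epsilon> * \<eta>)"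
        using ls(1)[of t] t j \<epsilon>(2) by (intro mult_left_mono_neg) auto
      finally show ?thesis by simp
    qed
    have "(\<Sum>l\<leftarrow>take j ls. psi s ?\<theta> l) = (\<Sum>t<j. psi s ?\<theta> (ls ! t))"
      using j by (simp add: sum_list_sum_nth atLeast0LessThan)
    also have "\<dots> \<le> (\<Sum>t<j. - ?\<theta> * (\<epsilon> - p * real (L + t + 1) - \<epsilon> * \<eta>) + 2 * ?\<theta>\<^sup>2)"
      by (intro sum_mono psi) auto
    also have "\<dots> = (\<Sum>t<j. (- ?\<theta> * (\<epsilon> - \<epsilon> * \<eta>) + 2 * ?\<theta>\<^sup>2) + ?\<theta> * p * real (L + t + 1))"
      by (intro sum.cong refl) (simp add: field_simps)
    also have "\<dots> = real j * (- ?\<theta> * (\<epsilon> - \<epsilon> * \<eta>) + 2 * ?\<theta>\<^sup>2) + ?\<theta> * p * (real j * real L + real j *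
        (real j + 1) / 2)"
      by (simp only: sum.distrib sum_distrib_left[symmetric] sum_real_shift) (simp add: field_simps)
    also have "\<dots> = real j * ?\<theta> * (- \<epsilon> + \<epsilon> * \<eta> + 2 * ?\<theta> + p * (2 * real L + real j + 1) / 2)"
      by (simp add: field_simps power2_eq_square)
    also have "\<dots> \<le> 0"
    proof (intro mult_nonneg_nonpos)
      have "p = 2 * \<epsilon> / k" using k unfolding \<epsilon>(1) by simp
      hence "p * (2 * real L + real j + 1) / 2 = \<epsilon> * ((2 * real L + real j + 1) / k)" by simp
      also have "\<dots> \<le> \<epsilon> * (1/2 + (real L + 1) / k)"
      proof (intro mult_left_mono)
        have "2 * (L + j) \<le> 2 * (L + length ls)" using j by simp
        hence "2 * (L + j) \<le> k" using len by (rule order_trans)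
        hence "real (2 * (L + j)) \<le> real k" by (simp only: of_nat_le_iff)
        hence "2 * (real L + real j) \<le> k" by simp
        hence "(real L + real j) / k \<le> 1/2" using k by (simp add: divide_le_eq)
        moreover have "(2 * real L + real j + 1) / k = (real L + real j) / k + (real L + 1) / k"
          by (simp flip: add_divide_distrib)
        ultimately show "(2 * real L + real j + 1) / k \<le> 1/2 + (real L + 1) / k" by simp
      qed (use \<epsilon> in auto)
      finally have "- \<epsilon> + \<epsilon> * \<eta> + 2 * ?\<theta> + p * (2 * real L + real j + 1) / 2 \<le>
          \<epsilon> * ((\<eta> + (real L + 1) / k) - 1/4)" by (simp add: algebra_simps)
      also have "\<dots> \<le> 0" using \<eta> \<epsilon> by (intro mult_nonneg_nonpos) auto
      finally show "- \<epsilon> + \<epsilon> * \<eta> + 2 * ?\<theta> + p * (2 * real L + real j + 1) / 2 \<le> 0" .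
    qed (use \<epsilon> in auto)
    finally show "(\<Sum>l\<leftarrow>take j ls. psi s ?\<theta> l) \<le> 0" .
  next
    fix l assume "l \<in> set ls"
    thus "0 < l" using ls(2) by (auto simp: in_set_conv_nth)
  qed (use \<epsilon> in auto)
  thus ?thesis by simp
qed

definition good :: "int \<Rightarrow> int \<Rightarrow> real \<Rightarrow> real list \<Rightarrow> nat list \<Rightarrow> bool" where
  "good s y D ls xs \<longleftrightarrow> stays_pos s y xs \<and> \<bar>real (sum_list xs) - sum_list ls\<bar> < D"

lemma prob_good_le: "measure_pmf.prob (poisson_vec ls) {xs. good s y D ls xs} \<le> surv s ls y"
  unfolding surv_def by (intro measure_pmf.finite_measure_mono) (auto simp: good_def)

lemma prob_good_ge:
  assumes "\<And>l. l \<in> set ls \<Longrightarrow> 0 < l \<and> l \<le> b" "D > 0" "b \<ge> 0"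
  shows "surv s ls y - b * (\<Sum>j<length ls. surv s (take j ls) y) / D\<^sup>2 \<le>
    measure_pmf.prob (poisson_vec ls) {xs. good s y D ls xs}"
proof -
  have "surv s ls y = measure_pmf.prob (poisson_vec ls) ({xs. good s y D ls xs} \<union> 
      {xs. stays_pos s y xs \<and> \<bar>real (sum_list xs) - sum_list ls\<bar> \<ge> D})"
    unfolding surv_def by (rule arg_cong[where f="measure_pmf.prob _"]) (auto simp: good_def)
  also have "\<dots> \<le> measure_pmf.prob (poisson_vec ls) {xs. good s y D ls xs} +
      measure_pmf.prob (poisson_vec ls) {xs. stays_pos s y xs \<and> \<bar>real (sum_list xs) - sum_list ls\<bar> \<ge>
          D}"
    by (rule measure_Un_le) auto
  finally show ?thesis using prob_stays_deviation[OF assms, of ls s y] by simp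
qed

text \<open>After a good first block the height is within \<open>D\<close> of its mean; the second
  block is an independent walk restarted there, and \<open>F\<close> bounds its death
  uniformly.\<close>

lemma prob_good_then_dies:
  assumes s: "s = 1 \<or> s = -1"
    and F: "\<And>y'. y + s * (sum_list ls - real (length ls)) - D \<le> real_of_int y' \<Longrightarrow> 1 - surv s ls' y' \<le>
        F"
    and F0: "F \<ge> 0"
  shows "measure_pmf.prob (poisson_vec (ls @ ls')) {xs. good s y D ls (take (length ls) xs) \<and> \<not>
      stays_pos s y xs} \<le>
    surv s ls y * F"
proof -
  have "measure_pmf.prob (poisson_vec (ls @ ls')) {xs. good s y D ls (take (length ls) xs) \<and> \<not>
      stays_pos s y xs} =
     measure_pmf.expectation (poisson_vec ls) (\<lambda>xs. measure_pmf.prob (poisson_vec ls') {ys. xs @ ys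
         \<in>
       {xs. good s y D ls (take (length ls) xs) \<and> \<not> stays_pos s y xs}})"
    by (rule prob_poisson_vec_append)
  also have "\<dots> \<le> measure_pmf.expectation (poisson_vec ls) (\<lambda>xs. F * indicator {xs. good s y D ls xs}
      xs)"
  proof (intro integral_mono_AE AE_pmfI)
    fix xs assume "xs \<in> set_pmf (poisson_vec ls)"
    hence len: "length xs = length ls" by (rule length_poisson_vec)
    show "measure_pmf.prob (poisson_vec ls') {ys. xs @ ys \<in>
       {xs. good s y D ls (take (length ls) xs) \<and> \<not> stays_pos s y xs}} \<le> F * indicator {xs. good s y
           D ls xs} xs"
    proof (cases "good s y D ls xs")
      case True
      let ?y = "y + s * (int (sum_list xs) - int (length ls))"
      have "{ys. xs @ ys \<in> {xs. good s y D ls (take (length ls) xs) \<and> \<not> stays_pos s y xs}} =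
          space (measure_pmf (poisson_vec ls')) - {ys. stays_pos s ?y ys}"
        using True len by (auto simp: stays_pos_append good_def)
      also have "measure_pmf.prob (poisson_vec ls') \<dots> = 1 - surv s ls' ?y"
        unfolding surv_def by (rule measure_pmf.prob_compl) auto
      also have "\<dots> \<le> F"
      proof (rule F)
        have "\<bar>real (sum_list xs) - sum_list ls\<bar> < D" using True by (simp add: good_def)
        thus "y + s * (sum_list ls - real (length ls)) - D \<le> real_of_int ?y"
          using s by auto
      qed
      finally show ?thesis using True by simp
    qed (simp add: len)
  qed (auto intro!: integrable_pmf_bounded[where B="max 1 F"] simp: indicator_def F0
      le_max_iff_disj)
  also have "\<dots> = F * measure_pmf.prob (poisson_vec ls) {xs. good s y D ls xs}" by simp
  also have "\<dots> \<le> F * surv s ls y" using F0 prob_good_le by (intro mult_left_mono) auto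
  finally show ?thesis by (simp add: mult.commute)
qed

text \<open>Bounds for the walks over the first (up) and the last (down) \<open>L\<close> bins when the drift lies
  between \<open>\<delta>'\<close> and \<open>\<delta>\<close>; the good variants also ask that the number of balls deviate from its mean
  by less than \<open>w * sqrt L\<close>.\<close>

definition up_bound :: "nat \<Rightarrow> real \<Rightarrow> real" where
  "up_bound L \<delta> = 2 * \<delta> * (1 + 2 * \<delta>) + 2 / (\<delta> * L)"

definition down_bound :: "nat \<Rightarrow> real \<Rightarrow> real" where
  "down_bound L \<delta> = \<delta> + 1 / sqrt L"

definition up_good_bound :: "nat \<Rightarrow> real \<Rightarrow> real \<Rightarrow> real \<Rightarrow> real" where
  "up_good_bound L \<delta> \<delta>' w = 1 - exp (- (2 * \<delta>' / (1 + \<delta>'))) -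
     (1 + \<delta>) * (L * (2 * \<delta> * (1 + 2 * \<delta>)) + 2 / \<delta>) / (w\<^sup>2 * L)"

definition down_good_bound :: "nat \<Rightarrow> real \<Rightarrow> real \<Rightarrow> real \<Rightarrow> real" where
  "down_good_bound L \<delta> \<delta>' w = \<delta>' - (1 + \<delta>) * (1 + L * \<delta> + 2 * sqrt L) / (w\<^sup>2 * L)"

text \<open>\<open>\<eta>\<close> is the relative error of \<open>lam_approx\<close>, and
  \<open>\<rho>\<close> adds the loss of drift over the outer \<open>L\<close> bins.\<close>

context
  fixes k L :: nat and p \<epsilon> \<eta> \<rho> \<delta> \<delta>' :: real
  assumes k: "k \<ge> 40" and L: "L \<ge> 1" and p: "p > 0" and \<epsilon>: "\<epsilon> = p * real k / 2" and \<epsilon>1: "\<epsilon> \<le> 1/20"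
    and \<eta>: "\<eta> = 5 * (\<epsilon> + 1 / (real k * \<epsilon>))" and \<rho>: "\<rho> = \<eta> + 2 * (real L + 1) / real k" and \<rho>1: "\<rho> \<le>
        1/8"
    and \<delta>: "\<delta> = \<epsilon> * (1 + \<eta>)" and \<delta>': "\<delta>' = \<epsilon> * (1 - \<rho>)"
begin

lemma eps_pos: "\<epsilon> > 0"
  using p k unfolding \<epsilon> by simp

lemma p_eq: "p = 2 * \<epsilon> / k"
  using k unfolding \<epsilon> by simp

lemma eta_bounds: "0 < \<eta>" "\<eta> \<le> 1/8"
  using eps_pos k \<rho> \<rho>1 by (auto simp: \<eta> intro!: add_pos_pos) (smt (verit) divide_nonneg_nonneg
      of_nat_0_le_iff)

lemma L_bound: "real L + 1 \<le> real k / 16"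
proof -
  have "2 * (real L + 1) / real k \<le> 1/8" using \<rho> \<rho>1 eta_bounds by linarith
  thus ?thesis using k by (simp add: field_simps)
qed

lemma delta_bounds: "0 < \<delta>" "\<delta> \<le> 1/10" "\<epsilon> \<le> \<delta>" "0 < \<delta>'" "\<epsilon> / 2 \<le> \<delta>'" "\<delta>' \<le> \<epsilon>"
proof -
  have "\<epsilon> * (1 + \<eta>) \<le> (1/20) * (1 + 1/8)" using eps_pos \<epsilon>1 eta_bounds by (intro mult_mono) auto
  thus "\<delta> \<le> 1/10" unfolding \<delta> by simp
  show "0 < \<delta>" unfolding \<delta> using eps_pos eta_bounds by (intro mult_pos_pos) auto
  show "\<epsilon> \<le> \<delta>" unfolding \<delta> using eps_pos eta_bounds by (simp add: algebra_simps)
  have "\<epsilon> * (1/2) \<le> \<epsilon> * (1 - \<rho>)" using eps_pos \<rho>1 by (intro mult_left_mono) auto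
  thus "\<epsilon> / 2 \<le> \<delta>'" "0 < \<delta>'" unfolding \<delta>' using eps_pos by auto
  have "\<rho> \<ge> 0" using eta_bounds \<rho> by simp
  thus "\<delta>' \<le> \<epsilon>" unfolding \<delta>' using eps_pos by (simp add: algebra_simps)
qed

lemma p_lt_1: "p < 1"
proof -
  have "2 * \<epsilon> / k < 1" using \<epsilon>1 k by (simp add: field_simps)
  thus ?thesis using p_eq by simp
qed

lemma lam_bounds:
  assumes "i \<in> {1..k}"
  shows "1 + \<epsilon> - p * real i - \<epsilon> * \<eta> \<le> lam k p i" "lam k p i \<le> 1 + \<epsilon> - p * real i + \<epsilon> * \<eta>"
proof -
  have "\<bar>lam k p i - (1 + \<epsilon> - p * real i)\<bar> \<le> 5 * (\<epsilon>\<^sup>2 + 1 / real k)"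
    using k p \<epsilon>1 assms by (intro lam_approx[OF _ _ \<epsilon>]) auto
  also have "\<dots> = \<epsilon> * \<eta>" using eps_pos unfolding \<eta> by (simp add: power2_eq_square field_simps)
  finally show "1 + \<epsilon> - p * real i - \<epsilon> * \<eta> \<le> lam k p i" "lam k p i \<le> 1 + \<epsilon> - p * real i + \<epsilon> * \<eta>"
    by linarith+
qed

lemma lam_general:
  assumes "i \<in> {1..k}"
  shows "1 - \<delta> \<le> lam k p i" "lam k p i \<le> 1 + \<delta>" "0 < lam k p i" "lam k p i \<le> 2"
proof -
  have "p * real i \<le> p * real k" using assms p by (intro mult_left_mono) auto
  hence "p * real i \<le> 2 * \<epsilon>" using \<epsilon> by simp
  thus 1: "1 - \<delta> \<le> lam k p i" using lam_bounds[OF assms] unfolding \<delta> by (simp add: algebra_simps)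
  show 2: "lam k p i \<le> 1 + \<delta>"
    using lam_bounds[OF assms] p unfolding \<delta> by (simp add: algebra_simps) (smt (verit)
        mult_nonneg_nonneg of_nat_0_le_iff)
  show "0 < lam k p i" "lam k p i \<le> 2" using 1 2 delta_bounds by auto
qed

lemma pL: "p * real L \<le> \<epsilon> * (\<rho> - \<eta>)"
  using k eps_pos unfolding p_eq \<rho> by (simp add: field_simps)

lemma lam_fwd:
  assumes "i \<in> set (fwd L)"
  shows "1 + \<delta>' \<le> lam k p i"
proof -
  have i: "i \<in> {1..k}" "i \<le> L" using assms L_bound by (auto simp: set_fwd)
  have "p * real i \<le> p * real L" using i p by (intro mult_left_mono) auto
  thus ?thesis using lam_bounds(1)[OF i(1)] pL unfolding \<delta>' by (simp add: algebra_simps)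
qed

lemma lam_bwd_nth:
  assumes "j < k"
  shows "lam k p (k - j) \<le> 1 - \<epsilon> + p * real j + \<epsilon> * \<eta>"
proof -
  have "k - j \<in> {1..k}" using assms by auto
  moreover have "p * real (k - j) = 2 * \<epsilon> - p * real j" using assms \<epsilon> by (simp add: of_nat_diff
      algebra_simps)
  ultimately show ?thesis using lam_bounds(2)[of "k - j"] by simp
qed

lemma lam_bwd:
  assumes "i \<in> set (bwd k L)"
  shows "lam k p i \<le> 1 - \<delta>'"
proof -
  obtain j where j: "i = k - j" "j < L" using assms by (auto simp: bwd_def)
  have "p * real j \<le> p * real L" using j p by (intro mult_left_mono) auto
  thus ?thesis using lam_bwd_nth[of j] j L_bound pL unfolding \<delta>' by (simp add: algebra_simps)
qed

lemma set_fwd_bwd_subset: "a \<le> k \<Longrightarrow> set (fwd a) \<subseteq> {1..k}" "b \<le> k \<Longrightarrow> set (bwd k b) \<subseteq> {1..k}"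
  using set_bwd[of b k] by (auto simp: set_fwd)

private abbreviation (input) "lf a \<equiv> map (lam k p) (fwd a)"
private abbreviation (input) "lb b \<equiv> map (lam k p) (bwd k b)"

lemma lf_lb_general: "a \<le> k \<Longrightarrow> l \<in> set (lf a) \<Longrightarrow> 0 < l \<and> l \<le> 1 + \<delta> \<and> 1 - \<delta> \<le> l"
  "b \<le> k \<Longrightarrow> l \<in> set (lb b) \<Longrightarrow> 0 < l \<and> l \<le> 1 + \<delta> \<and> 1 - \<delta> \<le> l"
proof -
  have *: "0 < l \<and> l \<le> 1 + \<delta> \<and> 1 - \<delta> \<le> l" if "l \<in> lam k p ` I" "I \<subseteq> {1..k}" for l I
    using that lam_general by blast
  show "a \<le> k \<Longrightarrow> l \<in> set (lf a) \<Longrightarrow> 0 < l \<and> l \<le> 1 + \<delta> \<and> 1 - \<delta> \<le> l"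
    "b \<le> k \<Longrightarrow> l \<in> set (lb b) \<Longrightarrow> 0 < l \<and> l \<le> 1 + \<delta> \<and> 1 - \<delta> \<le> l"
    using *[OF _ set_fwd_bwd_subset(1)] *[OF _ set_fwd_bwd_subset(2)] by simp_all
qed

lemma Lk: "L \<le> k" "L < k"
  using L_bound by auto

lemma k_real: "real k \<ge> 40"
  using k by simp

lemma lf_lb_nonempty: "lf L \<noteq> []" "lb L \<noteq> []"
  using L by (auto simp flip: length_0_conv)

lemma surv_fwd_le: "surv 1 (lf L) 1 \<le> up_bound L \<delta>"
  using surv_up_le(1)[of \<delta> "lf L", OF _ _ _ lf_lb_nonempty(1)] delta_bounds lf_lb_general(1)[OF
      Lk(1)]
  by (auto simp: up_bound_def)

lemma surv_bwd_le: "surv (-1) (lb L) 0 \<le> down_bound L \<delta>"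
  using surv_down_le(1)[of \<delta> "lb L", OF _ _ _ lf_lb_nonempty(2)] delta_bounds lf_lb_general(2)[OF
      Lk(1)]
  by (auto simp: down_bound_def)

lemma bounds_nonneg: "0 \<le> up_bound L \<delta>" "0 \<le> down_bound L \<delta>"
  using surv_fwd_le surv_bwd_le surv_bounds(1) order_trans by blast+

text \<open>Lower bound for the mean number of balls outside the two blocks, the quantity that
  governs the likelihood ratio.\<close>

lemma tail_mass:
  assumes "a + b \<le> k"
  defines "P \<equiv> (\<Sum>i\<leftarrow>fwd a @ bwd k b. pmf (tilted_bin k p) i)"
  shows "real k - 1 - real (a + b) * (1 + \<delta>) \<le> (real k - 1) * (1 - P)"
proof -
  have "(real k - 1) * P = sum_list (lf a) + sum_list (lb b)"
    unfolding P_def using sum_lam_eq[of k p a b] k p p_lt_1 assms by simp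
  also have "sum_list (lf a) \<le> (\<Sum>i\<leftarrow>fwd a. 1 + \<delta>)"
    by (rule sum_list_mono) (use lam_general(2) set_fwd_bwd_subset(1)[of a] assms(1) in force)
  also have "sum_list (lb b) \<le> (\<Sum>i\<leftarrow>bwd k b. 1 + \<delta>)"
    by (rule sum_list_mono) (use lam_general(2) set_fwd_bwd_subset(2)[of b] assms(1) in force)
  finally have "(real k - 1) * P \<le> real a * (1 + \<delta>) + real b * (1 + \<delta>)"
    by (simp add: sum_list_triv)
  thus ?thesis by (simp add: algebra_simps)
qed

text \<open>Positivity is kept only at the times within \<open>L\<close> of either end. Since 1 +
  \<delta> is at most 2, the 2 L outer bins receive at most 4 L balls on average, whence the
  denominator.\<close>

lemma prob_TREE_le:
  "measure_pmf.prob (placement k p) (TREE k) \<le> sqrt (real k / (real k - 2 - 4 * L)) * (up_bound L \<delta>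
      * down_bound L \<delta>)"
proof -
  let ?A = "stays_pos 1 1" and ?B = "stays_pos (-1) 0"
  let ?P = "\<Sum>i\<leftarrow>fwd L @ bwd k L. pmf (tilted_bin k p) i"
  have LL: "L + L \<le> k" using L_bound by linarith
  have "real (L + L) * (1 + \<delta>) \<le> real (L + L) * 2" using delta_bounds by (intro mult_left_mono) auto
  hence M: "real k - 1 - 4 * L \<le> (real k - 1) * (1 - ?P)" using tail_mass[OF LL] by simp
  have M2: "real k - 1 - 4 * L \<ge> 2" using L_bound k_real by linarith
  have "measure_pmf.prob (placement k p) (TREE k) \<le>
      measure_pmf.prob (placement k p) {T. ?A (counts k (fwd L) T) \<and> ?B (counts k (bwd k L) T)}"
    using TREE_imp_stays[OF p less_imp_le[OF p_lt_1] _ _ Lk(2)]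
    by (intro measure_pmf.finite_measure_mono_AE AE_pmfI) auto
  also have "\<dots> \<le> sqrt ((real k - 1) / ((real k - 1) * (1 - ?P) - 1)) * (surv 1 (lf L) 1 * surv (-1)
      (lb L) 0)"
    unfolding surv_def by (rule prob_counts_le) (use k p p_lt_1 LL M M2 in auto)
  also have "\<dots> \<le> sqrt (real k / (real k - 2 - 4 * L)) * (up_bound L \<delta> * down_bound L \<delta>)"
    using M M2 surv_fwd_le surv_bwd_le bounds_nonneg
    by (intro mult_mono real_sqrt_le_mono frac_le) auto
  finally show ?thesis .
qed

text \<open>The mean rise over \<open>L\<close> bins is at least \<epsilon>L/2; a permitted
  deviation of at most half of this leaves a good walk at height \<epsilon>L/4 or more.\<close>

context
  fixes w :: real
  assumes w: "w > 0" and wL: "w * sqrt L \<le> \<epsilon> * L / 4"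
begin

private abbreviation (input) "D \<equiv> w * sqrt L"

lemma D_pos: "D > 0" and D_sq: "D\<^sup>2 = w\<^sup>2 * L" and D_le: "D \<le> \<epsilon> * L / 4" "D \<le> L"
proof -
  show "D > 0" "D\<^sup>2 = w\<^sup>2 * L" using w L by (auto simp: power_mult_distrib)
  show "D \<le> \<epsilon> * L / 4" using wL by simp
  also have "\<dots> \<le> 1 * real L / 4" using \<epsilon>1 by (intro divide_right_mono mult_right_mono) auto
  finally show "D \<le> L" by simp
qed

lemma good_fwd_ge: "up_good_bound L \<delta> \<delta>' w \<le> measure_pmf.prob (poisson_vec (lf L)) {xs. good 1 1 D
    (lf L) xs}"
proof -
  have "up_good_bound L \<delta> \<delta>' w \<le> surv 1 (lf L) 1 - (1 + \<delta>) * (\<Sum>j<length (lf L). surv 1 (take j (lf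
      L)) 1) / D\<^sup>2"
    unfolding up_good_bound_def D_sq
  proof (intro diff_mono divide_right_mono mult_left_mono)
    show "1 - exp (- (2 * \<delta>' / (1 + \<delta>'))) \<le> surv 1 (lf L) 1"
      by (rule surv_up_ge) (use delta_bounds lam_fwd in auto)
    show "(\<Sum>j<length (lf L). surv 1 (take j (lf L)) 1) \<le> L * (2 * \<delta> * (1 + 2 * \<delta>)) + 2 / \<delta>"
      using surv_up_le(2)[of \<delta> "lf L"] delta_bounds lf_lb_general(1)[OF Lk(1)] by simp
  qed (use delta_bounds in auto)
  also have "\<dots> \<le> measure_pmf.prob (poisson_vec (lf L)) {xs. good 1 1 D (lf L) xs}"
    using lf_lb_general(1)[OF Lk(1)] D_pos delta_bounds by (intro prob_good_ge) auto
  finally show ?thesis .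
qed

lemma good_bwd_ge: "down_good_bound L \<delta> \<delta>' w \<le> measure_pmf.prob (poisson_vec (lb L)) {xs. good (-1)
    0 D (lb L) xs}"
proof -
  have "down_good_bound L \<delta> \<delta>' w \<le> surv (-1) (lb L) 0 - (1 + \<delta>) * (\<Sum>j<length (lb L). surv (-1) (take
      j (lb L)) 0) / D\<^sup>2"
    unfolding down_good_bound_def D_sq
  proof (intro diff_mono divide_right_mono mult_left_mono)
    show "\<delta>' \<le> surv (-1) (lb L) 0"
    proof (rule surv_down_ge)
      show "0 < l \<and> l \<le> 1 - \<delta>'" if "l \<in> set (lb L)" for l
        using that lam_bwd lf_lb_general(2)[OF Lk(1) that] by auto
      show "lb L \<noteq> []" by (rule lf_lb_nonempty)
    qed
    show "(\<Sum>j<length (lb L). surv (-1) (take j (lb L)) 0) \<le> 1 + L * \<delta> + 2 * sqrt L"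
      using surv_down_le(2)[of \<delta> "lb L"] delta_bounds lf_lb_general(2)[OF Lk(1)] by simp
  qed (use delta_bounds in auto)
  also have "\<dots> \<le> measure_pmf.prob (poisson_vec (lb L)) {xs. good (-1) 0 D (lb L) xs}"
    using lf_lb_general(2)[OF Lk(1)] D_pos delta_bounds by (intro prob_good_ge) auto
  finally show ?thesis .
qed

private abbreviation (input) "h \<equiv> k div 2"

lemma Lh: "L \<le> h"
  using L_bound by linarith

text \<open>From height \<epsilon>L/4, the exponent \<epsilon>/8 of \<open>surv_drift_bound\<close>
  gives exp (- \<epsilon>^2 L/32).\<close>

lemma fail_bound:
  assumes s: "s = 1 \<or> s = -1" and len: "2 * (L + length ls') \<le> k"
    and ls': "\<And>t. t < length ls' \<Longrightarrow> \<epsilon> - p * real (L + t + 1) - \<epsilon> * \<eta> \<le> s * (ls' ! t - 1)"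
      "\<And>t. t < length ls' \<Longrightarrow> 0 < ls' ! t \<and> ls' ! t \<le> 2"
    and ls: "length ls = L" "\<epsilon> * (1 - \<rho>) * L \<le> s * (sum_list ls - real L)" and y: "y \<ge> 0"
  shows "measure_pmf.prob (poisson_vec (ls @ ls')) {xs. good s y D ls (take L xs) \<and> \<not> stays_pos s y
      xs} \<le>
    surv s ls y * exp (- (\<epsilon>\<^sup>2 * L / 32))"
proof -
  have "measure_pmf.prob (poisson_vec (ls @ ls')) {xs. good s y D ls (take (length ls) xs) \<and> \<not>
      stays_pos s y xs} \<le>
    surv s ls y * exp (- (\<epsilon>\<^sup>2 * L / 32))"
  proof (rule prob_good_then_dies[OF s])
    fix y' assume y': "y + s * (sum_list ls - real (length ls)) - D \<le> real_of_int y'"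
    have "\<epsilon> * (1/2) * L \<le> \<epsilon> * (1 - \<rho>) * L"
      using \<rho>1 eps_pos by (intro mult_left_mono mult_right_mono) auto
    hence "\<epsilon> * L / 4 \<le> real_of_int y'" using y' ls D_le y by simp
    hence *: "(\<epsilon> / 8) * (\<epsilon> * L / 4) \<le> (\<epsilon> / 8) * y'" using eps_pos by (intro mult_left_mono) auto
    have "1 - surv s ls' y' \<le> exp (- (\<epsilon> / 8) * y')"
    proof (rule surv_drift_bound[OF s \<epsilon> eps_pos])
      have "(real L + 1) / k \<le> 2 * (real L + 1) / k" by (simp add: divide_right_mono)
      thus "\<eta> + (real L + 1) / k \<le> 1/4" using \<rho> \<rho>1 by linarith
    qed (use \<epsilon>1 k len ls' in auto)
    also have "\<dots> \<le> exp (- (\<epsilon>\<^sup>2 * L / 32))"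
      using * by (simp add: power2_eq_square)
    finally show "1 - surv s ls' y' \<le> exp (- (\<epsilon>\<^sup>2 * L / 32))" .
  qed auto
  thus ?thesis by (simp only: ls)
qed

lemma fail_fwd: "measure_pmf.prob (poisson_vec (lf h)) {xs. good 1 1 D (lf L) (take L xs) \<and> \<not>
    stays_pos 1 1 xs} \<le>
    up_bound L \<delta> * exp (- (\<epsilon>\<^sup>2 * L / 32))"
proof -
  let ?ls' = "map (lam k p) [Suc L..<Suc h]"
  have "lf h = lf L @ ?ls'"
    unfolding fwd_def map_append[symmetric] using upt_add_eq_append[of 1 "Suc L" "h - L"] Lh by simp
  moreover have "measure_pmf.prob (poisson_vec (lf L @ ?ls')) {xs. good 1 1 D (lf L) (take L xs) \<and> \<not>
      stays_pos 1 1 xs} \<le>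
    surv 1 (lf L) 1 * exp (- (\<epsilon>\<^sup>2 * L / 32))"
  proof (rule fail_bound)
    fix t assume "t < length ?ls'"
    hence t: "t < h - L" by (simp del: upt_Suc)
    hence n: "?ls' ! t = lam k p (L + t + 1)" by (simp del: upt_Suc)
    have i: "L + t + 1 \<in> {1..k}" using t by auto
    show "\<epsilon> - p * real (L + t + 1) - \<epsilon> * \<eta> \<le> real_of_int 1 * (?ls' ! t - 1)"
      unfolding n using lam_bounds(1)[OF i] by simp
    show "0 < ?ls' ! t \<and> ?ls' ! t \<le> 2" unfolding n using lam_general[OF i] by simp
  next
    have "(\<Sum>i\<leftarrow>fwd L. 1 + \<delta>') \<le> (\<Sum>i\<leftarrow>fwd L. lam k p i)"
      by (rule sum_list_mono) (rule lam_fwd)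
    thus "\<epsilon> * (1 - \<rho>) * L \<le> real_of_int 1 * (sum_list (lf L) - real L)"
      by (simp add: sum_list_triv \<delta>' algebra_simps)
  qed (use Lh in \<open>auto simp del: upt_Suc\<close>)
  ultimately show ?thesis
    by (simp only:) (erule order_trans, rule mult_right_mono[OF surv_fwd_le], simp)
qed

lemma fail_bwd: "measure_pmf.prob (poisson_vec (lb h)) {xs. good (-1) 0 D (lb L) (take L xs) \<and> \<not>
    stays_pos (-1) 0 xs} \<le>
    down_bound L \<delta> * exp (- (\<epsilon>\<^sup>2 * L / 32))"
proof -
  let ?ls' = "map (\<lambda>i. lam k p (k - i)) [L..<h]"
  have "lb h = lb L @ ?ls'"
    unfolding bwd_def map_map o_def map_append[symmetric] using upt_add_eq_append[of 0 L "h - L"] Lh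
        by simp
  moreover have "measure_pmf.prob (poisson_vec (lb L @ ?ls')) {xs. good (-1) 0 D (lb L) (take L xs)
      \<and> \<not> stays_pos (-1) 0 xs} \<le>
    surv (-1) (lb L) 0 * exp (- (\<epsilon>\<^sup>2 * L / 32))"
  proof (rule fail_bound)
    fix t assume "t < length ?ls'"
    hence t: "t < h - L" by simp
    hence n: "?ls' ! t = lam k p (k - (L + t))" by simp
    have i: "k - (L + t) \<in> {1..k}" "L + t < k" using t by auto
    show "\<epsilon> - p * real (L + t + 1) - \<epsilon> * \<eta> \<le> real_of_int (-1) * (?ls' ! t - 1)"
      \<comment> \<open>Read from the right, this bin is number L + t counted from 0, so the drift
        is larger by \<open>p\<close> than claimed; the index L + t + 1 is kept to share
        \<open>fail_bound\<close> with the left walk.\<close>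
      unfolding n using lam_bwd_nth[OF i(2)] p by (simp add: algebra_simps)
    show "0 < ?ls' ! t \<and> ?ls' ! t \<le> 2" unfolding n using lam_general[OF i(1)] by simp
  next
    have "(\<Sum>i\<leftarrow>bwd k L. lam k p i) \<le> (\<Sum>i\<leftarrow>bwd k L. 1 - \<delta>')"
      by (rule sum_list_mono) (rule lam_bwd)
    thus "\<epsilon> * (1 - \<rho>) * L \<le> real_of_int (-1) * (sum_list (lb L) - real L)"
      by (simp add: sum_list_triv \<delta>' algebra_simps)
  qed (use Lh in auto)
  ultimately show ?thesis
    by (simp only:) (erule order_trans, rule mult_right_mono[OF surv_bwd_le], simp)
qed

text \<open>Half of the bins plus \<open>L\<close> more are exposed, yet at least k/4 + 1 balls are
  expected elsewhere; the likelihood ratio is then at most sqrt 4 = 2.\<close>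

lemma prob_bad_le:
  assumes "a = h \<and> b = L \<or> a = L \<and> b = h"
  shows "measure_pmf.prob (placement k p) {T. A (counts k (fwd a) T) \<and> B (counts k (bwd k b) T)} \<le>
    2 * (measure_pmf.prob (poisson_vec (lf a)) {xs. A xs} * measure_pmf.prob (poisson_vec (lb b))
        {xs. B xs})"
proof -
  let ?P = "\<Sum>i\<leftarrow>fwd a @ bwd k b. pmf (tilted_bin k p) i"
  have ab: "a + b \<le> k" and s: "real (a + b) \<le> real k / 2 + real L" using assms L_bound by auto
  have "real (a + b) * (1 + \<delta>) \<le> (real k / 2 + real L) * (11/10)"
    using delta_bounds s by (intro mult_mono) auto
  moreover have "x / 4 + 1 \<le> z"
    if "y \<le> (x / 2 + u) * (11/10)" "x - 1 - y \<le> z" "u + 1 \<le> x / 16" "40 \<le> x" for x y z u :: real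
    using that by simp
  ultimately have M: "real k / 4 + 1 \<le> (real k - 1) * (1 - ?P)"
    using tail_mass[OF ab] L_bound k_real by blast
  have "measure_pmf.prob (placement k p) {T. A (counts k (fwd a) T) \<and> B (counts k (bwd k b) T)} \<le>
      sqrt ((real k - 1) / ((real k - 1) * (1 - ?P) - 1)) *
      (measure_pmf.prob (poisson_vec (lf a)) {xs. A xs} * measure_pmf.prob (poisson_vec (lb b)) {xs.
          B xs})"
    by (rule prob_counts_le) (use k p p_lt_1 ab M in auto)
  also have "sqrt ((real k - 1) / ((real k - 1) * (1 - ?P) - 1)) \<le> sqrt 4"
  proof (rule real_sqrt_le_mono)
    show "(real k - 1) / ((real k - 1) * (1 - ?P) - 1) \<le> 4"
      using M k by (subst pos_divide_le_eq) auto
  qed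
  finally show ?thesis by (simp add: mult_right_mono)
qed

text \<open>If both outer walks are good, the placement is normal, and TREE can fail only if one of
  them dies on its way to the middle. In \<open>?E1\<close> and \<open>?E2\<close> the opposite
  outer walk is still required to be good, so each failure costs both survival bounds times the
  exponential.\<close>

lemma prob_TREE_normal_ge:
  assumes G: "0 \<le> up_good_bound L \<delta> \<delta>' w" "0 \<le> down_good_bound L \<delta> \<delta>' w"
  shows "exp (- (8 * (w\<^sup>2 * L / k))) * (up_good_bound L \<delta> \<delta>' w * down_good_bound L \<delta> \<delta>' w) - 4 *
      (up_bound L \<delta> * down_bound L \<delta> * exp (- (\<epsilon>\<^sup>2 * L / 32))) \<le>
    measure_pmf.prob (placement k p) (TREE k \<inter> normal_placements k p L w)"
proof -
  let ?M = "placement k p"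
  let ?A = "good 1 1 D (lf L)" and ?B = "good (-1) 0 D (lb L)"
  let ?A2 = "\<lambda>xs. ?A (take L xs) \<and> \<not> stays_pos 1 1 xs" and ?B2 = "\<lambda>xs. ?B (take L xs) \<and> \<not> stays_pos
      (-1) 0 xs"
  let ?E = "{T. ?A (counts k (fwd L) T) \<and> ?B (counts k (bwd k L) T)}"
  let ?E1 = "{T. ?A2 (counts k (fwd h) T) \<and> ?B (counts k (bwd k L) T)}"
  let ?E2 = "{T. ?A (counts k (fwd L) T) \<and> ?B2 (counts k (bwd k h) T)}"
  let ?N = "TREE k \<inter> normal_placements k p L w"
  let ?P = "\<Sum>i\<leftarrow>fwd L @ bwd k L. pmf (tilted_bin k p) i"
  let ?x = "exp (- (\<epsilon>\<^sup>2 * L / 32))"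
  have "measure_pmf.prob ?M ?E \<le> measure_pmf.prob ?M (?N \<union> (?E1 \<union> ?E2))"
  proof (intro measure_pmf.finite_measure_mono_AE AE_pmfI)
    fix T assume T: "T \<in> set_pmf ?M"
    show "T \<in> ?E \<longrightarrow> T \<in> ?N \<union> (?E1 \<union> ?E2)"
    proof (intro impI)
      assume E: "T \<in> ?E"
      have tf: "take L (counts k (fwd h) T) = counts k (fwd L) T"
        using Lh by (simp add: counts_def take_map take_fwd)
      have tb: "take L (counts k (bwd k h) T) = counts k (bwd k L) T"
        using Lh by (simp add: counts_def take_map take_bwd)
      show "T \<in> ?N \<union> (?E1 \<union> ?E2)"
      proof (cases "stays_pos 1 1 (counts k (fwd h) T) \<and> stays_pos (-1) 0 (counts k (bwd k h) T)")
        case True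
        \<comment> \<open>For odd \<open>k\<close> the two halves cover exactly the k - 1 times that
          TREE tests.\<close>
        have "k - 1 \<le> h + h" "h \<le> k" by auto
        hence "T \<in> TREE k"
          using True k by (intro stays_imp_TREE[OF p less_imp_le[OF p_lt_1] T, of h h]) auto
        moreover have "T \<in> normal_placements k p L w"
          using E k Lk by (auto simp: normal_placements_def m_L_eq m_R_eq mu_L_eq mu_R_eq good_def)
        ultimately show ?thesis by blast
      qed (use E tf tb in auto)
    qed
  qed auto
  also have "\<dots> \<le> measure_pmf.prob ?M ?N + measure_pmf.prob ?M (?E1 \<union> ?E2)"
    by (rule measure_Un_le) auto
  also have "measure_pmf.prob ?M (?E1 \<union> ?E2) \<le> measure_pmf.prob ?M ?E1 + measure_pmf.prob ?M ?E2"
    by (rule measure_Un_le) auto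
  finally have 1: "measure_pmf.prob ?M ?E \<le> measure_pmf.prob ?M ?N + (measure_pmf.prob ?M ?E1 +
      measure_pmf.prob ?M ?E2)"
    by simp
  have "measure_pmf.prob ?M ?E1 \<le> 2 * (measure_pmf.prob (poisson_vec (lf h)) {xs. ?A2 xs} *
      measure_pmf.prob (poisson_vec (lb L)) {xs. ?B xs})"
    by (rule prob_bad_le) auto
  also have "\<dots> \<le> 2 * ((up_bound L \<delta> * ?x) * down_bound L \<delta>)"
    using fail_fwd order_trans[OF prob_good_le surv_bwd_le] bounds_nonneg by (intro mult_left_mono
        mult_mono) auto
  finally have 2: "measure_pmf.prob ?M ?E1 \<le> 2 * (up_bound L \<delta> * down_bound L \<delta> * ?x)" by (simp add:
      mult_ac)
  have "measure_pmf.prob ?M ?E2 \<le> 2 * (measure_pmf.prob (poisson_vec (lf L)) {xs. ?A xs} *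
      measure_pmf.prob (poisson_vec (lb h)) {xs. ?B2 xs})"
    by (rule prob_bad_le) auto
  also have "\<dots> \<le> 2 * (up_bound L \<delta> * (down_bound L \<delta> * ?x))"
    using fail_bwd order_trans[OF prob_good_le surv_fwd_le] bounds_nonneg by (intro mult_left_mono
        mult_mono) auto
  finally have 3: "measure_pmf.prob ?M ?E2 \<le> 2 * (up_bound L \<delta> * down_bound L \<delta> * ?x)" by (simp add:
      mult_ac)
  have LL: "L + L \<le> k" using L_bound by linarith
  have "real (L + L) * (1 + \<delta>) \<le> real (L + L) * 2" using delta_bounds by (intro mult_left_mono) auto
  hence M: "real k - 1 - 4 * L \<le> (real k - 1) * (1 - ?P)" using tail_mass[OF LL] by simp
  have M2: "real k / 2 \<le> (real k - 1) * (1 - ?P)" using M L_bound k_real by linarith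
  have P1: "?P < 1"
  proof (rule ccontr)
    assume "\<not> ?P < 1"
    hence "(real k - 1) * (1 - ?P) \<le> 0" using k by (intro mult_nonneg_nonpos) auto
    thus False using M2 k by simp
  qed
  have "exp (- (8 * (w\<^sup>2 * L / k))) * (up_good_bound L \<delta> \<delta>' w * down_good_bound L \<delta> \<delta>' w) \<le> exp (-
      ((2 * D)\<^sup>2 / ((real k - 1) * (1 - ?P)))) *
    (measure_pmf.prob (poisson_vec (lf L)) {xs. ?A xs} * measure_pmf.prob (poisson_vec (lb L)) {xs.
        ?B xs})"
  proof (intro mult_mono good_fwd_ge good_bwd_ge G)
    \<comment> \<open>At least k/2 balls are expected outside the outer bins, so the Gaussian loss
      is at most (2 D)^2 / (k/2), the source of the constant 8.\<close>
    have "(2 * D)\<^sup>2 / ((real k - 1) * (1 - ?P)) \<le> (2 * D)\<^sup>2 / (real k / 2)"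
      using M2 k by (intro divide_left_mono) auto
    also have "\<dots> = 8 * (w\<^sup>2 * L / k)" by (simp add: power_mult_distrib D_sq)
    finally show "exp (- (8 * (w\<^sup>2 * L / k))) \<le> exp (- ((2 * D)\<^sup>2 / ((real k - 1) * (1 - ?P))))" by
        simp
  qed (use G in auto)
  also have "\<dots> \<le> measure_pmf.prob ?M ?E"
  proof (rule prob_counts_ge)
    show "(real k - 1) * ?P + 2 * D < real k - 1"
      using M D_le L_bound k_real by (simp add: algebra_simps)
  qed (use k p p_lt_1 LL P1 in \<open>auto simp: good_def\<close>)
  finally show ?thesis using 1 2 3 by linarith
qed

end

end

section \<open>Asymptotics\<close>

lemma scaled_drift_sum:
  fixes e l u v :: real
  assumes "e \<noteq> 0" "l \<noteq> 0"
  shows "(l * (2 * (e * u) * v) + 2 / (e * u)) / l / (2 * e) = u * v + 1 / (e\<^sup>2 * l) / u"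
  using assms by (simp add: add_divide_distrib power2_eq_square mult_ac)

text \<open>Divided by its leading order, the bound is a continuous expression in quantities that
  all tend to 0, so that its limit can be read off; the other ratio lemmas have the same
  purpose.\<close>

lemma up_bound_ratio:
  assumes "e > 0" "L \<ge> 1" "\<eta> > 0"
  shows "up_bound L (e * (1 + \<eta>)) / (2 * e) = (1 + \<eta>) * (1 + 2 * (e * (1 + \<eta>))) + 1 / (e\<^sup>2 * L) / (1
      + \<eta>)"
proof -
  have "up_bound L (e * (1 + \<eta>)) = (L * (2 * (e * (1 + \<eta>)) * (1 + 2 * (e * (1 + \<eta>)))) + 2 / (e * (1
      + \<eta>))) / L"
    unfolding up_bound_def add_divide_distrib using assms by simp
  thus ?thesis using assms scaled_drift_sum[of e L] by simp
qed

lemma down_bound_ratio: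
  assumes "e > 0" "L \<ge> 1"
  shows "down_bound L (e * (1 + \<eta>)) / e = (1 + \<eta>) + sqrt (1 / (e\<^sup>2 * L))"
proof -
  have "sqrt (1 / (e\<^sup>2 * L)) = 1 / sqrt L / e" using assms by (simp add: real_sqrt_divide
      real_sqrt_mult)
  thus ?thesis using assms by (simp add: down_bound_def add_divide_distrib)
qed

text \<open>The deviation penalty is of order \<epsilon> L / (w^2 L), so after division only a
  multiple of (1 / w)^2 remains. \<open>x\<close> is the exponent from \<open>surv_up_ge\<close>,
  isolated so that the derivative of exp at 0 gives the limit.\<close>

lemma up_good_bound_ratio:
  assumes "e > 0" "L \<ge> 1" "\<eta> > 0" "w > 0" "\<rho> < 1"
  defines "x \<equiv> 2 * (e * (1 - \<rho>)) / (1 + e * (1 - \<rho>))"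
  shows "up_good_bound L (e * (1 + \<eta>)) (e * (1 - \<rho>)) w / (2 * e) =
    (1 - exp (- x)) / x * ((1 - \<rho>) / (1 + e * (1 - \<rho>))) -
    (1 + e * (1 + \<eta>)) * ((1 + \<eta>) * (1 + 2 * (e * (1 + \<eta>))) + 1 / (e\<^sup>2 * L) / (1 + \<eta>)) * (1 / w)\<^sup>2"
proof -
  let ?d = "e * (1 + \<eta>)"
  have e': "e * (1 - \<rho>) > 0" using assms by simp
  hence x0: "x > 0" unfolding x_def by (intro divide_pos_pos) auto
  have xe: "(1 - \<rho>) / (1 + e * (1 - \<rho>)) = x / (2 * e)"
    using assms by (simp add: x_def)
  have "(1 - exp (- x)) / x * ((1 - \<rho>) / (1 + e * (1 - \<rho>))) = (1 - exp (- x)) / (2 * e)"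
    unfolding xe using x0 by simp
  moreover have "(1 + ?d) * (L * (2 * ?d * (1 + 2 * ?d)) + 2 / ?d) / (w\<^sup>2 * L) / (2 * e) =
    (1 + ?d) * ((1 + \<eta>) * (1 + 2 * ?d) + 1 / (e\<^sup>2 * L) / (1 + \<eta>)) * (1 / w)\<^sup>2"
  proof -
    have "(L * (2 * ?d * (1 + 2 * ?d)) + 2 / ?d) / L / (2 * e) = (1 + \<eta>) * (1 + 2 * ?d) + 1 / (e\<^sup>2 *
        L) / (1 + \<eta>)"
      using assms by (intro scaled_drift_sum) auto
    hence "(1 + ?d) * ((L * (2 * ?d * (1 + 2 * ?d)) + 2 / ?d) / L / (2 * e)) * (1 / w)\<^sup>2 =
      (1 + ?d) * ((1 + \<eta>) * (1 + 2 * ?d) + 1 / (e\<^sup>2 * L) / (1 + \<eta>)) * (1 / w)\<^sup>2" by (simp only:)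
    thus ?thesis by (simp add: power_divide mult_ac)
  qed
  ultimately show ?thesis
    unfolding up_good_bound_def x_def[symmetric] diff_divide_distrib[of "1 - exp (- x)"] by simp
qed

lemma down_good_bound_ratio:
  assumes "e > 0" "L \<ge> 1" "w > 0"
  shows "down_good_bound L (e * (1 + \<eta>)) (e * (1 - \<rho>)) w / e =
    (1 - \<rho>) - (1 + e * (1 + \<eta>)) * (e * (1 / (e\<^sup>2 * L)) + (1 + \<eta>) + 2 * sqrt (1 / (e\<^sup>2 * L))) * (1 /
        w)\<^sup>2"
proof -
  let ?d = "e * (1 + \<eta>)"
  have s: "sqrt (1 / (e\<^sup>2 * L)) = 1 / (sqrt L * e)" using assms by (simp add: real_sqrt_divide
      real_sqrt_mult)
  have "2 * sqrt L / L / e = 2 * (1 / (sqrt L * e))" using assms by (simp add: field_simps)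
  hence "(1 + L * ?d + 2 * sqrt L) / L / e = e * (1 / (e\<^sup>2 * L)) + (1 + \<eta>) + 2 * sqrt (1 / (e\<^sup>2 *
      L))"
    unfolding s using assms by (simp only: add_divide_distrib) (simp add: power2_eq_square mult_ac)
  hence "(1 + ?d) * ((1 + L * ?d + 2 * sqrt L) / L / e) * (1 / w)\<^sup>2 =
     (1 + ?d) * (e * (1 / (e\<^sup>2 * L)) + (1 + \<eta>) + 2 * sqrt (1 / (e\<^sup>2 * L))) * (1 / w)\<^sup>2" by (simp
         only:)
  hence "(1 + ?d) * (1 + L * ?d + 2 * sqrt L) / (w\<^sup>2 * L) / e =
     (1 + ?d) * (e * (1 / (e\<^sup>2 * L)) + (1 + \<eta>) + 2 * sqrt (1 / (e\<^sup>2 * L))) * (1 / w)\<^sup>2"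
    by (simp add: power_divide mult_ac)
  thus ?thesis unfolding down_good_bound_def diff_divide_distrib using assms by simp
qed

lemma tendsto_one_minus_exp_over: "((\<lambda>x :: real. (1 - exp (- x)) / x) \<longlongrightarrow> 1) (at 0)"
proof -
  have "((\<lambda>x :: real. - exp (- x)) has_field_derivative exp (- 0)) (at 0)"
    by (auto intro!: derivative_eq_intros)
  thus ?thesis by (simp add: has_field_derivative_iff)
qed

context
  fixes p e \<eta> \<rho> w :: "nat \<Rightarrow> real" and L :: "nat \<Rightarrow> nat"
  assumes p: "eventually (\<lambda>k. p k > 0) sequentially"
    and e: "\<And>k. e k = p k * real k / 2" "e \<longlonglongrightarrow> 0"
    and ek: "(\<lambda>k. 1 / ((e k)\<^sup>2 * real k)) \<longlonglongrightarrow> 0"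
    and L1: "eventually (\<lambda>k. L k \<ge> 1) sequentially"
    and Lk: "(\<lambda>k. real (L k) / real k) \<longlonglongrightarrow> 0"
    and eL: "(\<lambda>k. 1 / ((e k)\<^sup>2 * real (L k))) \<longlonglongrightarrow> 0"
    and \<eta>: "\<And>k. \<eta> k = 5 * (e k + 1 / (real k * e k))"
    and \<rho>: "\<And>k. \<rho> k = \<eta> k + 2 * (real (L k) + 1) / real k"
begin

lemma e_pos: "eventually (\<lambda>k. e k > 0) sequentially"
  using p eventually_gt_at_top[of 0] by eventually_elim (auto simp: e)

lemma inverse_k: "(\<lambda>k. 1 / real k) \<longlonglongrightarrow> 0"
  by (rule lim_1_over_n)

lemma eta_lim: "\<eta> \<longlonglongrightarrow> 0"
proof -
  \<comment> \<open>The term 1/(k \<epsilon>) is rewritten as \<epsilon> times 1/(\<epsilon>^2 k), a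
    product of two null sequences.\<close>
  have "(\<lambda>k. 5 * (e k + e k * (1 / ((e k)\<^sup>2 * real k)))) \<longlonglongrightarrow> 5 * (0 + 0 * 0)"
    by (intro tendsto_intros e ek)
  moreover have "eventually (\<lambda>k. 5 * (e k + e k * (1 / ((e k)\<^sup>2 * real k))) = \<eta> k) sequentially"
    using e_pos by eventually_elim (auto simp: \<eta> power2_eq_square mult_ac)
  ultimately show ?thesis by (auto intro: Lim_transform_eventually)
qed

lemma rho_lim: "\<rho> \<longlonglongrightarrow> 0"
proof -
  have "(\<lambda>k. \<eta> k + 2 * (real (L k) / real k + 1 / real k)) \<longlonglongrightarrow> 0 + 2 * (0 + 0)"
    by (intro tendsto_intros eta_lim Lk inverse_k)
  thus ?thesis by (simp add: \<rho>[abs_def] add_divide_distrib)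
qed

lemma eta_pos: "eventually (\<lambda>k. \<eta> k > 0) sequentially"
  using e_pos eventually_gt_at_top[of 0] by eventually_elim (auto simp: \<eta> intro!: add_pos_pos)

lemma parameters_ok:
  "eventually (\<lambda>k. k \<ge> 40 \<and> L k \<ge> 1 \<and> p k > 0 \<and> e k > 0 \<and> e k \<le> 1/20 \<and> \<rho> k \<le> 1/8 \<and> \<eta> k > 0)
      sequentially"
proof -
  have "eventually (\<lambda>k. e k < 1/20) sequentially" "eventually (\<lambda>k. \<rho> k < 1/8) sequentially"
    using order_tendstoD(2)[OF e(2), of "1/20"] order_tendstoD(2)[OF rho_lim, of "1/8"] by auto
  with eventually_ge_at_top[of 40] L1 p e_pos eta_pos show ?thesis
    by eventually_elim auto
qed

private abbreviation (input) "\<delta> k \<equiv> e k * (1 + \<eta> k)"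
private abbreviation (input) "\<delta>' k \<equiv> e k * (1 - \<rho> k)"

lemma up_bound_lim: "(\<lambda>k. up_bound (L k) (\<delta> k) / (2 * e k)) \<longlonglongrightarrow> 1"
proof -
  have "(\<lambda>k. (1 + \<eta> k) * (1 + 2 * \<delta> k) + 1 / ((e k)\<^sup>2 * L k) / (1 + \<eta> k)) \<longlonglongrightarrow>
      (1 + 0) * (1 + 2 * (0 * (1 + 0))) + 0 / (1 + 0)"
    by (intro tendsto_intros e eta_lim eL) auto
  moreover have "eventually (\<lambda>k. (1 + \<eta> k) * (1 + 2 * \<delta> k) + 1 / ((e k)\<^sup>2 * L k) / (1 + \<eta> k) =
      up_bound (L k) (\<delta> k) / (2 * e k)) sequentially"
    using parameters_ok by eventually_elim (rule up_bound_ratio[symmetric], auto)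
  ultimately show ?thesis by (auto intro: Lim_transform_eventually)
qed

lemma down_bound_lim: "(\<lambda>k. down_bound (L k) (\<delta> k) / e k) \<longlonglongrightarrow> 1"
proof -
  have "(\<lambda>k. (1 + \<eta> k) + sqrt (1 / ((e k)\<^sup>2 * L k))) \<longlonglongrightarrow> (1 + 0) + sqrt 0"
    by (intro tendsto_intros eta_lim eL)
  moreover have "eventually (\<lambda>k. (1 + \<eta> k) + sqrt (1 / ((e k)\<^sup>2 * L k)) = down_bound (L k) (\<delta> k) / e
      k) sequentially"
    using parameters_ok by eventually_elim (rule down_bound_ratio[symmetric], auto)
  ultimately show ?thesis by (auto intro: Lim_transform_eventually)
qed

definition "U k = sqrt (real k / (real k - 2 - 4 * L k)) * (up_bound (L k) (\<delta> k) * down_bound (L k)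
    (\<delta> k))"

lemma U_ge: "eventually (\<lambda>k. measure_pmf.prob (placement k (p k)) (TREE k) \<le> U k) sequentially"
  using parameters_ok
proof eventually_elim
  case (elim k)
  thus ?case unfolding U_def
    by (intro prob_TREE_le[where \<rho>="\<rho> k" and \<eta>="\<eta> k" and \<epsilon>="e k" and \<delta>'="\<delta>' k"]) (auto simp: e \<eta> \<rho>)
qed

lemma U_lim: "(\<lambda>k. U k / (2 * (e k)\<^sup>2)) \<longlonglongrightarrow> 1"
proof -
  have "(\<lambda>k. sqrt (1 / (1 - 2 * (1 / real k) - 4 * (L k / k))) * ((up_bound (L k) (\<delta> k) / (2 * e k))
      * (down_bound (L k) (\<delta> k) / e k)))
      \<longlonglongrightarrow> sqrt (1 / (1 - 2 * 0 - 4 * 0)) * (1 * 1)"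
    by (intro tendsto_intros up_bound_lim down_bound_lim inverse_k Lk) auto
  moreover have "eventually (\<lambda>k. sqrt (1 / (1 - 2 * (1 / real k) - 4 * (L k / k))) *
      ((up_bound (L k) (\<delta> k) / (2 * e k)) * (down_bound (L k) (\<delta> k) / e k)) = U k / (2 * (e k)\<^sup>2))
          sequentially"
    using parameters_ok
  proof eventually_elim
    case (elim k)
    have "1 - 2 * (1 / real k) - 4 * (L k / k) = (real k - 2 - 4 * L k) / k"
      using elim by (simp add: diff_divide_distrib)
    hence "1 / (1 - 2 * (1 / real k) - 4 * (L k / k)) = real k / (real k - 2 - 4 * L k)" by simp
    thus ?case by (simp only: U_def) (simp add: power2_eq_square mult_ac)
  qed
  ultimately show ?thesis by (auto intro: Lim_transform_eventually)
qed

context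
  assumes w: "filterlim w at_top sequentially"
    and wk: "(\<lambda>k. (w k)\<^sup>2 * L k / k) \<longlonglongrightarrow> 0"
    and wL: "eventually (\<lambda>k. w k * sqrt (L k) \<le> e k * L k / 4) sequentially"
begin

lemma w_pos: "eventually (\<lambda>k. w k > 0) sequentially"
  using w by (simp add: filterlim_at_top_dense)

lemma w_inv: "(\<lambda>k. 1 / w k) \<longlonglongrightarrow> 0"
  using tendsto_inverse_0_at_top[OF w] by (simp add: inverse_eq_divide)

lemma up_good_bound_lim: "(\<lambda>k. up_good_bound (L k) (\<delta> k) (\<delta>' k) (w k) / (2 * e k)) \<longlonglongrightarrow> 1"
proof -
  define x where "x k = 2 * \<delta>' k / (1 + \<delta>' k)" for k
  have "x \<longlonglongrightarrow> 2 * (0 * (1 - 0)) / (1 + 0 * (1 - 0))"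
    unfolding x_def[abs_def] by (intro tendsto_intros e rho_lim) auto
  hence "filterlim x (at 0) sequentially"
    unfolding filterlim_at using parameters_ok
    by (auto elim!: eventually_mono simp: x_def add_pos_pos less_imp_neq[symmetric]
        add_nonneg_eq_0_iff)
  from filterlim_compose[OF tendsto_one_minus_exp_over this]
  have xl: "(\<lambda>k. (1 - exp (- x k)) / x k) \<longlonglongrightarrow> 1" .
  have "(\<lambda>k. (1 - exp (- x k)) / x k * ((1 - \<rho> k) / (1 + \<delta>' k)) -
      (1 + \<delta> k) * ((1 + \<eta> k) * (1 + 2 * \<delta> k) + 1 / ((e k)\<^sup>2 * L k) / (1 + \<eta> k)) * (1 / w k)\<^sup>2)
    \<longlonglongrightarrow> 1 * ((1 - 0) / (1 + 0 * (1 - 0))) - (1 + 0 * (1 + 0)) * ((1 + 0) * (1 + 2 * (0 * (1 + 0))) + 0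
        / (1 + 0)) * 0\<^sup>2"
    by (intro tendsto_intros xl e eta_lim rho_lim eL w_inv) auto
  moreover have "eventually (\<lambda>k. (1 - exp (- x k)) / x k * ((1 - \<rho> k) / (1 + \<delta>' k)) -
      (1 + \<delta> k) * ((1 + \<eta> k) * (1 + 2 * \<delta> k) + 1 / ((e k)\<^sup>2 * L k) / (1 + \<eta> k)) * (1 / w k)\<^sup>2 =
      up_good_bound (L k) (\<delta> k) (\<delta>' k) (w k) / (2 * e k)) sequentially"
    using parameters_ok w_pos unfolding x_def by eventually_elim (rule
        up_good_bound_ratio[symmetric], auto)
  ultimately show ?thesis by (auto intro: Lim_transform_eventually)
qed

lemma down_good_bound_lim: "(\<lambda>k. down_good_bound (L k) (\<delta> k) (\<delta>' k) (w k) / e k) \<longlonglongrightarrow> 1"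
proof -
  have "(\<lambda>k. (1 - \<rho> k) - (1 + \<delta> k) * (e k * (1 / ((e k)\<^sup>2 * L k)) + (1 + \<eta> k) + 2 * sqrt (1 / ((e
      k)\<^sup>2 * L k))) * (1 / w k)\<^sup>2)
    \<longlonglongrightarrow> (1 - 0) - (1 + 0 * (1 + 0)) * (0 * 0 + (1 + 0) + 2 * sqrt 0) * 0\<^sup>2"
    by (intro tendsto_intros e eta_lim rho_lim eL w_inv)
  moreover have "eventually (\<lambda>k. (1 - \<rho> k) - (1 + \<delta> k) * (e k * (1 / ((e k)\<^sup>2 * L k)) + (1 + \<eta> k) +
      2 * sqrt (1 / ((e k)\<^sup>2 * L k))) * (1 / w k)\<^sup>2
     = down_good_bound (L k) (\<delta> k) (\<delta>' k) (w k) / e k) sequentially"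
    using parameters_ok w_pos by eventually_elim (rule down_good_bound_ratio[symmetric], auto)
  ultimately show ?thesis by (auto intro: Lim_transform_eventually)
qed

definition "W k = exp (- (8 * ((w k)\<^sup>2 * L k / k))) * (up_good_bound (L k) (\<delta> k) (\<delta>' k) (w k) *
    down_good_bound (L k) (\<delta> k) (\<delta>' k) (w k)) -
    4 * (up_bound (L k) (\<delta> k) * down_bound (L k) (\<delta> k) * exp (- ((e k)\<^sup>2 * L k / 32)))"

lemma W_le: "eventually (\<lambda>k. W k \<le> measure_pmf.prob (placement k (p k)) (TREE k \<inter> normal_placements
    k (p k) (L k) (w k))) sequentially"
proof -
  have "eventually (\<lambda>k. up_good_bound (L k) (\<delta> k) (\<delta>' k) (w k) / (2 * e k) > 0) sequentially"
    "eventually (\<lambda>k. down_good_bound (L k) (\<delta> k) (\<delta>' k) (w k) / e k > 0) sequentially"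
    using order_tendstoD(1)[OF up_good_bound_lim] order_tendstoD(1)[OF down_good_bound_lim] by auto
  with parameters_ok w_pos wL show ?thesis
  proof eventually_elim
    case (elim k)
    hence "up_good_bound (L k) (\<delta> k) (\<delta>' k) (w k) \<ge> 0" "down_good_bound (L k) (\<delta> k) (\<delta>' k) (w k) \<ge>
        0"
      by (auto simp: zero_less_divide_iff)
    thus ?case unfolding W_def
      using elim by (intro prob_TREE_normal_ge[where \<rho>="\<rho> k" and \<eta>="\<eta> k" and \<epsilon>="e k"]) (auto simp: e
          \<eta> \<rho>)
  qed
qed

lemma W_lim: "(\<lambda>k. W k / (2 * (e k)\<^sup>2)) \<longlonglongrightarrow> 1"
proof -
  have "filterlim (\<lambda>k. inverse (1 / ((e k)\<^sup>2 * L k))) at_top sequentially"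
    using parameters_ok by (intro filterlim_inverse_at_top[OF eL]) (auto elim!: eventually_mono)
  hence "filterlim (\<lambda>k. (e k)\<^sup>2 * L k / 32) at_top sequentially"
    using filterlim_tendsto_pos_mult_at_top[OF tendsto_const[of "1/32 :: real"]] by (force simp:
        mult.commute)
  hence ex: "(\<lambda>k. exp (- ((e k)\<^sup>2 * L k / 32))) \<longlonglongrightarrow> 0"
    by (intro filterlim_compose[OF exp_at_bot]) (simp add: filterlim_uminus_at_top)
  have "(\<lambda>k. exp (- (8 * ((w k)\<^sup>2 * L k / k))) * ((up_good_bound (L k) (\<delta> k) (\<delta>' k) (w k) / (2 * e
      k)) * (down_good_bound (L k) (\<delta> k) (\<delta>' k) (w k) / e k)) -
     4 * ((up_bound (L k) (\<delta> k) / (2 * e k)) * (down_bound (L k) (\<delta> k) / e k) * exp (- ((e k)\<^sup>2 * L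
         k / 32))))
    \<longlonglongrightarrow> exp (- (8 * 0)) * (1 * 1) - 4 * (1 * 1 * 0)"
    by (intro tendsto_intros up_good_bound_lim down_good_bound_lim up_bound_lim down_bound_lim ex
        wk)
  thus ?thesis
    by (simp add: W_def diff_divide_distrib power2_eq_square mult_ac)
qed

text \<open>\<open>q\<close> ranges over anything between the restricted and the full probability,
  so one sandwich serves both claims.\<close>

lemma squeeze_TREE:
  assumes "eventually (\<lambda>k. measure_pmf.prob (placement k (p k)) (TREE k \<inter> normal_placements k (p k)
      (L k) (w k)) \<le> q k) sequentially"
    and "eventually (\<lambda>k. q k \<le> measure_pmf.prob (placement k (p k)) (TREE k)) sequentially"
  shows "(\<lambda>k. q k / (2 * (e k)\<^sup>2)) \<longlonglongrightarrow> 1"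
proof (rule tendsto_sandwich[OF _ _ W_lim U_lim])
  show "eventually (\<lambda>k. W k / (2 * (e k)\<^sup>2) \<le> q k / (2 * (e k)\<^sup>2)) sequentially"
    using W_le assms(1) by eventually_elim (rule divide_right_mono, auto)
  show "eventually (\<lambda>k. q k / (2 * (e k)\<^sup>2) \<le> U k / (2 * (e k)\<^sup>2)) sequentially"
    using U_ge assms(2) by eventually_elim (rule divide_right_mono, auto)
qed

end

end

section \<open>Reduction to slowly growing deviations, and the choice of \<open>L\<close>\<close>

lemma normal_placements_mono:
  assumes "w \<le> w'"
  shows "normal_placements k p L w \<subseteq> normal_placements k p L w'"
  using mult_right_mono[OF assms, of "sqrt L"] by (auto simp: normal_placements_def)

text \<open>A given \<omega> may grow too fast for the deviation condition of
  \<open>squeeze_TREE\<close>. A smaller \<open>w\<close> only shrinks the normal event, so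
  \<open>q\<close> remains an upper bound for its probability.\<close>

lemma TREE_asymptotics:
  fixes p e \<omega> q :: "nat \<Rightarrow> real" and L :: "nat \<Rightarrow> nat"
  assumes p: "eventually (\<lambda>k. p k > 0) sequentially"
    and e: "\<And>k. e k = p k * real k / 2" "e \<longlonglongrightarrow> 0"
    and ek: "(\<lambda>k. 1 / ((e k)\<^sup>2 * real k)) \<longlonglongrightarrow> 0"
    and L1: "eventually (\<lambda>k. L k \<ge> 1) sequentially"
    and Lk: "(\<lambda>k. real (L k) / real k) \<longlonglongrightarrow> 0"
    and eL: "(\<lambda>k. 1 / ((e k)\<^sup>2 * real (L k))) \<longlonglongrightarrow> 0"
    and \<omega>: "filterlim \<omega> at_top sequentially" "(\<lambda>k. (\<omega> k)\<^sup>2 * L k / k) \<longlonglongrightarrow> 0"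
    and q: "eventually (\<lambda>k. measure_pmf.prob (placement k (p k)) (TREE k \<inter> normal_placements k (p k)
        (L k) (\<omega> k)) \<le> q k) sequentially"
      "eventually (\<lambda>k. q k \<le> measure_pmf.prob (placement k (p k)) (TREE k)) sequentially"
  shows "(\<lambda>k. q k / (2 * (e k)\<^sup>2)) \<longlonglongrightarrow> 1"
proof -
  \<comment> \<open>The fourth root makes r^2 = \<epsilon> sqrt L; once r is at least 4, r is at
    most r^2/4, which is the required bound on \<open>w\<close>, and r still tends to
    infinity.\<close>
  define r where "r k = sqrt (sqrt ((e k)\<^sup>2 * L k))" for k
  define w where "w k = min (\<omega> k) (r k)" for k
  have e_pos: "eventually (\<lambda>k. e k > 0) sequentially"
    using p eventually_gt_at_top[of 0] by eventually_elim (auto simp: e)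
  have "filterlim (\<lambda>k. inverse (1 / ((e k)\<^sup>2 * L k))) at_top sequentially"
    using e_pos L1 by (intro filterlim_inverse_at_top[OF eL]) (auto elim: eventually_elim2)
  hence "filterlim r at_top sequentially"
    unfolding r_def by (intro filterlim_compose[OF sqrt_at_top]) simp
  hence r_ge: "eventually (\<lambda>k. r k \<ge> Z) sequentially" for Z
    by (simp add: filterlim_at_top)
  have \<omega>_ge: "eventually (\<lambda>k. \<omega> k \<ge> Z) sequentially" for Z
    using \<omega>(1) by (simp add: filterlim_at_top)
  have w: "filterlim w at_top sequentially"
    unfolding filterlim_at_top
  proof
    fix Z show "eventually (\<lambda>k. Z \<le> w k) sequentially"
      using r_ge[of Z] \<omega>_ge[of Z] by eventually_elim (simp add: w_def)
  qed
  have wk: "(\<lambda>k. (w k)\<^sup>2 * L k / k) \<longlonglongrightarrow> 0"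
  proof (rule tendsto_sandwich[OF _ _ tendsto_const \<omega>(2)])
    show "eventually (\<lambda>k. (w k)\<^sup>2 * L k / k \<le> (\<omega> k)\<^sup>2 * L k / k) sequentially"
      using \<omega>_ge[of 0] r_ge[of 0]
      by eventually_elim (intro divide_right_mono mult_right_mono power_mono, auto simp: w_def)
  qed auto
  have wL: "eventually (\<lambda>k. w k * sqrt (L k) \<le> e k * L k / 4) sequentially"
    using r_ge[of 4] e_pos
  proof eventually_elim
    case (elim k)
    have "r k * 4 \<le> r k * r k" using elim by (intro mult_left_mono) auto
    also have "r k * r k = sqrt ((e k)\<^sup>2 * L k)" by (simp add: r_def)
    also have "\<dots> = e k * sqrt (L k)" using elim by (simp add: real_sqrt_mult)
    finally have "w k \<le> e k * sqrt (L k) / 4" by (simp add: w_def min_def)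
    hence "w k * sqrt (L k) \<le> (e k * sqrt (L k)) / 4 * sqrt (L k)"
      by (intro mult_right_mono) auto
    thus ?case by (simp add: mult.assoc)
  qed
  show ?thesis
  proof (rule squeeze_TREE[OF p e ek L1 Lk eL refl refl w wk wL _ q(2)])
    show "eventually (\<lambda>k. measure_pmf.prob (placement k (p k)) (TREE k \<inter> normal_placements k (p k)
        (L k) (w k)) \<le> q k) sequentially"
      using q(1)
    proof eventually_elim
      case (elim k)
      have "measure_pmf.prob (placement k (p k)) (TREE k \<inter> normal_placements k (p k) (L k) (w k)) \<le>
          measure_pmf.prob (placement k (p k)) (TREE k \<inter> normal_placements k (p k) (L k) (\<omega> k))"
        using normal_placements_mono[of "w k" "\<omega> k" k "p k" "L k"]
        by (intro measure_pmf.finite_measure_mono) (auto simp: w_def)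
      with elim show ?case by simp
    qed
  qed
qed

theorem theorem9:
  fixes p \<epsilon> :: "nat \<Rightarrow> real"
  assumes "eventually (\<lambda>k. 0 < p k) sequentially"
    and "(\<lambda>k. real k powr (-3/2)) \<in> o[sequentially](p)"
    and "p \<in> o[sequentially](\<lambda>k. 1 / real k)"
    and "\<And>k. \<epsilon> k = p k * real k / 2"
  shows "(\<forall>(L :: nat \<Rightarrow> nat) (\<omega> :: nat \<Rightarrow> real).
            (\<lambda>k. 1 / (real k * p k)\<^sup>2) \<in> o[sequentially](\<lambda>k. real (L k)) \<longrightarrow>
            (\<lambda>k. real (L k)) \<in> o[sequentially](\<lambda>k. real k powr (-1/2) * (1 / p k)) \<longrightarrow>
            filterlim \<omega> at_top sequentially \<longrightarrow>
            (\<lambda>k. \<omega> k * sqrt (real (L k))) \<in> o[sequentially](\<lambda>k. sqrt (real k)) \<longrightarrow>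
            \<omega> \<in> o[sequentially](\<lambda>k. sqrt (real (L k))) \<longrightarrow>
            (\<lambda>k. measure_pmf.prob (placement k (p k))
                    (TREE k \<inter> normal_placements k (p k) (L k) (\<omega> k)))
              \<sim>[sequentially] (\<lambda>k. 2 * (\<epsilon> k)\<^sup>2))
       \<and> (\<lambda>k. measure_pmf.prob (placement k (p k)) (TREE k)) \<sim>[sequentially] (\<lambda>k. 2 * (\<epsilon> k)\<^sup>2)"
proof -
  have p: "eventually (\<lambda>k. 0 < p k \<and> k > 0) sequentially"
    using assms(1) eventually_gt_at_top[of 0] by eventually_elim auto
  have small: "(\<lambda>k. real k powr (-3/2) / p k) \<longlonglongrightarrow> 0"
    by (rule smalloD_tendsto[OF assms(2)])
  have e0: "\<epsilon> \<longlonglongrightarrow> 0"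
  proof -
    have "(\<lambda>k. p k / (1 / real k) / 2) \<longlonglongrightarrow> 0 / 2"
      by (intro tendsto_intros smalloD_tendsto[OF assms(3)]) auto
    thus ?thesis by (simp add: assms(4)[abs_def])
  qed
  have ek: "(\<lambda>k. 1 / ((\<epsilon> k)\<^sup>2 * real k)) \<longlonglongrightarrow> 0"
  proof -
    \<comment> \<open>Uses \<epsilon>^2 k = p^2 k^3 / 4, so the lower bound on \<open>p\<close>
      enters squared.\<close>
    have "(\<lambda>k. 4 * (real k powr (-3/2) / p k)\<^sup>2) \<longlonglongrightarrow> 4 * 0\<^sup>2"
      by (intro tendsto_intros small)
    moreover have "eventually (\<lambda>k. 4 * (real k powr (-3/2) / p k)\<^sup>2 = 1 / ((\<epsilon> k)\<^sup>2 * real k))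
        sequentially"
      using p
    proof eventually_elim
      case (elim k)
      have "(real k powr (-3/2))\<^sup>2 = real k powr (-3)"
        by (simp add: power2_eq_square flip: powr_add)
      also have "\<dots> = 1 / real k ^ 3"
        using elim by (simp add: powr_minus powr_numeral field_simps)
      finally show ?case
        using elim unfolding assms(4) power_divide by (simp add: power2_eq_square power3_eq_cube)
    qed
    ultimately have "(\<lambda>k. 1 / ((\<epsilon> k)\<^sup>2 * real k)) \<longlonglongrightarrow> 4 * 0\<^sup>2"
      by (rule Lim_transform_eventually)
    thus ?thesis by simp
  qed
  have first: "(\<lambda>k. measure_pmf.prob (placement k (p k)) (TREE k \<inter> normal_placements k (p k) (L k)
      (\<omega> k)))
      \<sim>[sequentially] (\<lambda>k. 2 * (\<epsilon> k)\<^sup>2)"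
    if a: "(\<lambda>k. 1 / (real k * p k)\<^sup>2) \<in> o[sequentially](\<lambda>k. real (L k))"
      and b: "(\<lambda>k. real (L k)) \<in> o[sequentially](\<lambda>k. real k powr (-1/2) * (1 / p k))"
      and c: "filterlim \<omega> at_top sequentially"
      and d: "(\<lambda>k. \<omega> k * sqrt (real (L k))) \<in> o[sequentially](\<lambda>k. sqrt (real k))"
    for L :: "nat \<Rightarrow> nat" and \<omega> :: "nat \<Rightarrow> real"
  proof (rule asymp_equivI', rule TREE_asymptotics[OF assms(1,4) e0 ek _ _ _ c])
    have "eventually (\<lambda>k. norm (1 / (real k * p k)\<^sup>2) \<le> 1 * norm (real (L k))) sequentially"
      by (rule landau_o.smallD[OF a]) simp
    thus L1: "eventually (\<lambda>k. L k \<ge> 1) sequentially"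
      using p
    proof eventually_elim
      case (elim k)
      have "0 < 1 / (real k * p k)\<^sup>2" using elim by simp
      also have "\<dots> \<le> real (L k)" using elim by simp
      finally show ?case by simp
    qed
    \<comment> \<open>L/k factors into the ratio controlled by the upper bound on \<open>L\<close>
      and the one controlled by the lower bound on \<open>p\<close>.\<close>
    have "(\<lambda>k. (real (L k) / (real k powr (-1/2) * (1 / p k))) * (real k powr (-3/2) / p k)) \<longlonglongrightarrow> 0 *
        0"
      by (intro tendsto_intros small smalloD_tendsto[OF b])
    moreover have "eventually (\<lambda>k. (real (L k) / (real k powr (-1/2) * (1 / p k))) * (real k powr
        (-3/2) / p k) =
        real (L k) / real k) sequentially"
      using p
    proof eventually_elim
      case (elim k)
      have "real k powr (-3/2) = real k powr (-1/2 + - 1)" by simp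
      also have "\<dots> = real k powr (-1/2) / real k"
        using elim by (subst powr_add) (simp add: powr_minus field_simps)
      finally show ?case using elim by simp
    qed
    ultimately show "(\<lambda>k. real (L k) / real k) \<longlonglongrightarrow> 0" by (auto intro: Lim_transform_eventually)
    have "(\<lambda>k. 4 * (1 / (real k * p k)\<^sup>2 / real (L k))) \<longlonglongrightarrow> 4 * 0"
      by (intro tendsto_intros smalloD_tendsto[OF a])
    thus "(\<lambda>k. 1 / ((\<epsilon> k)\<^sup>2 * real (L k))) \<longlonglongrightarrow> 0"
      by (simp add: assms(4) power_divide power_mult_distrib mult_ac)
    have "(\<lambda>k. (\<omega> k * sqrt (real (L k)) / sqrt (real k))\<^sup>2) \<longlonglongrightarrow> 0\<^sup>2"
      by (intro tendsto_intros smalloD_tendsto[OF d])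
    thus "(\<lambda>k. (\<omega> k)\<^sup>2 * real (L k) / real k) \<longlonglongrightarrow> 0"
      by (simp add: power_divide power_mult_distrib)
  qed (auto intro!: always_eventually measure_pmf.finite_measure_mono)
  \<comment> \<open>The geometric mean of 1/\<epsilon>^2 and k, the two ends of the admissible
    range: both L/k and 1/(\<epsilon>^2 L) are then of order sqrt (1/(\<epsilon>^2 k)).\<close>
  define L where "L k = nat \<lceil>sqrt (real k) / \<epsilon> k\<rceil>" for k
  \<comment> \<open>The fourth root of k/L tends to infinity, while \<omega>^2 L/k = sqrt (L/k)
    still vanishes.\<close>
  define \<omega> where "\<omega> k = sqrt (sqrt (real k / real (L k)))" for k
  have L: "eventually (\<lambda>k. sqrt (real k) / \<epsilon> k \<le> real (L k) \<and> real (L k) \<le> sqrt (real k) / \<epsilon> k + 1 \<and>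
      \<epsilon> k > 0 \<and> L k \<ge> 1 \<and> k > 0) sequentially"
    using p
  proof eventually_elim
    case (elim k)
    hence e: "\<epsilon> k > 0" unfolding assms(4) by simp
    hence "sqrt (real k) / \<epsilon> k > 0" using elim by simp
    hence "0 < \<lceil>sqrt (real k) / \<epsilon> k\<rceil>" by (simp only: zero_less_ceiling)
    hence "nat \<lceil>sqrt (real k) / \<epsilon> k\<rceil> \<ge> 1" by linarith
    thus ?case using e elim unfolding L_def by (auto simp: of_nat_nat)
  qed
  have sq: "sqrt (1 / (x\<^sup>2 * real k)) = sqrt (real k) / x / real k" if "x > 0" "k > 0" for x :: real
      and k :: nat
    using that by (simp add: real_sqrt_divide real_sqrt_mult field_simps)
  have Lk: "(\<lambda>k. real (L k) / real k) \<longlonglongrightarrow> 0"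
  proof (rule tendsto_sandwich[OF _ _ tendsto_const])
    show "(\<lambda>k. sqrt (1 / ((\<epsilon> k)\<^sup>2 * real k)) + 1 / real k) \<longlonglongrightarrow> 0"
      using tendsto_add[OF tendsto_real_sqrt[OF ek] lim_1_over_n] by simp
    show "eventually (\<lambda>k. real (L k) / real k \<le> sqrt (1 / ((\<epsilon> k)\<^sup>2 * real k)) + 1 / real k)
        sequentially"
      using L
    proof eventually_elim
      case (elim k)
      hence "real (L k) / real k \<le> (sqrt (real k) / \<epsilon> k + 1) / real k" by (intro divide_right_mono)
          auto
      also have "\<dots> = sqrt (real k) / \<epsilon> k / real k + 1 / real k" by (rule add_divide_distrib)
      finally show ?case using elim by (subst sq) auto
    qed
  qed auto
  have second: "(\<lambda>k. measure_pmf.prob (placement k (p k)) (TREE k)) \<sim>[sequentially] (\<lambda>k. 2 * (\<epsilon>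
      k)\<^sup>2)"
  proof (rule asymp_equivI', rule TREE_asymptotics[OF assms(1,4) e0 ek _ Lk, where \<omega>=\<omega>])
    show "eventually (\<lambda>k. L k \<ge> 1) sequentially" using L by eventually_elim auto
    show "(\<lambda>k. 1 / ((\<epsilon> k)\<^sup>2 * real (L k))) \<longlonglongrightarrow> 0"
    proof (rule tendsto_sandwich[OF _ _ tendsto_const])
      show "(\<lambda>k. sqrt (1 / ((\<epsilon> k)\<^sup>2 * real k))) \<longlonglongrightarrow> 0"
        using tendsto_real_sqrt[OF ek] by simp
      show "eventually (\<lambda>k. 1 / ((\<epsilon> k)\<^sup>2 * real (L k)) \<le> sqrt (1 / ((\<epsilon> k)\<^sup>2 * real k)))
          sequentially"
        using L
      proof eventually_elim
        case (elim k)
        have "1 / ((\<epsilon> k)\<^sup>2 * real (L k)) \<le> 1 / ((\<epsilon> k)\<^sup>2 * (sqrt (real k) / \<epsilon> k))"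
          using elim by (intro divide_left_mono mult_left_mono mult_pos_pos) auto
        also have "\<dots> = sqrt (real k) / \<epsilon> k / real k"
          using elim by (simp add: power2_eq_square field_simps)
        finally show ?case using elim by (subst sq) auto
      qed
    qed auto
    have "filterlim (\<lambda>k. inverse (real (L k) / real k)) at_top sequentially"
      using L by (intro filterlim_inverse_at_top[OF Lk]) (auto elim!: eventually_mono)
    thus "filterlim \<omega> at_top sequentially"
      unfolding \<omega>_def by (intro filterlim_compose[OF sqrt_at_top]) simp
    have "(\<lambda>k. sqrt (real (L k) / real k)) \<longlonglongrightarrow> sqrt 0" by (intro tendsto_intros Lk)
    moreover have "eventually (\<lambda>k. sqrt (real (L k) / real k) = (\<omega> k)\<^sup>2 * real (L k) / real k)
        sequentially"
      using L
    proof eventually_elim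
      case (elim k)
      define x where "x = sqrt (real (L k) / real k)"
      have x: "x > 0" "x * x = real (L k) / real k" using elim by (auto simp: x_def)
      have "(\<omega> k)\<^sup>2 = sqrt (real k / real (L k))" by (simp add: \<omega>_def)
      also have "\<dots> = 1 / x" using elim by (simp add: x_def real_sqrt_divide)
      finally have "(\<omega> k)\<^sup>2 * real (L k) / real k = 1 / x * (x * x)" unfolding x(2) by simp
      also have "\<dots> = x" using x(1) by simp
      finally show ?case by (simp only: x_def)
    qed
    ultimately show "(\<lambda>k. (\<omega> k)\<^sup>2 * real (L k) / real k) \<longlonglongrightarrow> 0"
      by (auto intro: Lim_transform_eventually)
  qed (auto intro!: always_eventually measure_pmf.finite_measure_mono)
  show ?thesis using first second by blast
qed

end
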